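(* The dg algebra $\mathcal{A}$ and the $A_\infty$ algebra $\mathcal{B}^\infty$ are quasi-isomorphic as $A_\infty$ algebras over $\mathbb{F}$.
   Context: $\mathbb{F}=\mathbb{F}_2$, $\widetilde{R}^\partial=\mathbb{F}[x,y,z]$. Let $\widetilde{M}(\mathcal{D}_0)$ be the matrix factorization $\widetilde{R}^\partial\rightleftarrows\widetilde{R}^\partial$ with maps $x$ (from the first copy to the second) and $yz$ (back), and $\widetilde{M}(\mathcal{D}_1)$ the one with maps $y$ and $xz$; both have potential $xyz$ with total differential $d_0$, $d_0^2=xyz\cdot\mathrm{id}$. Let $\mathcal{A}=\mathrm{End}_{\widetilde{R}^\partial}(\widetilde{M}(\mathcal{D}_0)\oplus\widetilde{M}(\mathcal{D}_1))$ be the algebra of all $\widetilde{R}^\partial$-linear maps of the underlying free modules (irrespective of the differentials), with composition as product and differential $f\mapsto f\circ d_0+d_0\circ f$. $\mathcal{B}$: the path algebra over $\mathbb{F}$ of the quiver with vertices $\circ,\bullet$, loops $D_\circ,D_\bullet$ and arrows ${}_\circ S_\bullet,{}_\bullet S_\circ$, modulo: every product of a $D$-arrow with an $S$-arrow is zero (${}_a x_b\cdot{}_b y_c$ denotes concatenation). Basis: idempotents, $D_\circ^n,D_\bullet^n$ ($n\ge1$), alternating $S$-words $S^n$ ($n\ge1$). $\mathcal{B}^\infty$ has the same space, $\mu_1=0$, $\mu_2$ the product of $\mathcal{B}$, and higher products from disk sequences: $E_4$ consists of the cyclic permutations of $({}_\circ S_\bullet,{}_\bullet D_\bullet,{}_\bullet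 S_\circ,{}_\circ D_\circ)$; $E_{2m+2}$ is obtained from $E_{2m}$ by replacing two consecutive entries via one of $(D^k_\bullet,{}_\bullet S^\ell)\mapsto(D^{k+1}_\bullet,{}_\bullet S_\circ,{}_\circ D_\circ,{}_\circ S^{\ell+1})$, $(D^k_\circ,{}_\circ S^\ell)\mapsto(D^{k+1}_\circ,{}_\circ S_\bullet,{}_\bullet D_\bullet,{}_\bullet S^{\ell+1})$, $(S^k_\bullet,{}_\bullet D^\ell)\mapsto(S^{k+1}_\circ,{}_\circ D_\circ,{}_\circ S_\bullet,{}_\bullet D^{\ell+1})$, $(S^k_\circ,{}_\circ D^\ell)\mapsto(S^{k+1}_\bullet,{}_\bullet D_\bullet,{}_\bullet S_\circ,{}_\circ D^{\ell+1})$ (left/right subscripts denote start/end vertices). For $(a_1,\dots,a_{2m})\in E_{2m}$ and $b\in\{\text{idempotents},S^n,D^n:n\ge1\}$: $\mu_{2m}(a_1,\dots,a_{2m}b)=b$ if $a_{2m}b\ne0$, and $\mu_{2m}(ba_1,\dots,a_{2m})=b$ if $ba_1\ne0$; all other higher products of basis elements vanish, extended multilinearly. E.g. $\mu_4(D,S,D,S^k)=S^{k-1}$, $\mu_4(S^k,D,S,D)=S^{k-1}$ for $k\ge1$. *)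

theory Defs
  imports "HOL-Analysis.Finite_Cartesian_Product" "HOL-Library.Numeral_Type"
          "HOL-Library.Z2" "HOL-Library.Poly_Mapping" "HOL-Library.Product_Plus"
begin

text \<open>An F_2-vector space is an abelian group in which x + x = 0; F_2-linear maps are
  exactly additive maps.  An operation of every arity is modelled as a function on lists:
  mu as is mu_n(a_1,...,a_n) where n = length as.\<close>

definition char2 :: "'v::ab_group_add itself \<Rightarrow> bool" where
  "char2 _ \<longleftrightarrow> (\<forall>x::'v. x + x = 0)"

definition multilinear :: "('v::ab_group_add list \<Rightarrow> 'w::ab_group_add) \<Rightarrow> bool" where
  "multilinear f \<longleftrightarrow> (\<forall>xs a b ys. f (xs @ (a + b) # ys) = f (xs @ a # ys) + f (xs @ b # ys))"

text \<open>A-infinity relations (no signs are needed in characteristic 2):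
  sum over i + j + k = n, j >= 1, of mu_{i+1+k}(a_1..a_i, mu_j(a_{i+1}..a_{i+j}), ...) = 0.\<close>

definition ainf_algebra :: "('v::ab_group_add list \<Rightarrow> 'v) \<Rightarrow> bool" where
  "ainf_algebra mu \<longleftrightarrow> char2 TYPE('v) \<and> multilinear mu \<and>
     (\<forall>as. as \<noteq> [] \<longrightarrow>
        (\<Sum>i<length as. \<Sum>j\<in>{1..length as - i}.
            mu (take i as @ mu (take j (drop i as)) # drop (i + j) as)) = 0)"

definition blocks :: "'a list \<Rightarrow> 'a list list set" where
  "blocks as = {ps. concat ps = as \<and> [] \<notin> set ps}"

definition ainf_morphism ::
  "('v::ab_group_add list \<Rightarrow> 'v) \<Rightarrow> ('w::ab_group_add list \<Rightarrow> 'w) \<Rightarrow> ('v list \<Rightarrow> 'w) \<Rightarrow> bool" where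
  "ainf_morphism muV muW f \<longleftrightarrow> multilinear f \<and>
     (\<forall>as. as \<noteq> [] \<longrightarrow>
        (\<Sum>i<length as. \<Sum>j\<in>{1..length as - i}.
            f (take i as @ muV (take j (drop i as)) # drop (i + j) as))
        = (\<Sum>ps\<in>blocks as. muW (map f ps)))"

definition ainf_quasi_iso ::
  "('v::ab_group_add list \<Rightarrow> 'v) \<Rightarrow> ('w::ab_group_add list \<Rightarrow> 'w) \<Rightarrow> ('v list \<Rightarrow> 'w) \<Rightarrow> bool" where
  "ainf_quasi_iso muV muW f \<longleftrightarrow> ainf_morphism muV muW f \<and>
     (\<forall>v. muV [v] = 0 \<longrightarrow> (\<exists>u. f [v] = muW [u]) \<longrightarrow> (\<exists>u. v = muV [u])) \<and>
     (\<forall>w. muW [w] = 0 \<longrightarrow> (\<exists>v u. muV [v] = 0 \<and> f [v] - w = muW [u]))"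

type_synonym Rpoly = "(nat \<times> nat \<times> nat) \<Rightarrow>\<^sub>0 bit"

definition px :: Rpoly where "px = Poly_Mapping.single (1, 0, 0) 1"
definition py :: Rpoly where "py = Poly_Mapping.single (0, 1, 0) 1"
definition pz :: Rpoly where "pz = Poly_Mapping.single (0, 0, 1) 1"

text \<open>The underlying free module of M(D_0) + M(D_1) is R^4 with basis indices
  0,1 (first and second copy of M(D_0)) and 2,3 (first and second copy of M(D_1)).
  Endomorphisms are 4x4 matrices acting on column vectors, composition f o g = f ** g.
  d_0 maps copy 0 -> copy 1 by x, copy 1 -> copy 0 by yz, copy 2 -> copy 3 by y,
  copy 3 -> copy 2 by xz.\<close>

type_synonym Aalg = "Rpoly ^ 4 ^ 4"

definition d0 :: Aalg where
  "d0 = (\<chi> i j.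
     if i = 1 \<and> j = 0 then px
     else if i = 0 \<and> j = 1 then py * pz
     else if i = 3 \<and> j = 2 then py
     else if i = 2 \<and> j = 3 then px * pz
     else 0)"

definition muA :: "Aalg list \<Rightarrow> Aalg" where
  "muA as = (case as of
      [f] \<Rightarrow> f ** d0 + d0 ** f
    | [f, g] \<Rightarrow> f ** g
    | _ \<Rightarrow> 0)"

datatype vtx = Wh | Bk

text \<open>Basis of B: Idm v (idempotent at v), Dg v k = D_v^(k+1),
  Sg v k = the alternating S-word of length k+1 starting at vertex v.\<close>

datatype bgen = Idm vtx | Dg vtx nat | Sg vtx nat

fun other :: "vtx \<Rightarrow> vtx" where
  "other Wh = Bk" | "other Bk = Wh"

fun src :: "bgen \<Rightarrow> vtx" where
  "src (Idm v) = v" | "src (Dg v k) = v" | "src (Sg v k) = v"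

fun tgt :: "bgen \<Rightarrow> vtx" where
  "tgt (Idm v) = v" | "tgt (Dg v k) = v"
| "tgt (Sg v k) = (if even k then other v else v)"

text \<open>Product of basis elements (concatenation of paths), None meaning zero.\<close>

fun bmul :: "bgen \<Rightarrow> bgen \<Rightarrow> bgen option" where
  "bmul (Idm v) b = (if src b = v then Some b else None)"
| "bmul a (Idm v) = (if tgt a = v then Some a else None)"
| "bmul (Dg v k) (Dg w l) = (if v = w then Some (Dg v (k + l + 1)) else None)"
| "bmul (Sg v k) (Sg w l) = (if tgt (Sg v k) = w then Some (Sg v (k + l + 1)) else None)"
| "bmul (Dg v k) (Sg w l) = None"
| "bmul (Sg v k) (Dg w l) = None"

text \<open>Disk sequences (union of all E_{2m}, m >= 2).  Exponent/length conventions: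
  D^k_v = Dg v (k-1); an S-word of length k starting at v is Sg v (k-1); ending at v it is
  Sg u (k-1) with tgt (Sg u (k-1)) = v.\<close>

inductive disk :: "bgen list \<Rightarrow> bool" where
  e4_1: "disk [Sg Wh 0, Dg Bk 0, Sg Bk 0, Dg Wh 0]"
| e4_2: "disk [Dg Bk 0, Sg Bk 0, Dg Wh 0, Sg Wh 0]"
| e4_3: "disk [Sg Bk 0, Dg Wh 0, Sg Wh 0, Dg Bk 0]"
| e4_4: "disk [Dg Wh 0, Sg Wh 0, Dg Bk 0, Sg Bk 0]"
| rDS_Bk: "disk (xs @ [Dg Bk k, Sg Bk l] @ ys) \<Longrightarrow>
      disk (xs @ [Dg Bk (Suc k), Sg Bk 0, Dg Wh 0, Sg Wh (Suc l)] @ ys)"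
| rDS_Wh: "disk (xs @ [Dg Wh k, Sg Wh l] @ ys) \<Longrightarrow>
      disk (xs @ [Dg Wh (Suc k), Sg Wh 0, Dg Bk 0, Sg Bk (Suc l)] @ ys)"
| rSD_Bk: "tgt (Sg u k) = Bk \<Longrightarrow> disk (xs @ [Sg u k, Dg Bk l] @ ys) \<Longrightarrow>
      disk (xs @ [Sg u (Suc k), Dg Wh 0, Sg Wh 0, Dg Bk (Suc l)] @ ys)"
| rSD_Wh: "tgt (Sg u k) = Wh \<Longrightarrow> disk (xs @ [Sg u k, Dg Wh l] @ ys) \<Longrightarrow>
      disk (xs @ [Sg u (Suc k), Dg Bk 0, Sg Bk 0, Dg Wh (Suc l)] @ ys)"

definition right_disk :: "bgen list \<Rightarrow> bgen \<Rightarrow> bool" where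
  "right_disk cs b \<longleftrightarrow> (\<exists>as c. disk as \<and> bmul (last as) b = Some c \<and> cs = butlast as @ [c])"

definition left_disk :: "bgen list \<Rightarrow> bgen \<Rightarrow> bool" where
  "left_disk cs b \<longleftrightarrow> (\<exists>as c. disk as \<and> bmul b (hd as) = Some c \<and> cs = c # tl as)"

definition muB_basis :: "bgen list \<Rightarrow> bgen \<Rightarrow>\<^sub>0 bit" where
  "muB_basis cs =
     (if length cs = 2 then
        (case bmul (cs ! 0) (cs ! 1) of None \<Rightarrow> 0 | Some c \<Rightarrow> Poly_Mapping.single c 1)
      else if length cs \<ge> 3 then
        (if \<exists>b. right_disk cs b then Poly_Mapping.single (SOME b. right_disk cs b) 1
         else if \<exists>b. left_disk cs b then Poly_Mapping.single (SOME b. left_disk cs b) 1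
         else 0)
      else 0)"

text \<open>Multilinear extension over F_2 (every nonzero coefficient is 1).\<close>

definition muB :: "(bgen \<Rightarrow>\<^sub>0 bit) list \<Rightarrow> (bgen \<Rightarrow>\<^sub>0 bit)" where
  "muB vs = (\<Sum>cs\<in>listset (map Poly_Mapping.keys vs). muB_basis cs)"

end

theory Submission
  imports Defs "HOL-Analysis.Cartesian_Space"
begin

text \<open>An A-infinity morphism \<open>f\<close> from \<open>\<B>\<^sup>\<infinity>\<close> to the dg algebra \<open>\<A>\<close> is a twisting element for the
  bar construction.  As \<open>\<B>\<close> is a quadratic monomial algebra, the bar complex contracts onto the
  Koszul words (alternating words of arrows): a word is paired with its refinement at the first
  place where an arrow can be split off.  Requiring \<open>f\<close> to vanish on refined words, and prescribing
  ten matrices on Koszul words, determines \<open>f\<close> by recursion.  The defect of the morphism equation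
  satisfies a Bianchi identity, which propagates its vanishing from the refined words to all words,
  provided that the A-infinity relation of \<open>\<B>\<^sup>\<infinity>\<close> holds on refined words.  There it is the statement
  that a quadrangulated polygon is cut in a unique way along the first diagonal bounding its root
  quadrilateral.  The full A-infinity relation of \<open>\<B>\<^sup>\<infinity>\<close> comes for free, since the linear part
  of \<open>f\<close> is injective.  That this linear part induces an isomorphism onto the cohomology of \<open>\<A>\<close> is
  a computation with \<open>4 \<times> 4\<close> matrices over \<open>F_2[x,y,z]\<close>.\<close>

section \<open>Words, cuts and insertions\<close>

text \<open>The identity that propagates the vanishing of the defect contains the double insertion,
  that is, the A-infinity relation of the source, which is not known beforehand. Both are therefore
  proved in one induction on the total exponent of a word: the twofold product preserves it, and a
  higher product lowers it by the corners of a polygon. Refined words are within reach because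
  higher products live on alternating words, so that the only product across the bar is the one that
  removes it. A second obstacle is that disk sequences are generated by replacements in the middle
  of a sequence. A code without proper prefixes turns their unique decomposition into parsing from
  the left. The ten matrices come from cohomology: the loops act as \<open>y\<close> and
  \<open>x\<close>, and the two S-arrows compose to \<open>z\<close>. The products of a D-arrow with
  an S-arrow are only null-homotopic. Four matrices are such homotopies, two more bound the
  threefold sums that arise from them, and the fourfold sums are then identities, which is the value
  of the fourfold disk product.\<close>

definition splits :: "'a list \<Rightarrow> ('a list \<times> 'a list) set" where
  "splits w = {(u, v). u @ v = w}"

lemma splits_Nil [simp]: "splits [] = {([], [])}"
  by (auto simp: splits_def)

lemma splits_Cons: "splits (c # w) = insert ([], c # w) ((\<lambda>p. (c # fst p, snd p)) ` splits w)"
  by (force simp: splits_def append_eq_Cons_conv image_iff)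

lemma finite_splits [simp, intro]: "finite (splits w)"
  by (induction w) (auto simp: splits_Cons)

definition cut :: "('a list \<Rightarrow> 'a list \<Rightarrow> 'r::ab_group_add) \<Rightarrow> 'a list \<Rightarrow> 'r" where
  "cut Q w = (\<Sum>(u, v)\<in>splits w. Q u v)"

lemma cut_Nil [simp]: "cut Q [] = Q [] []"
  by (simp add: cut_def)

lemma cut_Cons: "cut Q (c # w) = Q [] (c # w) + cut (\<lambda>u. Q (c # u)) w"
proof -
  have inj: "inj_on (\<lambda>p. (c # fst p, snd p)) (splits w)"
    by (auto simp: inj_on_def)
  have "([], c # w) \<notin> (\<lambda>p. (c # fst p, snd p)) ` splits w"
    by auto
  then show ?thesis
    by (simp add: cut_def splits_Cons sum.reindex[OF inj] split_beta o_def)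
qed

lemma cut_add: "cut (\<lambda>u v. Q u v + Q' u v) w = cut Q w + cut Q' w"
  by (simp add: cut_def split_beta sum.distrib)

lemma cut_zero [simp]: "cut (\<lambda>u v. 0) w = 0"
  by (simp add: cut_def split_beta)

lemma cut_cong:
  assumes "\<And>u v. u @ v = w \<Longrightarrow> Q u v = Q' u v"
  shows "cut Q w = cut Q' w"
  using assms by (auto simp: cut_def splits_def intro!: sum.cong)

lemma cut_neutral: "(\<And>u v. u @ v = w \<Longrightarrow> Q u v = 0) \<Longrightarrow> cut Q w = 0"
  using cut_cong[of w Q "\<lambda>_ _. 0"] by simp

lemma cut_hom:
  assumes "\<And>x y. F (x + y) = F x + F y" "F 0 = 0"
  shows "F (cut Q w) = cut (\<lambda>u v. F (Q u v)) w"
  by (induction w arbitrary: Q) (auto simp: cut_Cons assms)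

text \<open>Coassociativity of deconcatenation: both sides run over the cuts of \<open>w\<close>
  into three pieces.\<close>

lemma cut_assoc:
  "cut (\<lambda>u y. cut (\<lambda>v x. g v x y) u) w = cut (\<lambda>v z. cut (\<lambda>x y. g v x y) z) w"
  by (induction w arbitrary: g) (simp_all add: cut_Cons cut_add add.assoc)

section \<open>Partial products on words and the transpose of the bar differential\<close>

locale word_product =
  fixes m :: "'g list \<Rightarrow> 'g option"
  \<comment> \<open>There is no curvature. Products of all arities are bundled in \<open>m\<close>,
    and a product of basis elements is zero or a single basis element.\<close>
  assumes m_Nil [simp]: "m [] = None"
begin

definition val :: "('g \<Rightarrow> 'r::ab_group_add) \<Rightarrow> 'g list \<Rightarrow> 'r" where
  "val \<phi> v = (case m v of None \<Rightarrow> 0 | Some c \<Rightarrow> \<phi> c)"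

lemma val_Nil [simp]: "val \<phi> [] = 0"
  by (simp add: val_def)

lemma val_add: "val (\<lambda>c. \<phi> c + \<psi> c) v = val \<phi> v + val \<psi> v"
  by (simp add: val_def split: option.split)

lemma val_hom: "F 0 = 0 \<Longrightarrow> F (val \<phi> v) = val (\<lambda>c. F (\<phi> c)) v"
  by (simp add: val_def split: option.split)

definition pre :: "('g list \<Rightarrow> 'r::ab_group_add) \<Rightarrow> 'g list \<Rightarrow> 'r" where
  "pre \<phi> w = cut (\<lambda>v x. val (\<lambda>c. \<phi> (c # x)) v) w"

text \<open>\<open>ins \<phi> w\<close> is the sum of \<open>\<phi>\<close> over all words obtained from \<open>w\<close> by replacing one factor
  by its product; see \<open>ins_eq_cut\<close>.\<close>

primrec ins :: "('g list \<Rightarrow> 'r::ab_group_add) \<Rightarrow> 'g list \<Rightarrow> 'r" where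
  "ins \<phi> [] = 0"
| "ins \<phi> (a # w) = pre \<phi> (a # w) + ins (\<lambda>u. \<phi> (a # u)) w"

lemma ins_eq_cut: "ins \<phi> w = cut (\<lambda>u z. cut (\<lambda>v x. val (\<lambda>c. \<phi> (u @ c # x)) v) z) w"
  by (induction w arbitrary: \<phi>) (simp_all add: cut_Cons pre_def)

lemma pre_add: "pre (\<lambda>u. \<phi> u + \<psi> u) w = pre \<phi> w + pre \<psi> w"
  by (simp add: pre_def val_add cut_add)

lemma ins_add: "ins (\<lambda>u. \<phi> u + \<psi> u) w = ins \<phi> w + ins \<psi> w"
  by (induction w arbitrary: \<phi> \<psi>) (simp_all add: pre_add algebra_simps)

lemma ins_hom:
  assumes "\<And>x y. F (x + y) = F x + F y" "F 0 = 0"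
  shows "F (ins \<phi> w) = ins (\<lambda>u. F (\<phi> u)) w"
  by (simp add: ins_eq_cut cut_hom[of F, OF assms] val_hom[of F, OF assms(2)])

lemma ins_zero [simp]: "ins (\<lambda>u. 0) w = 0"
  using ins_hom[of "\<lambda>x. 0" "\<lambda>u. 0" w] by simp

lemma cut_val: "cut (\<lambda>s x. val (\<lambda>c. Q c s x) v) w = val (\<lambda>c. cut (Q c) w) v"
  by (cases "m v") (simp_all add: val_def)

text \<open>Inserting a product on one side of a cut: the product cannot straddle the cut.\<close>

lemma ins_cut:
  "ins (cut Q) w = cut (\<lambda>s x. ins (\<lambda>s. Q s x) s + ins (Q s) x) w"
proof (induction w arbitrary: Q)
  case Nil
  then show ?case by simp
next
  case (Cons a w)
  have A: "pre (cut Q) (a # w) =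
      pre (Q []) (a # w) + cut (\<lambda>v x. val (\<lambda>c. cut (\<lambda>s. Q (c # s)) x) v) (a # w)"
    by (simp add: pre_def cut_Cons[of Q] val_add cut_add)
  have B: "cut (\<lambda>v x. val (\<lambda>c. cut (\<lambda>s. Q (c # s)) x) v) (a # w)
      = cut (\<lambda>s x. pre (\<lambda>s. Q s x) s) (a # w)"
    by (simp add: pre_def cut_assoc cut_val)
  also have "\<dots> = cut (\<lambda>s x. pre (\<lambda>s. Q s x) (a # s)) w"
    by (simp add: cut_Cons pre_def)
  finally show ?case
    by (simp add: A cut_Cons ins_add cut_add Cons.IH algebra_simps)
qed

text \<open>As \<open>pre\<close> is a cut whose left piece gets multiplied, \<open>ins_cut\<close>
  applies: the other insertion either feeds into the factor that is multiplied or takes place to its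
  right.\<close>

lemma ins_pre:
  "ins (pre \<phi>) w = cut (\<lambda>s x. ins (val (\<lambda>c. \<phi> (c # x))) s + val (\<lambda>c. ins (\<lambda>u. \<phi> (c # u)) x) s) w"
proof -
  have "ins (\<lambda>x. val (\<lambda>c. \<phi> (c # x)) s) x = val (\<lambda>c. ins (\<lambda>u. \<phi> (c # u)) x) s" for s x
    by (cases "m s") (simp_all add: val_def)
  then show ?thesis
    by (simp add: pre_def[abs_def] ins_cut)
qed

text \<open>In characteristic two the disjoint double insertions cancel, only nested ones survive.\<close>

lemma ins_ins:
  fixes \<phi> :: "'g list \<Rightarrow> 'r::ab_group_add"
  assumes char2: "\<And>x::'r. x + x = 0"
  shows "ins (ins \<phi>) w = cut (\<lambda>u z. cut (\<lambda>v x. ins (val (\<lambda>c. \<phi> (u @ c # x))) v) z) w"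
proof (induction w arbitrary: \<phi>)
  case Nil
  then show ?case by simp
next
  case (Cons a w)
  let ?X = "cut (\<lambda>v x. val (\<lambda>c. ins (\<lambda>u. \<phi> (c # u)) x) v) (a # w)"
  let ?T = "cut (\<lambda>v x. ins (val (\<lambda>c. \<phi> (c # x))) v) (a # w)"
  let ?P = "pre (pre \<phi>) (a # w)"
  have 1: "pre (ins \<phi>) (a # w) = ?P + ?X"
    unfolding pre_def[of "ins \<phi>"] pre_def[of "pre \<phi>"] by (simp add: val_add cut_add)
  have "?P + ins (\<lambda>u. pre \<phi> (a # u)) w = ?T + ?X"
    using ins_pre[of \<phi> "a # w"] by (simp only: ins.simps cut_add)
  then have 2: "ins (\<lambda>u. pre \<phi> (a # u)) w = ?P + (?T + ?X)"
    using char2[of ?P] by (metis add.assoc add.left_neutral)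
  have "pre (ins \<phi>) (a # w) + ins (\<lambda>u. pre \<phi> (a # u)) w = (?P + ?P) + (?X + ?X) + ?T"
    unfolding 1 2 by (simp only: ac_simps)
  then have "pre (ins \<phi>) (a # w) + ins (\<lambda>u. pre \<phi> (a # u)) w = ?T"
    by (simp only: char2 add_0)
  then show ?case
    by (simp add: ins_add Cons.IH cut_Cons[of "\<lambda>u z. cut (\<lambda>v x. ins (val (\<lambda>c. \<phi> (u @ c # x))) v) z"]
        flip: add.assoc)
qed

end

text \<open>The product is a parameter because the type class operation \<open>*\<close> on matrices is componentwise.\<close>

locale dga2 =
  fixes M :: "'r::ab_group_add \<Rightarrow> 'r \<Rightarrow> 'r" and d :: "'r \<Rightarrow> 'r"
  assumes char2 [simp]: "x + x = (0::'r)"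
    and M_add_left: "M (x + y) z = M x z + M y z"
    and M_add_right: "M x (y + z) = M x y + M x z"
    and M_assoc: "M (M x y) z = M x (M y z)"
    and d_add: "d (x + y) = d x + d y"
    and d_M: "d (M x y) = M (d x) y + M x (d y)"
    and d_d [simp]: "d (d x) = 0"
begin

lemma M_zero [simp]: "M 0 x = 0" "M x 0 = 0"
  using M_add_left[of 0 0 x] M_add_right[of x 0 0] by simp_all

lemma d_zero [simp]: "d 0 = 0"
  using d_add[of 0 0] by simp

lemma char2_cancel [simp]: "x + (x + y) = (y::'r)"
  by (simp flip: add.assoc)

lemma eq_iff_add_zero: "x = y \<longleftrightarrow> x + y = (0::'r)"
  by (metis char2 char2_cancel add.right_neutral)

definition conv :: "('g list \<Rightarrow> 'r) \<Rightarrow> ('g list \<Rightarrow> 'r) \<Rightarrow> 'g list \<Rightarrow> 'r" where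
  "conv \<phi> \<psi> = cut (\<lambda>u v. M (\<phi> u) (\<psi> v))"

lemma conv_add_left: "conv (\<lambda>u. \<phi> u + \<phi>' u) \<psi> w = conv \<phi> \<psi> w + conv \<phi>' \<psi> w"
  and conv_add_right: "conv \<phi> (\<lambda>u. \<psi> u + \<psi>' u) w = conv \<phi> \<psi> w + conv \<phi> \<psi>' w"
  by (simp_all add: conv_def M_add_left M_add_right cut_add)

lemma conv_assoc: "conv (conv \<phi> \<psi>) \<theta> w = conv \<phi> (conv \<psi> \<theta>) w"
  unfolding conv_def
  by (simp add: cut_hom[of "\<lambda>x. M x _"] cut_hom[of "M _"] M_add_left M_add_right M_assoc cut_assoc)

lemma d_conv: "d (conv \<phi> \<psi> w) = conv (\<lambda>u. d (\<phi> u)) \<psi> w + conv \<phi> (\<lambda>u. d (\<psi> u)) w"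
  by (simp add: conv_def cut_hom[of d] d_add d_M cut_add)

end

locale dga2_words = dga2 M d + word_product m
  for M :: "'r::ab_group_add \<Rightarrow> 'r \<Rightarrow> 'r" and d :: "'r \<Rightarrow> 'r" and m :: "'g list \<Rightarrow> 'g option"
begin

lemma ins_conv: "ins (conv \<phi> \<psi>) w = conv (ins \<phi>) \<psi> w + conv \<phi> (ins \<psi>) w"
  unfolding conv_def
  by (simp add: ins_cut cut_add ins_hom[of "\<lambda>x. M x _"] ins_hom[of "M _"] M_add_left M_add_right)

text \<open>On words of basis elements, \<open>defect f = 0\<close> is the equation of an A-infinity morphism.\<close>

definition defect :: "('g list \<Rightarrow> 'r) \<Rightarrow> 'g list \<Rightarrow> 'r" where
  "defect f w = d (f w) + conv f f w + ins f w"

text \<open>Write \<open>D\<close> for \<open>d\<close> plus insertion. Then the defect is the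
  curvature \<open>D f + f f\<close>. Expanding everything, each term occurs twice except the double
  insertion, which measures the failure of \<open>D\<close> to square to zero.\<close>

lemma bianchi:
  "ins (defect f) w = d (defect f w) + conv (defect f) f w + conv f (defect f) w + ins (ins f) w"
proof -
  have 1: "ins (defect f) w = ins (\<lambda>u. d (f u)) w + (conv (ins f) f w + conv f (ins f) w) + ins (ins f) w"
    by (simp add: defect_def[abs_def] ins_add ins_conv)
  have 2: "d (defect f w) = conv (\<lambda>u. d (f u)) f w + conv f (\<lambda>u. d (f u)) w + ins (\<lambda>u. d (f u)) w"
    by (simp add: defect_def d_add d_conv ins_hom[of d])
  have 3: "conv (defect f) f w = conv (\<lambda>u. d (f u)) f w + conv f (conv f f) w + conv (ins f) f w"
    by (simp add: defect_def[abs_def] conv_add_left conv_assoc)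
  have 4: "conv f (defect f) w = conv f (\<lambda>u. d (f u)) w + conv f (conv f f) w + conv f (ins f) w"
    by (simp add: defect_def[abs_def] conv_add_right)
  show ?thesis
    unfolding 1 2 3 4 by (simp add: ac_simps)
qed

end

section \<open>Disk sequences as quadrangulated polygons\<close>

fun esz :: "bgen \<Rightarrow> nat" where
  "esz (Idm v) = 0" | "esz (Dg v k) = Suc k" | "esz (Sg v k) = Suc k"

fun isD :: "bgen \<Rightarrow> bool" where
  "isD (Dg v k) = True" | "isD _ = False"

definition alt :: "bgen list \<Rightarrow> bool" where
  "alt w \<longleftrightarrow> (\<forall>g\<in>set w. 0 < esz g) \<and> successively (\<lambda>a b. tgt a = src b \<and> isD a \<noteq> isD b) w"

text \<open>A dissection of a polygon into quadrilaterals is coded by walking around its boundary: \<open>True\<close>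
  for each corner of a quadrilateral met at a vertex, \<open>False\<close> for each side of the polygon except
  the one between the last and the first vertex.  In \<open>poly\<close> the root quadrilateral is the one at
  that side; its three other edges are sides of the polygon or carry smaller polygons.  The disk
  sequences are the alternating composable words with such a code, the exponent of an entry being
  the number of quadrilaterals at the vertex.\<close>

fun toks :: "bgen list \<Rightarrow> bool list" where
  "toks [] = []"
| "toks [g] = replicate (esz g) True"
| "toks (g # h # w) = replicate (esz g) True @ False # toks (h # w)"

inductive poly :: "bool list \<Rightarrow> bool" and side :: "bool list \<Rightarrow> bool" where
  tile: "side s1 \<Longrightarrow> side s2 \<Longrightarrow> side s3 \<Longrightarrow> poly (True # s1 @ True # s2 @ True # s3 @ [True])"
| edge: "side [False]"
| inner: "poly s \<Longrightarrow> side s"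

lemma poly_hd: "poly s \<Longrightarrow> \<exists>r. s = True # r"
  by (erule poly.cases) auto

lemma poly_last: "poly s \<Longrightarrow> \<exists>r. s = r @ [True]"
  by (erule poly.cases) auto

lemma poly_not_Nil [simp]: "\<not> poly []"
  using poly_hd by blast

lemma not_poly_False [simp]: "\<not> poly (False # s)"
  using poly_hd by blast

lemma side_TrueD: "side (True # s) \<Longrightarrow> poly (True # s)"
  by (erule side.cases) auto

lemma side_FalseD: "side (False # s) \<Longrightarrow> s = []"
  by (erule side.cases) (auto dest: poly_hd)

lemma side_not_Nil [simp]: "\<not> side []"
  by (auto elim: side.cases)

text \<open>A sum of three odd numbers is odd. Since a word has one entry more than its code has
  separators, disk sequences have even length.\<close>

lemma odd_count:
  "poly s \<Longrightarrow> odd (count_list s False)"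
  "side s \<Longrightarrow> odd (count_list s False)"
  by (induction rule: poly_side.inducts) auto

lemma count_ge3: "poly s \<Longrightarrow> 3 \<le> count_list s False"
proof (erule poly.cases)
  fix s1 s2 s3 assume "s = True # s1 @ True # s2 @ True # s3 @ [True]" "side s1" "side s2" "side s3"
  then show ?thesis
    using odd_pos[OF odd_count(2)[of s1]] odd_pos[OF odd_count(2)[of s2]] odd_pos[OF odd_count(2)[of s3]]
    by simp
qed

text \<open>The grammar is parsed from the left without choice, because the first letter of a side
  tells an edge from a polygon. The tails \<open>x\<close> and \<open>y\<close> are arbitrary so
  that the induction can move on to the next side of a tile.\<close>

lemma prefix_free:
  "poly s \<Longrightarrow> poly t \<Longrightarrow> s @ x = t @ y \<Longrightarrow> s = t"
  "side s \<Longrightarrow> side t \<Longrightarrow> s @ x = t @ y \<Longrightarrow> s = t"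
proof (induction arbitrary: t x y and t x y rule: poly_side.inducts)
  case (tile s1 s2 s3)
  from tile.prems(1) obtain t1 t2 t3 where t: "t = True # t1 @ True # t2 @ True # t3 @ [True]"
    and st: "side t1" "side t2" "side t3"
    by (auto elim: poly.cases)
  have e1: "s1 @ (True # s2 @ True # s3 @ True # x) = t1 @ (True # t2 @ True # t3 @ True # y)"
    using tile.prems(2) t by simp
  from tile.IH(1)[OF st(1) e1] have 1: "s1 = t1" .
  from e1 1 have e2: "s2 @ (True # s3 @ True # x) = t2 @ (True # t3 @ True # y)"
    by simp
  from tile.IH(2)[OF st(2) e2] have 2: "s2 = t2" .
  from e2 2 have e3: "s3 @ (True # x) = t3 @ (True # y)"
    by simp
  from tile.IH(3)[OF st(3) e3] have 3: "s3 = t3" .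
  show ?case using t 1 2 3 by simp
next
  case edge
  then obtain t' where "t = False # t'"
    by (cases t rule: list.exhaust) auto
  with edge side_FalseD show ?case
    by blast
next
  case (inner s)
  from poly_hd[OF inner.hyps] obtain r where "s = True # r" by blast
  with inner.prems have "poly t"
    by (cases t rule: list.exhaust) (auto dest: side_TrueD)
  with inner show ?case by blast
qed

text \<open>This excludes that a word is a left disk with nontrivial excess and also starts with a disk.\<close>

lemma no_poly_prefix:
  "poly p \<Longrightarrow> poly q \<Longrightarrow> 0 < t \<Longrightarrow> replicate t True @ p = q @ y \<Longrightarrow> False"
proof (induction t arbitrary: q y)
  case 0
  then show ?case by simp
next
  case (Suc t)
  from Suc.prems(2) obtain s1 s2 s3 where q: "q = True # s1 @ True # s2 @ True # s3 @ [True]"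
    and s: "side s1" "side s2" "side s3"
    by (auto elim: poly.cases)
  have e: "replicate t True @ p = s1 @ (True # s2 @ True # s3 @ True # y)"
    using Suc.prems(4) q by simp
  \<comment> \<open>The first side \<open>s1\<close> of \<open>q\<close> now faces a corner, so it
    is itself a polygon, and it has one corner fewer to skip.\<close>
  obtain r where "replicate t True @ p = True # r"
    using poly_hd[OF Suc.prems(1)] by (cases t) auto
  with e s(1) have p1: "poly s1"
    by (cases s1 rule: list.exhaust) (auto dest: side_TrueD)
  show False
  proof (cases "t = 0")
    case True
    then show False
      using e prefix_free(1)[OF Suc.prems(1) p1, of "[]"] by auto
  next
    case False
    then show False
      using Suc.IH[OF Suc.prems(1) p1 _ e] by simp
  qed
qed

abbreviation leaf :: "bool list" where
  "leaf \<equiv> [True, False, True, False, True, False, True]"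

lemma poly_leaf: "poly leaf"
  using tile[OF edge edge edge] by simp

text \<open>Gluing one quadrilateral onto a side of the polygon, which is what the four replacement
  rules do.\<close>

lemma poly_insert_aux:
  "poly s \<Longrightarrow> s = u @ False # v \<Longrightarrow> poly (u @ leaf @ v)"
  "side s \<Longrightarrow> s = u @ False # v \<Longrightarrow> side (u @ leaf @ v)"
proof (induction arbitrary: u v and u v rule: poly_side.inducts)
  case (tile s1 s2 s3)
  from tile.prems obtain u' where u: "u = True # u'"
    by (cases u) auto
  with tile.prems have e: "s1 @ (True # s2 @ True # s3 @ [True]) = u' @ False # v"
    by simp
  then consider (a) v' where "s1 = u' @ False # v'" "v = v' @ True # s2 @ True # s3 @ [True]"
    | (b) u'' v' where "s2 = u'' @ False # v'" "u' = s1 @ True # u''" "v = v' @ True # s3 @ [True]"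
    | (c) u'' v' where "s3 = u'' @ False # v'" "u' = s1 @ True # s2 @ True # u''" "v = v' @ [True]"
    by (auto simp: append_eq_append_conv2 append_eq_Cons_conv Cons_eq_append_conv)
  then show ?case
  proof cases
    case a
    then show ?thesis
      using poly_side.tile[OF tile.IH(1)[OF a(1)] tile.hyps(2,3)] u by simp
  next
    case b
    then show ?thesis
      using poly_side.tile[OF tile.hyps(1) tile.IH(2)[OF b(1)] tile.hyps(3)] u by simp
  next
    case c
    then show ?thesis
      using poly_side.tile[OF tile.hyps(1,2) tile.IH(3)[OF c(1)]] u by simp
  qed
next
  case edge
  then have "u = []" "v = []"
    by (auto simp: Cons_eq_append_conv)
  then show ?case using inner[OF poly_leaf] by simp
next
  case (inner s)
  then show ?case using poly_side.inner by blast
qed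

lemma poly_insert: "poly (u @ False # v) \<Longrightarrow> poly (u @ leaf @ v)"
  using poly_insert_aux(1) by blast

text \<open>Inverse to gluing: the tree of tiles has an innermost one, whose three edges other than
  its root edge are sides of the polygon.\<close>

lemma poly_has_leaf:
  "poly s \<Longrightarrow> s = leaf \<or> (\<exists>u v. s = u @ leaf @ v \<and> poly (u @ False # v))"
  "side s \<Longrightarrow> s = [False] \<or> (\<exists>u v. s = u @ leaf @ v \<and> side (u @ False # v))"
proof (induction rule: poly_side.inducts)
  case (tile s1 s2 s3)
  consider "s1 = [False]" "s2 = [False]" "s3 = [False]"
    | (a) u v where "s1 = u @ leaf @ v" "side (u @ False # v)"
    | (b) u v where "s2 = u @ leaf @ v" "side (u @ False # v)"
    | (c) u v where "s3 = u @ leaf @ v" "side (u @ False # v)"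
    using tile.IH by blast
  then show ?case
  proof cases
    case 1
    then show ?thesis by simp
  next
    case a
    with poly_side.tile[OF a(2) tile.hyps(2,3)] show ?thesis
      by (intro disjI2 exI[of _ "True # u"] exI[of _ "v @ True # s2 @ True # s3 @ [True]"]) simp
  next
    case b
    with poly_side.tile[OF tile.hyps(1) b(2) tile.hyps(3)] show ?thesis
      by (intro disjI2 exI[of _ "True # s1 @ True # u"] exI[of _ "v @ True # s3 @ [True]"]) simp
  next
    case c
    with poly_side.tile[OF tile.hyps(1,2) c(2)] show ?thesis
      by (intro disjI2 exI[of _ "True # s1 @ True # s2 @ True # u"] exI[of _ "v @ [True]"]) simp
  qed
next
  case edge
  then show ?case by simp
next
  case (inner s)
  then show ?case
    by (metis append_Nil append_Nil2 poly_side.edge poly_side.inner append_Cons)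
qed

text \<open>Both ends of a side are vertices, and each vertex is a corner of some tile; only the
  lone edge has no tile. Hence the entries next to a glued tile keep positive exponent when it is
  removed.\<close>

lemma poly_comma:
  "poly s \<Longrightarrow> s = u @ False # v \<Longrightarrow> \<exists>u' v'. u = u' @ [True] \<and> v = True # v'"
  "side s \<Longrightarrow> s = u @ False # v \<Longrightarrow> s \<noteq> [False] \<Longrightarrow> \<exists>u' v'. u = u' @ [True] \<and> v = True # v'"
proof (induction arbitrary: u v and u v rule: poly_side.inducts)
  case (tile s1 s2 s3)
  from tile.prems obtain u' where u: "u = True # u'"
    by (cases u) auto
  with tile.prems have e: "s1 @ (True # s2 @ True # s3 @ [True]) = u' @ False # v"
    by simp
  then consider (a) v' where "s1 = u' @ False # v'" "v = v' @ True # s2 @ True # s3 @ [True]"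
    | (b) u'' v' where "s2 = u'' @ False # v'" "u' = s1 @ True # u''" "v = v' @ True # s3 @ [True]"
    | (c) u'' v' where "s3 = u'' @ False # v'" "u' = s1 @ True # s2 @ True # u''" "v = v' @ [True]"
    by (auto simp: append_eq_append_conv2 append_eq_Cons_conv Cons_eq_append_conv)
  then show ?case
  proof cases
    case a
    then show ?thesis
      using tile.IH(1)[OF a(1)] u by (cases "s1 = [False]") (auto simp: Cons_eq_append_conv)
  next
    case b
    then show ?thesis
      using tile.IH(2)[OF b(1)] u by (cases "s2 = [False]") (auto simp: Cons_eq_append_conv)
  next
    case c
    then show ?thesis
      using tile.IH(3)[OF c(1)] u by (cases "s3 = [False]") (auto simp: Cons_eq_append_conv)
  qed
qed simp_all

section \<open>Words of basis elements, their codes, and disk sequences\<close>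

definition pref :: "bgen list \<Rightarrow> bool list" where
  "pref w = (if w = [] then [] else toks w @ [False])"

definition suff :: "bgen list \<Rightarrow> bool list" where
  "suff w = (if w = [] then [] else False # toks w)"

lemma pref_Nil [simp]: "pref [] = []" and suff_Nil [simp]: "suff [] = []"
  by (simp_all add: pref_def suff_def)

lemma toks_Cons: "toks (g # w) = replicate (esz g) True @ suff w"
  by (cases w) (simp_all add: suff_def)

lemma suff_Cons: "suff (g # w) = False # replicate (esz g) True @ suff w"
  by (simp add: suff_def toks_Cons)

lemma suff_append: "suff (u @ v) = suff u @ suff v"
  by (induction u) (simp_all add: suff_Cons)

lemma pref_Cons: "pref (g # w) = replicate (esz g) True @ False # pref w"
  by (cases w) (simp_all add: pref_def)

lemma toks_append: "v \<noteq> [] \<Longrightarrow> toks (u @ v) = pref u @ toks v"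
  by (induction u) (auto simp: pref_Cons toks_Cons suff_def)

lemma toks_append': "u \<noteq> [] \<Longrightarrow> toks (u @ v) = toks u @ suff v"
  by (cases u) (auto simp: toks_Cons suff_append)

lemma toks_mid: "toks (u @ g # v) = pref u @ replicate (esz g) True @ suff v"
  by (simp add: toks_append toks_Cons)

lemma count_toks: "w \<noteq> [] \<Longrightarrow> Suc (count_list (toks w) False) = length w"
proof -
  have r: "count_list (replicate n True) False = 0" for n
    by (induction n) auto
  have "count_list (suff w) False = length w" for w
    by (induction w) (auto simp: suff_Cons r)
  then show "w \<noteq> [] \<Longrightarrow> ?thesis"
    by (cases w) (auto simp: toks_Cons r)
qed

lemma replicate_True_ne_False: "replicate n True = u @ False # v \<longleftrightarrow> False"
  by (metis in_set_conv_decomp in_set_replicate)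

lemma pref_last: "pref w = u @ [True] \<longleftrightarrow> False"
  by (auto simp: pref_def)

lemma toks_split:
  "toks w = u @ False # v \<Longrightarrow> \<exists>x y. w = x @ y \<and> x \<noteq> [] \<and> y \<noteq> [] \<and> toks x = u \<and> toks y = v"
proof (induction w arbitrary: u)
  case Nil
  then show ?case by simp
next
  case (Cons g w)
  show ?case
  proof (cases "w = []")
    case True
    with Cons.prems show ?thesis
      by (simp add: replicate_True_ne_False)
  next
    case False
    have e: "replicate (esz g) True @ False # toks w = u @ False # v"
      using Cons.prems False by (simp add: toks_Cons suff_def)
    show ?thesis
    proof (cases "u = replicate (esz g) True")
      case True
      with e False show ?thesis
        by (intro exI[of _ "[g]"] exI[of _ w]) simp
    next
      case u: False
      have "\<exists>u'. u = replicate (esz g) True @ False # u' \<and> toks w = u' @ False # v"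
        using e u by (auto simp: append_eq_append_conv2 append_eq_Cons_conv Cons_eq_append_conv
            replicate_True_ne_False dest: sym)
      then obtain u' where u': "u = replicate (esz g) True @ False # u'" "toks w = u' @ False # v"
        by blast
      from Cons.IH[OF u'(2)] obtain x y where
        xy: "w = x @ y" "x \<noteq> []" "y \<noteq> []" "toks x = u'" "toks y = v"
        by blast
      then show ?thesis
        by (intro exI[of _ "g # x"] exI[of _ y]) (auto simp: u' toks_Cons suff_def)
    qed
  qed
qed

text \<open>\<open>rexc g t\<close> and \<open>lexc g t\<close> are the final and initial pieces of exponent \<open>t\<close> of \<open>g\<close>.\<close>

definition rexc :: "bgen \<Rightarrow> nat \<Rightarrow> bgen" where
  "rexc g t = (case t of 0 \<Rightarrow> Idm (tgt g)
     | Suc k \<Rightarrow> if isD g then Dg (tgt g) k else Sg (if odd k then tgt g else other (tgt g)) k)"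

definition lexc :: "bgen \<Rightarrow> nat \<Rightarrow> bgen" where
  "lexc g t = (case t of 0 \<Rightarrow> Idm (src g)
     | Suc k \<Rightarrow> if isD g then Dg (src g) k else Sg (src g) k)"

lemma other_other [simp]: "other (other v) = v"
  by (cases v) simp_all

lemma other_ne [simp]: "other v \<noteq> v" "v \<noteq> other v"
  by (cases v; simp)+

lemma other_eq_iff: "other v = w \<longleftrightarrow> v = other w"
  by (cases v; cases w) simp_all

lemma esz_exc [simp]: "esz (rexc g t) = t" "esz (lexc g t) = t"
  by (simp_all add: rexc_def lexc_def split: nat.split)

lemma isD_exc [simp]: "isD (rexc g t) \<longleftrightarrow> t \<noteq> 0 \<and> isD g" "isD (lexc g t) \<longleftrightarrow> t \<noteq> 0 \<and> isD g"
  by (simp_all add: rexc_def lexc_def split: nat.split)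

lemma tgt_rexc [simp]: "tgt (rexc g t) = tgt g"
  by (simp add: rexc_def split: nat.split)

lemma src_lexc [simp]: "src (lexc g t) = src g"
  by (simp add: lexc_def split: nat.split)

lemma bgen_eqI: "0 < esz a \<Longrightarrow> esz a = esz b \<Longrightarrow> isD a = isD b \<Longrightarrow> src a = src b \<Longrightarrow> a = b"
  by (cases a; cases b) auto

lemma diff_eq_Suc: "b - a = Suc c \<longleftrightarrow> b = Suc (a + c)" for a b c :: nat
  by arith

text \<open>Powers of loops and alternating words cancel: the first factor of \<open>g\<close>
  determines the second.\<close>

lemma bmul_rexc:
  "0 < esz a \<Longrightarrow> 0 < esz g \<Longrightarrow>
   bmul a b = Some g \<longleftrightarrow> isD a = isD g \<and> src a = src g \<and> esz a \<le> esz g \<and> b = rexc g (esz g - esz a)"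
  by (cases a; cases b; cases g)
     (auto simp: rexc_def other_eq_iff diff_eq_Suc split: nat.split if_splits)

lemma bmul_lexc:
  "0 < esz a \<Longrightarrow> 0 < esz g \<Longrightarrow>
   bmul b a = Some g \<longleftrightarrow> isD a = isD g \<and> tgt a = tgt g \<and> esz a \<le> esz g \<and> b = lexc g (esz g - esz a)"
  by (cases a; cases b; cases g)
     (auto simp: lexc_def other_eq_iff diff_eq_Suc split: nat.split if_splits)

lemma bmul_Some:
  assumes "bmul a b = Some g"
  shows "esz g = esz a + esz b" "src g = src a" "tgt g = tgt b" "tgt a = src b"
    "0 < esz a \<Longrightarrow> isD g = isD a" "0 < esz b \<Longrightarrow> isD g = isD b"
  using assms by (cases a; cases b; auto split: if_splits)+

lemma bmul_None: "0 < esz a \<Longrightarrow> 0 < esz b \<Longrightarrow> bmul a b = None \<longleftrightarrow> tgt a \<noteq> src b \<or> isD a \<noteq> isD b"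
  by (cases a; cases b) auto

lemma bmul_Idm [simp]: "tgt a = v \<Longrightarrow> bmul a (Idm v) = Some a" "src a = v \<Longrightarrow> bmul (Idm v) a = Some a"
  by (cases a; auto)+

lemma alt_Nil [simp]: "alt []"
  by (simp add: alt_def)

lemma alt_Cons: "alt (g # w) \<longleftrightarrow> 0 < esz g \<and> alt w \<and> (w \<noteq> [] \<longrightarrow> tgt g = src (hd w) \<and> isD g \<noteq> isD (hd w))"
  by (cases w) (auto simp: alt_def)

lemma alt_append:
  "alt (u @ v) \<longleftrightarrow> alt u \<and> alt v \<and>
     (u \<noteq> [] \<longrightarrow> v \<noteq> [] \<longrightarrow> tgt (last u) = src (hd v) \<and> isD (last u) \<noteq> isD (hd v))"
  by (auto simp: alt_def successively_append_iff)

lemma alt_isD: "alt w \<Longrightarrow> w \<noteq> [] \<Longrightarrow> isD (last w) \<noteq> isD (hd w) \<longleftrightarrow> even (length w)"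
  by (induction w rule: induct_list012) (auto simp: alt_Cons)

text \<open>Gluing in the shape of the rules: both neighbours of the replaced side gain a corner,
  and two entries of exponent one appear between them.\<close>

lemma poly_glue:
  assumes "poly (u @ True # replicate k True @ False # True # replicate l True @ v)"
  shows "poly (u @ True # True # replicate k True @ False # True # False # True # False #
    True # True # replicate l True @ v)"
  using poly_insert[of "u @ True # replicate k True" "True # replicate l True @ v"] assms
  by (simp add: replicate_app_Cons_same)

lemma disk_imp: "disk w \<Longrightarrow> alt w \<and> poly (toks w)"
proof (induction rule: disk.induct)
  case (rDS_Bk xs k l ys)
  then show ?case
    by (cases "even l") (auto simp: toks_mid suff_Cons alt_append alt_Cons poly_glue)
next
  case (rDS_Wh xs k l ys)
  then show ?case
    by (cases "even l") (auto simp: toks_mid suff_Cons alt_append alt_Cons poly_glue)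
next
  case (rSD_Bk u k xs l ys)
  then show ?case
    by (cases "even k") (auto simp: toks_mid suff_Cons alt_append alt_Cons poly_glue other_eq_iff)
next
  case (rSD_Wh u k xs l ys)
  then show ?case
    by (cases "even k") (auto simp: toks_mid suff_Cons alt_append alt_Cons poly_glue other_eq_iff)
qed (simp_all add: alt_Cons poly_leaf)

lemma toks_eq_T:
  assumes "toks w = [True]" "alt w"
  shows "\<exists>g. w = [g] \<and> esz g = 1"
proof -
  from assms obtain g v n where w: "w = g # v" and n: "esz g = Suc n"
    by (cases w; cases "esz (hd w)") (auto simp: alt_Cons)
  with assms(1) have "replicate n True @ suff v = []"
    by (simp add: toks_Cons)
  with w n show ?thesis
    by (auto simp: suff_def split: if_splits)
qed

lemma toks_snoc2:
  assumes "toks w = u @ [True, True]" "alt w"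
  shows "\<exists>x g k. w = x @ [g] \<and> esz g = Suc (Suc k) \<and> u = pref x @ replicate k True"
proof -
  from assms obtain x g where w: "w = x @ [g]"
    by (cases w rule: rev_cases) auto
  with assms have e: "pref x @ replicate (esz g) True = u @ [True, True]" and g: "0 < esz g"
    by (auto simp: toks_mid alt_append alt_Cons)
  then obtain n where n: "esz g = Suc n" by (cases "esz g") auto
  from e have e1: "pref x @ replicate n True = u @ [True]"
    by (simp add: n flip: replicate_append_same)
  then have "n \<noteq> 0"
    using pref_last[of x u] by (cases n) auto
  then obtain k where k: "n = Suc k" by (cases n) auto
  from e1 have "pref x @ replicate k True = u"
    by (simp add: k flip: replicate_append_same)
  with w n k show ?thesis by auto
qed

lemma toks_Cons2:
  assumes "toks w = True # True # u" "alt w"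
  shows "\<exists>x g k. w = g # x \<and> esz g = Suc (Suc k) \<and> u = replicate k True @ suff x"
proof -
  from assms obtain g x where w: "w = g # x"
    by (cases w) auto
  with assms have e: "replicate (esz g) True @ suff x = True # True # u" and g: "0 < esz g"
    by (auto simp: toks_Cons alt_Cons)
  then obtain n where n: "esz g = Suc n" by (cases "esz g") auto
  with e have e1: "replicate n True @ suff x = True # u"
    by simp
  then have "n \<noteq> 0"
    by (cases n) (auto simp: suff_def split: if_splits)
  then obtain k where k: "n = Suc k" by (cases n) auto
  with e1 w n show ?thesis by auto
qed

lemma leaf_disk:
  assumes "alt [a, b, c, d]" "esz a = 1" "esz b = 1" "esz c = 1" "esz d = 1"
  shows "disk [a, b, c, d]"
proof -
  consider v where "a = Dg v 0" | v where "a = Sg v 0"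
    using assms(2) by (cases a) auto
  then show ?thesis
  proof cases
    case (1 v)
    with assms have "b = Sg v 0" by (cases b) (auto simp: alt_Cons)
    moreover from this assms have "c = Dg (other v) 0" by (cases c) (auto simp: alt_Cons)
    moreover from this assms have "d = Sg (other v) 0" by (cases d) (auto simp: alt_Cons)
    ultimately show ?thesis
      using 1 by (cases v) (auto intro: disk.intros)
  next
    case (2 v)
    with assms have "b = Dg (other v) 0" by (cases b) (auto simp: alt_Cons)
    moreover from this assms have "c = Sg (other v) 0" by (cases c) (auto simp: alt_Cons)
    moreover from this assms have "d = Dg v 0" by (cases d) (auto simp: alt_Cons)
    ultimately show ?thesis
      using 2 by (cases v) (auto intro: disk.intros)
  qed
qed

lemma disk_insert:
  assumes "alt (xs @ [a, b, c, d] @ ys)"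
    and "esz a = Suc (Suc k)" "esz b = 1" "esz c = 1" "esz d = Suc (Suc l)"
    and "disk (xs @ [lexc a (Suc k), rexc d (Suc l)] @ ys)"
  shows "disk (xs @ [a, b, c, d] @ ys)"
proof -
  have al: "alt [a, b, c, d]"
    using assms(1) by (simp add: alt_append alt_Cons)
  consider v where "a = Dg v (Suc k)" | v where "a = Sg v (Suc k)"
    using assms(2) by (cases a) auto
  then show ?thesis
  proof cases
    case (1 v)
    with assms al have "b = Sg v 0" by (cases b) (auto simp: alt_Cons)
    moreover from this assms al have "c = Dg (other v) 0" by (cases c) (auto simp: alt_Cons)
    moreover from this assms al have "d = Sg (other v) (Suc l)" by (cases d) (auto simp: alt_Cons)
    ultimately show ?thesis
      using 1 assms(6) rDS_Bk[of xs k l ys] rDS_Wh[of xs k l ys]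
      by (cases v) (auto simp: lexc_def rexc_def split: if_splits)
  next
    case (2 v)
    define t where "t = tgt (Sg v (Suc k))"
    from 2 assms al have "b = Dg t 0" by (cases b) (auto simp: alt_Cons t_def)
    moreover from this assms al have "c = Sg t 0" by (cases c) (auto simp: alt_Cons)
    moreover from this assms al have "d = Dg (other t) (Suc l)" by (cases d) (auto simp: alt_Cons)
    moreover have "tgt (Sg v k) = other t"
      by (simp add: t_def)
    ultimately show ?thesis
      using 2 assms(6) rSD_Bk[of v k xs l ys] rSD_Wh[of v k xs l ys]
      by (cases t) (auto simp: lexc_def rexc_def split: if_splits)
  qed
qed

lemma tgt_lexc_diff: "esz g = Suc (Suc k) \<Longrightarrow> tgt (lexc g (Suc k)) = (if isD g then tgt g else other (tgt g))"
  by (cases g) (auto simp: lexc_def)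

lemma src_rexc_diff: "esz g = Suc (Suc k) \<Longrightarrow> src (rexc g (Suc k)) = (if isD g then src g else other (src g))"
  by (cases g) (auto simp: rexc_def)

lemma tgt_arrow: "esz g = 1 \<Longrightarrow> tgt g = (if isD g then src g else other (src g))"
  by (cases g) auto

text \<open>Induction by removing an innermost tile. This shortens its two neighbours by one and
  drops the two arrows between them, which undoes a replacement rule.\<close>

lemma imp_disk: "alt w \<Longrightarrow> poly (toks w) \<Longrightarrow> disk w"
proof (induction "length (toks w)" arbitrary: w rule: less_induct)
  case less
  from poly_has_leaf(1)[OF less.prems(2)] show ?case
  proof (elim disjE exE conjE)
    assume "toks w = leaf"
    then obtain a w1 where w1: "w = a @ w1" "toks a = [True]" "toks w1 = [True, False, True, False, True]"
      using toks_split[of w "[True]" "[True, False, True, False, True]"] by auto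
    then obtain b w2 where w2: "w1 = b @ w2" "toks b = [True]" "toks w2 = [True, False, True]"
      using toks_split[of w1 "[True]" "[True, False, True]"] by auto
    then obtain c e where w3: "w2 = c @ e" "toks c = [True]" "toks e = [True]"
      using toks_split[of w2 "[True]" "[True]"] by auto
    from less.prems(1) have "alt a" "alt b" "alt c" "alt e"
      by (auto simp: w1 w2 w3 alt_append)
    with w1(2) w2(2) w3(2,3) toks_eq_T obtain a' b' c' e' where
      "a = [a']" "b = [b']" "c = [c']" "e = [e']" "esz a' = 1" "esz b' = 1" "esz c' = 1" "esz e' = 1"
      by metis
    with less.prems(1) show ?thesis
      by (auto simp: w1 w2 w3 intro: leaf_disk)
  next
    fix u v assume e: "toks w = u @ leaf @ v" and p: "poly (u @ False # v)"
    from poly_comma(1)[OF p refl] obtain u' v' where uv: "u = u' @ [True]" "v = True # v'"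
      by blast
    have "toks w = (u' @ [True, True]) @ False # True # False # True # False # True # True # v'"
      using e by (simp add: uv)
    from toks_split[OF this] obtain a w1 where w1: "w = a @ w1" "toks a = u' @ [True, True]"
      "toks w1 = [True] @ False # True # False # True # True # v'"
      by auto
    from toks_split[OF w1(3)] obtain b w2 where w2: "w1 = b @ w2" "toks b = [True]"
      "toks w2 = [True] @ False # True # True # v'"
      by auto
    from toks_split[OF w2(3)] obtain c e where w3: "w2 = c @ e" "toks c = [True]" "toks e = True # True # v'"
      by auto
    from less.prems(1) have al: "alt a" "alt b" "alt c" "alt e"
      by (auto simp: w1 w2 w3 alt_append)
    from toks_snoc2[OF w1(2) al(1)] obtain xs g k where
      g: "a = xs @ [g]" "esz g = Suc (Suc k)" "u' = pref xs @ replicate k True"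
      by blast
    from toks_Cons2[OF w3(3) al(4)] obtain ys h l where
      h: "e = h # ys" "esz h = Suc (Suc l)" "v' = replicate l True @ suff ys"
      by blast
    from toks_eq_T[OF w2(2) al(2)] toks_eq_T[OF w3(2) al(3)] obtain b' c' where
      bc: "b = [b']" "esz b' = 1" "c = [c']" "esz c' = 1"
      by blast
    have w: "w = xs @ [g, b', c', h] @ ys"
      by (simp add: w1 w2 w3 g h bc)
    \<comment> \<open>One of the two neighbours is an S-word, and shortening it flips its inner end;
      one of the two removed arrows is an S-arrow. The flips match, so the smaller word is again
      composable.\<close>
    let ?w0 = "xs @ [lexc g (Suc k), rexc h (Suc l)] @ ys"
    have "toks ?w0 = u @ False # v"
      by (simp add: toks_mid suff_Cons uv g h replicate_app_Cons_same)
    moreover have "alt ?w0"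
      using less.prems(1) g(2) h(2) bc(2,4) unfolding w
      by (auto simp: alt_append alt_Cons tgt_lexc_diff src_rexc_diff tgt_arrow other_eq_iff split: if_splits)
    moreover have "length (u @ False # v) < length (toks w)"
      using e by simp
    ultimately have "disk ?w0"
      using less.hyps[of ?w0] p by simp
    then show ?thesis
      using disk_insert[of xs g b' c' h ys k l] less.prems(1) g(2) h(2) bc(2,4)
      unfolding w by blast
  qed
qed

text \<open>Generation by local rules becomes membership in a grammar, so that words can be parsed
  from the left.\<close>

theorem disk_iff: "disk w \<longleftrightarrow> alt w \<and> poly (toks w)"
  using disk_imp imp_disk by blast

text \<open>The rules keep the outer ends of a sequence. This fixes the endpoints of a higher
  product even where the first and last letters of its word do not show them.\<close>

lemma disk_closed: "disk w \<Longrightarrow> src (hd w) = tgt (last w)"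
proof (induction rule: disk.induct)
  case (rDS_Bk xs k l ys)
  then show ?case by (cases xs; cases ys) auto
next
  case (rDS_Wh xs k l ys)
  then show ?case by (cases xs; cases ys) auto
next
  case (rSD_Bk u k xs l ys)
  then show ?case by (cases xs; cases ys) auto
next
  case (rSD_Wh u k xs l ys)
  then show ?case by (cases xs; cases ys) auto
qed simp_all

text \<open>The surplus prolongs the last entry only, so on codes it appends \<open>t\<close>
  corners after the polygon, and cancellation recovers it as the final piece of that entry.\<close>

lemma right_disk_iff:
  "right_disk w c \<longleftrightarrow> alt w \<and> (\<exists>p t. poly p \<and> toks w = p @ replicate t True \<and> c = rexc (last w) t)"
proof
  assume "right_disk w c"
  then obtain as g where as: "disk as" "bmul (last as) c = Some g" "w = butlast as @ [g]"
    by (auto simp: right_disk_def)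
  then obtain bs a where bs: "as = bs @ [a]"
    by (cases as rule: rev_cases) (auto simp: disk_iff)
  have d: "alt as" "poly (toks as)"
    using as(1) by (auto simp: disk_iff)
  have a: "0 < esz a" "alt bs"
    using d(1) by (auto simp: bs alt_append alt_Cons)
  have m: "bmul a c = Some g"
    using as(2) by (simp add: bs)
  note b = bmul_Some[OF m]
  have g: "0 < esz g" using a b(1) by simp
  have "c = rexc g (esz g - esz a)"
    using m bmul_rexc[OF a(1) g] by simp
  moreover have "alt w"
    using d(1) b a as(3) by (auto simp: bs alt_append alt_Cons)
  moreover have "toks w = toks as @ replicate (esz g - esz a) True"
    using b(1) as(3) by (simp add: bs toks_mid replicate_add)
  ultimately show "alt w \<and> (\<exists>p t. poly p \<and> toks w = p @ replicate t True \<and> c = rexc (last w) t)"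
    using d as(3) by auto
next
  assume "alt w \<and> (\<exists>p t. poly p \<and> toks w = p @ replicate t True \<and> c = rexc (last w) t)"
  then obtain p t where p: "alt w" "poly p" "toks w = p @ replicate t True" "c = rexc (last w) t"
    by blast
  then obtain bs g where w: "w = bs @ [g]"
    by (cases w rule: rev_cases) auto
  have g: "0 < esz g" "alt bs"
    using p(1) by (auto simp: w alt_append alt_Cons)
  have e: "p @ replicate t True = pref bs @ replicate (esz g) True"
    using p(3) by (simp add: w toks_mid)
  \<comment> \<open>A surplus filling the whole last entry would leave a polygon code ending in a
    separator, followed at most by corners of the surplus; but every polygon code ends in a corner
    of its own.\<close>
  have t: "t < esz g"
  proof (rule ccontr)
    assume "\<not> t < esz g"
    then obtain k where "t = k + esz g"
      by (metis add.commute le_Suc_ex not_less)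
    with e have "p @ replicate k True = pref bs"
      by (simp add: replicate_add)
    moreover obtain r where "p @ replicate k True = r @ [True]"
      using poly_last[OF p(2)] by (cases k) (auto simp flip: replicate_append_same)
    ultimately show False
      using pref_last by metis
  qed
  then obtain k where k: "esz g = k + t" "0 < k"
    by (metis add.commute less_imp_add_positive)
  with e have pk: "p = pref bs @ replicate k True"
    by (simp add: replicate_add)
  let ?a = "lexc g k"
  have m: "bmul ?a c = Some g"
    using k g by (subst bmul_rexc) (auto simp: p(4) w)
  have "alt (bs @ [?a])"
    using p(1) k by (auto simp: w alt_append alt_Cons)
  moreover have "toks (bs @ [?a]) = p"
    by (simp add: toks_mid pk)
  ultimately have "disk (bs @ [?a])"
    using p(2) by (simp add: disk_iff)
  then show "right_disk w c"
    unfolding right_disk_def using m w by force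
qed

lemma left_disk_iff:
  "left_disk w c \<longleftrightarrow> alt w \<and> (\<exists>p t. poly p \<and> toks w = replicate t True @ p \<and> c = lexc (hd w) t)"
proof
  assume "left_disk w c"
  then obtain as g where as: "disk as" "bmul c (hd as) = Some g" "w = g # tl as"
    by (auto simp: left_disk_def)
  then obtain bs a where bs: "as = a # bs"
    by (cases as rule: list.exhaust) (auto simp: disk_iff)
  have d: "alt as" "poly (toks as)"
    using as(1) by (auto simp: disk_iff)
  have a: "0 < esz a" "alt bs"
    using d(1) by (auto simp: bs alt_Cons)
  have m: "bmul c a = Some g"
    using as(2) by (simp add: bs)
  note b = bmul_Some[OF m]
  have g: "0 < esz g" using a b(1) by simp
  have "c = lexc g (esz g - esz a)"
    using m bmul_lexc[OF a(1) g] by simp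
  moreover have "alt w"
    using d(1) b a as(3) by (auto simp: bs alt_Cons)
  moreover have "toks w = replicate (esz g - esz a) True @ toks as"
    using b(1) as(3) by (simp add: bs toks_Cons replicate_add)
  ultimately show "alt w \<and> (\<exists>p t. poly p \<and> toks w = replicate t True @ p \<and> c = lexc (hd w) t)"
    using d as(3) by auto
next
  assume "alt w \<and> (\<exists>p t. poly p \<and> toks w = replicate t True @ p \<and> c = lexc (hd w) t)"
  then obtain p t where p: "alt w" "poly p" "toks w = replicate t True @ p" "c = lexc (hd w) t"
    by blast
  then obtain bs g where w: "w = g # bs"
    by (cases w) auto
  have g: "0 < esz g" "alt bs"
    using p(1) by (auto simp: w alt_Cons)
  have e: "replicate t True @ p = replicate (esz g) True @ suff bs"
    using p(3) by (simp add: w toks_Cons)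
  have t: "t < esz g"
  proof (rule ccontr)
    assume "\<not> t < esz g"
    then obtain k where "t = esz g + k"
      by (metis le_Suc_ex not_less)
    with e have s: "replicate k True @ p = suff bs"
      by (simp add: replicate_add)
    moreover obtain r where "replicate k True @ p = True # r"
      using poly_hd[OF p(2)] by (cases k) auto
    ultimately show False
      by (auto simp: suff_def split: if_splits)
  qed
  then obtain k where k: "esz g = t + k" "0 < k"
    by (metis less_imp_add_positive)
  with e have pk: "p = replicate k True @ suff bs"
    by (simp add: replicate_add)
  let ?a = "rexc g k"
  have m: "bmul c ?a = Some g"
    using k g by (subst bmul_lexc) (auto simp: p(4) w)
  have "alt (?a # bs)"
    using p(1) k by (auto simp: w alt_Cons)
  moreover have "toks (?a # bs) = p"
    by (simp add: toks_Cons pk)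
  ultimately have "disk (?a # bs)"
    using p(2) by (simp add: disk_iff)
  then show "left_disk w c"
    unfolding left_disk_def using m w by force
qed

section \<open>The products of B read off from codes\<close>

definition mB :: "bgen list \<Rightarrow> bgen option" where
  "mB w = (if length w = 2 then bmul (w ! 0) (w ! 1)
     else if 3 \<le> length w then
       (if \<exists>b. right_disk w b then Some (SOME b. right_disk w b)
        else if \<exists>b. left_disk w b then Some (SOME b. left_disk w b) else None)
     else None)"

lemma muB_basis_eq: "muB_basis w = (case mB w of None \<Rightarrow> 0 | Some c \<Rightarrow> Poly_Mapping.single c 1)"
  by (auto simp: muB_basis_def mB_def split: option.split)

lemma mB_short [simp]: "mB [] = None" "mB [a] = None" "mB [a, b] = bmul a b"
  by (simp_all add: mB_def)

lemma replicate_prefix_poly: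
  assumes "poly p" "poly q" "p @ replicate t True = q @ replicate u True"
  shows "p = q \<and> t = u"
  using assms prefix_free(1)[OF assms] by auto

lemma poly_length:
  assumes "poly p" "toks w = u @ p @ v"
  shows "4 \<le> length w"
proof -
  have "w \<noteq> []" using assms by auto
  with count_toks[OF this] count_ge3[OF assms(1)] assms(2) show ?thesis
    by auto
qed

text \<open>By \<open>prefix_free\<close> the decomposition into polygon and trailing surplus is
  unique, so the choice operator has a single candidate.\<close>

lemma mB_right:
  assumes "alt w" "poly p" "toks w = p @ replicate t True"
  shows "mB w = Some (rexc (last w) t)"
proof -
  have r: "right_disk w (rexc (last w) t)"
    using assms right_disk_iff by blast
  have "b = rexc (last w) t" if "right_disk w b" for b
    using that assms replicate_prefix_poly unfolding right_disk_iff by metis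
  then have "(SOME b. right_disk w b) = rexc (last w) t"
    using r by blast
  then show ?thesis
    using r poly_length[OF assms(2), of w "[]"] assms(3) by (auto simp: mB_def)
qed

text \<open>For positive \<open>t\<close> the word is not a right disk as well, by
  \<open>no_poly_prefix\<close>, so the second test in \<open>mB\<close> decides. The case
  \<open>t = 0\<close> belongs to \<open>mB_right\<close>.\<close>

lemma mB_left:
  assumes "alt w" "poly p" "toks w = replicate t True @ p" "0 < t"
  shows "mB w = Some (lexc (hd w) t)"
proof -
  have r: "left_disk w (lexc (hd w) t)"
    using assms left_disk_iff by blast
  have n: "\<not> right_disk w b" for b
    using no_poly_prefix[OF assms(2) _ assms(4)] assms(3) by (auto simp: right_disk_iff)
  have "b = lexc (hd w) t" if "left_disk w b" for b
  proof -
    from that obtain q u where q: "poly q" "toks w = replicate u True @ q" "b = lexc (hd w) u"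
      by (auto simp: left_disk_iff)
    consider "u = t" | k where "u = t + k" "0 < k" | k where "t = u + k" "0 < k"
      by (metis less_imp_add_positive linorder_less_linear)
    then have "u = t"
    proof cases
      case (2 k)
      with q assms(3) have "replicate k True @ q = p @ []"
        by (simp add: replicate_add)
      with no_poly_prefix[OF q(1) assms(2) 2(2)] show ?thesis by blast
    next
      case (3 k)
      with q assms(3) have "replicate k True @ p = q @ []"
        by (simp add: replicate_add)
      with no_poly_prefix[OF assms(2) q(1) 3(2)] show ?thesis by blast
    qed
    with q show ?thesis by simp
  qed
  then have "(SOME b. left_disk w b) = lexc (hd w) t"
    using r by blast
  then show ?thesis
    using r n poly_length[OF assms(2), of w _ "[]"] assms(3) by (auto simp: mB_def)
qed

lemma mB_Some_cases:
  assumes "mB w = Some c" "3 \<le> length w"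
  obtains (right) p t where "alt w" "poly p" "toks w = p @ replicate t True" "c = rexc (last w) t"
  | (left) p t where "alt w" "poly p" "toks w = replicate t True @ p" "c = lexc (hd w) t" "0 < t"
proof -
  consider "\<exists>b. right_disk w b" | "\<exists>b. left_disk w b"
    using assms by (auto simp: mB_def split: if_splits)
  then show ?thesis
  proof cases
    case 1
    then obtain p t where p: "alt w" "poly p" "toks w = p @ replicate t True"
      unfolding right_disk_iff by blast
    with mB_right[OF p] assms show ?thesis by (auto intro!: right)
  next
    case 2
    then obtain p t where p: "alt w" "poly p" "toks w = replicate t True @ p"
      unfolding left_disk_iff by blast
    show ?thesis
    proof (cases "t = 0")
      case True
      with mB_right[OF p(1,2), of 0] p assms show ?thesis by (auto intro!: right)
    next
      case False
      with mB_left[OF p] p assms show ?thesis by (auto intro!: left)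
    qed
  qed
qed

lemma mB_alt: "mB w = Some c \<Longrightarrow> 3 \<le> length w \<Longrightarrow> alt w"
  by (erule mB_Some_cases) auto

lemma src_rexc_disk:
  assumes "alt w" "poly p" "toks w = p @ replicate t True"
  shows "src (rexc (last w) t) = src (hd w)"
proof -
  have "right_disk w (rexc (last w) t)"
    using assms right_disk_iff by blast
  then obtain as g where as: "disk as" "bmul (last as) (rexc (last w) t) = Some g" "w = butlast as @ [g]"
    by (auto simp: right_disk_def)
  have "length as \<ge> 2"
    using as(1) poly_length[of "toks as" as "[]" "[]"] by (auto simp: disk_iff)
  then have "hd w = hd as"
    using as(3) by (cases as) auto
  with bmul_Some(4)[OF as(2)] disk_closed[OF as(1)] show ?thesis
    by simp
qed

lemma tgt_lexc_disk:
  assumes "alt w" "poly p" "toks w = replicate t True @ p"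
  shows "tgt (lexc (hd w) t) = tgt (last w)"
proof -
  have "left_disk w (lexc (hd w) t)"
    using assms left_disk_iff by blast
  then obtain as g where as: "disk as" "bmul (lexc (hd w) t) (hd as) = Some g" "w = g # tl as"
    by (auto simp: left_disk_def)
  have "length as \<ge> 2"
    using as(1) poly_length[of "toks as" as "[]" "[]"] by (auto simp: disk_iff)
  then have "last w = last as"
    using as(3) by (cases as) auto
  with bmul_Some(4)[OF as(2)] disk_closed[OF as(1)] show ?thesis
    by simp
qed

lemma mB_length: "mB w = Some c \<Longrightarrow> 2 \<le> length w"
  by (auto simp: mB_def split: if_splits)

lemma mB_two: "length w = 2 \<Longrightarrow> \<exists>a b. w = [a, b]"
  by (cases w rule: list.exhaust; cases "tl w") auto

lemma mB_ends: "mB w = Some c \<Longrightarrow> src c = src (hd w) \<and> tgt c = tgt (last w)"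
proof (cases "length w = 2")
  case True
  assume "mB w = Some c"
  with mB_two[OF True] bmul_Some show ?thesis by force
next
  case False
  assume c: "mB w = Some c"
  with mB_length[OF this] False have "3 \<le> length w" by simp
  from c this show ?thesis
    by (cases rule: mB_Some_cases) (auto simp: src_rexc_disk tgt_lexc_disk)
qed

definition wsize :: "bgen list \<Rightarrow> nat" where
  "wsize w = sum_list (map esz w)"

lemma wsize_simps [simp]: "wsize [] = 0" "wsize (g # w) = esz g + wsize w" "wsize (u @ v) = wsize u + wsize v"
  by (simp_all add: wsize_def)

lemma count_toks_True: "count_list (toks w) True = wsize w"
proof -
  have "count_list (replicate n True) True = n" for n
    by (induction n) auto
  then show ?thesis
    by (induction w rule: toks.induct) auto
qed

text \<open>The corners of the polygon itself are lost, and there is at least one. This strict drop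
  makes the recursion for \<open>fb\<close> terminate and drives the induction on the total
  exponent.\<close>

lemma mB_wsize: "mB w = Some c \<Longrightarrow> 3 \<le> length w \<Longrightarrow> esz c < wsize w"
proof (erule (1) mB_Some_cases)
  have r: "count_list (replicate n True) True = n" for n
    by (induction n) auto
  show "esz c < wsize w" if "poly p" "toks w = p @ replicate t True" "c = rexc (last w) t" for p t
    using that poly_hd[OF that(1)] by (auto simp: r simp flip: count_toks_True)
  show "esz c < wsize w" if "poly p" "toks w = replicate t True @ p" "c = lexc (hd w) t" for p t
    using that poly_hd[OF that(1)] by (auto simp: r simp flip: count_toks_True)
qed

lemma mB_wsize_le: "mB w = Some c \<Longrightarrow> esz c \<le> wsize w"
  using mB_wsize[of w c] mB_two[of w] mB_length[of w c] bmul_Some(1)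
  by (cases "length w = 2") force+

text \<open>Higher products live on alternating words, in which neighbours multiply to zero.\<close>

lemma mB_adjacent:
  assumes "bmul a b \<noteq> None" "u \<noteq> [] \<or> v \<noteq> []"
  shows "mB (u @ a # b # v) = None"
proof (rule ccontr)
  assume "mB (u @ a # b # v) \<noteq> None"
  then obtain c where "mB (u @ a # b # v) = Some c" by blast
  moreover have "3 \<le> length (u @ a # b # v)"
    using assms(2) by (cases u; cases v) auto
  ultimately have "alt (u @ a # b # v)"
    by (rule mB_alt)
  then have "tgt a = src b \<and> isD a \<noteq> isD b \<and> 0 < esz a \<and> 0 < esz b"
    by (auto simp: alt_append alt_Cons)
  with assms(1) show False
    by (auto simp: bmul_None)
qed

section \<open>Koszul words and the first edge of the root tile that they leave open\<close>

definition kword :: "bgen list \<Rightarrow> bool" where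
  "kword k \<longleftrightarrow> alt k \<and> (\<forall>g\<in>set k. esz g = 1)"

lemma kword_append: "kword (u @ v) \<Longrightarrow> kword u \<and> kword v"
  by (auto simp: kword_def alt_append)

text \<open>The code starts with \<open>leaf\<close>, so by prefix-freeness no other polygon can be
  found there, and in a longer word a separator would be left over where only surplus corners are
  allowed.\<close>

lemma kword_mB:
  assumes "kword v" "mB v = Some c"
  shows "length v = 4 \<and> c = Idm (src (hd v))"
proof -
  have "length v \<noteq> 2"
  proof
    assume "length v = 2"
    then obtain a b where v: "v = [a, b]" using mB_two by blast
    with assms(1) have "bmul a b = None"
      by (auto simp: kword_def alt_Cons bmul_None)
    with v assms(2) show False by simp
  qed
  with mB_length[OF assms(2)] have l: "3 \<le> length v" by simp
  from assms(2) l obtain p t where p: "poly p"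
    and pt: "toks v = p @ replicate t True \<and> c = rexc (last v) t \<or>
             toks v = replicate t True @ p \<and> c = lexc (hd v) t \<and> 0 < t"
    by (cases rule: mB_Some_cases) auto
  have "4 \<le> length v"
    using poly_length[OF p, of v "[]"] poly_length[OF p, of v _ "[]"] pt by auto
  then obtain a b d e w where v: "v = a # b # d # e # w"
    by (auto simp: numeral_eq_Suc Suc_le_length_iff)
  have tv: "toks v = leaf @ suff w"
    using assms(1) by (simp add: v kword_def toks_Cons suff_Cons)
  from pt show ?thesis
  proof (elim disjE conjE)
    assume r: "toks v = p @ replicate t True" "c = rexc (last v) t"
    then have "leaf = p"
      using prefix_free(1)[OF poly_leaf p, of "suff w" "replicate t True"] tv by simp
    with tv r have "suff w = replicate t True"
      by simp
    then have "w = []" "t = 0"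
      by (auto simp: suff_def Cons_replicate_eq split: if_splits)
    with r v mB_ends[OF assms(2)] show ?thesis
      by (auto simp: rexc_def)
  next
    assume "toks v = replicate t True @ p" "0 < t"
    with no_poly_prefix[OF p poly_leaf, of t "suff w"] tv show ?thesis
      by simp
  qed
qed

lemma mB_kword4:
  assumes "kword v" "length v = 4"
  shows "mB v = Some (Idm (src (hd v)))"
proof -
  from assms(2) obtain a b d e where v: "v = [a, b, d, e]"
    by (auto simp: numeral_eq_Suc length_Suc_conv)
  have "toks v = leaf @ replicate 0 True"
    using assms(1) by (simp add: v kword_def)
  then have "mB v = Some (rexc (last v) 0)"
    using assms(1) poly_leaf by (intro mB_right) (auto simp: kword_def)
  with kword_mB[OF assms(1) this] show ?thesis by simp
qed

lemma append_False_eq_replicate: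
  assumes "u @ False # v = p @ replicate t True"
  shows "\<exists>v'. p = u @ False # v' \<and> v = v' @ replicate t True"
proof -
  from assms consider us where "us @ False # v = replicate t True"
    | us where "p = u @ us" "False # v = us @ replicate t True"
    by (auto simp: append_eq_append_conv2)
  then show ?thesis
  proof cases
    case 1
    then show ?thesis by (metis replicate_True_ne_False)
  next
    case (2 us)
    then show ?thesis
      by (cases us) (auto simp: Cons_replicate_eq)
  qed
qed

lemma length_ge4: "4 \<le> length xs \<Longrightarrow> \<exists>h1 h2 h3 h4 ys. xs = h1 # h2 # h3 # h4 # ys"
  by (auto simp: numeral_eq_Suc Suc_le_length_iff)

text \<open>Each arrow supplies one corner, so the arrows of \<open>k\<close> are the first corners
  of the root tile, and the edges between them are sides of the polygon. The next edge
  \<open>s\<close> of that tile is the diagonal of the geometric argument: it may be exchanged for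
  any \<open>s'\<close>, in particular a polygon for a plain side. Four arrows already complete the
  root tile.\<close>

lemma kword_slot:
  assumes "kword k" "k \<noteq> []" "poly p" "toks k @ \<sigma> = p @ y"
  shows "(4 \<le> length k \<and> p = leaf) \<or> (length k \<le> 3 \<and> (\<exists>s z. side s \<and> \<sigma> = s @ True # z @ y \<and>
    (\<forall>s'. side s' \<longrightarrow> poly (toks k @ s' @ True # z)) \<and> (length k < 3 \<longrightarrow> False \<in> set z)))"
proof -
  from assms(3) obtain s1 s2 s3 where p: "p = True # s1 @ True # s2 @ True # s3 @ [True]"
    and s: "side s1" "side s2" "side s3"
    by (auto elim: poly.cases)
  have F: "False \<in> set s" if "side s" for s
    using odd_count(2)[OF that] by (metis count_notin even_zero)
  have h: "s = [False] \<and> a = b" if "side s" "s @ a = False # b" for s a b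
    using that side_FalseD by (cases s rule: list.exhaust) auto
  consider a where "k = [a]" | a b where "k = [a, b]" | a b c where "k = [a, b, c]"
    | a b c d k' where "k = a # b # c # d # k'"
    using assms(2) by (metis list.exhaust)
  then show ?thesis
  proof cases
    case (1 a)
    with assms(1) have "toks k = [True]" by (simp add: kword_def)
    with assms(4) p have "\<sigma> = s1 @ True # (s2 @ True # s3 @ [True]) @ y" by simp
    then show ?thesis
      using 1 s \<open>toks k = [True]\<close> F[OF s(2)]
      by (intro disjI2 conjI exI[of _ s1] exI[of _ "s2 @ True # s3 @ [True]"]) (auto intro: tile)
  next
    case (2 a b)
    with assms(1) have k: "toks k = [True, False, True]" by (simp add: kword_def)
    with assms(4) p have "s1 @ (True # s2 @ True # s3 @ [True] @ y) = False # (True # \<sigma>)" by simp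
    from h[OF s(1) this] have "\<sigma> = s2 @ True # (s3 @ [True]) @ y" by simp
    then show ?thesis
      using 2 s k F[OF s(3)] tile[OF edge _ s(3)]
      by (intro disjI2 conjI exI[of _ s2] exI[of _ "s3 @ [True]"]) auto
  next
    case (3 a b c)
    with assms(1) have k: "toks k = [True, False, True, False, True]" by (simp add: kword_def)
    with assms(4) p have "s1 @ (True # s2 @ True # s3 @ [True] @ y) = False # (True # False # True # \<sigma>)"
      by simp
    from h[OF s(1) this] have "s2 @ (True # s3 @ [True] @ y) = False # (True # \<sigma>)" by simp
    from h[OF s(2) this] have "\<sigma> = s3 @ True # [] @ y" by simp
    then show ?thesis
      using 3 s k tile[OF edge edge]
      by (intro disjI2 conjI exI[of _ s3] exI[of _ "[]"]) auto
  next
    case (4 a b c d k')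
    with assms(1) have "toks k = leaf @ suff k'"
      by (simp add: kword_def toks_Cons suff_Cons)
    then have "leaf @ (suff k' @ \<sigma>) = p @ y"
      using assms(4) by simp
    from prefix_free(1)[OF poly_leaf assms(3) this] 4 show ?thesis
      by simp
  qed
qed

lemma all_True: "False \<notin> set y \<Longrightarrow> y = replicate (length y) True"
  by (induction y) auto

text \<open>The diagonal closing \<open>s\<close> may end between two corners of one entry. Then
  \<open>v\<close> takes the whole entry, and its \<open>m\<close> remaining corners are the surplus
  that the product of \<open>v\<close> hands back to the rest of the word.\<close>

lemma toks_cut:
  assumes "toks w = s @ True # y"
  shows "\<exists>v x m. w = v @ x \<and> v \<noteq> [] \<and> 0 < m \<and> toks v = s @ replicate m True \<and>
    True # y = replicate m True @ suff x"
proof (cases "False \<in> set y")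
  case False
  then have "True # y = replicate (length (True # y)) True"
    using all_True[of "True # y"] by simp
  with assms show ?thesis
    by (intro exI[of _ w] exI[of _ "[]"] exI[of _ "length (True # y)"]) auto
next
  case True
  then obtain a b where ab: "True # y = a @ False # b" "False \<notin> set a"
    using split_list_first[of False "True # y"] by auto
  have a: "a = replicate (length a) True"
    using all_True[OF ab(2)] .
  have a0: "a \<noteq> []" using ab(1) by auto
  from assms ab have "toks w = (s @ a) @ False # b" by simp
  from toks_split[OF this] obtain v x where "w = v @ x" "v \<noteq> []" "x \<noteq> []" "toks v = s @ a" "toks x = b"
    by blast
  with ab a a0 show ?thesis
    by (intro exI[of _ v] exI[of _ x] exI[of _ "length a"]) (auto simp: suff_def)
qed

lemma kword_toks4:
  assumes "kword v" "length v = 4"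
  shows "toks v = leaf"
proof -
  from assms(2) obtain a b c d where v: "v = [a, b, c, d]"
    by (auto simp: numeral_eq_Suc length_Suc_conv)
  show ?thesis
    using assms(1) unfolding v kword_def by simp
qed

text \<open>A barred word \<open>k @ b # rest\<close> with \<open>k = k0 @ [a]\<close>, and the result \<open>k0 @ g # rest\<close> of
  multiplying \<open>a\<close> and \<open>b\<close>.\<close>

locale barred_word =
  fixes k0 :: "bgen list" and a b g :: bgen and rest :: "bgen list"
  assumes kw: "kword (k0 @ [a])" and ab: "bmul a b = Some g" and b0: "0 < esz b"
begin

abbreviation "k \<equiv> k0 @ [a]"
abbreviation "w \<equiv> k0 @ g # rest"

lemma ea: "esz a = 1"
  using kw by (simp add: kword_def)

lemma g: "esz g = Suc (esz b)" "src g = src a" "tgt g = tgt b" "tgt a = src b" "isD g = isD a" "isD b = isD a"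
  using bmul_Some[OF ab] ea b0 by auto

text \<open>Once \<open>a\<close> and \<open>b\<close> are multiplied, no separator stands between
  \<open>k\<close> and \<open>b\<close>, whereas \<open>toks_kc\<close> shows one after
  \<open>k\<close>. Passing from \<open>k @ c # x\<close> to \<open>w\<close> thus replaces a side
  of the outer polygon by the polygon of \<open>v\<close>.\<close>

lemma toks_w: "toks w = toks k @ toks (b # rest)"
  by (simp add: toks_mid toks_Cons g ea)

lemma toks_kc: "toks (k @ c # x) = toks k @ False # toks (c # x)"
proof -
  have "suff (c # x) = False # toks (c # x)" by (simp add: suff_def)
  then show ?thesis
    using toks_append'[of k "c # x"] by (simp only: append_is_Nil_conv list.distinct simp_thms)
qed

lemma alt_w: "alt w \<longleftrightarrow> alt (b # rest)"
  using kw b0 by (auto simp: kword_def alt_append alt_Cons g)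

lemma last_w: "rest \<noteq> [] \<Longrightarrow> last w = last (b # rest)"
  by simp

text \<open>A further arrow would put a separator right after the first corner, where a skipped
  corner must be followed by another corner.\<close>

lemma k_left:
  assumes "poly p" "0 < t" "toks k @ \<sigma> = replicate t True @ p"
  shows "k0 = []"
proof (rule ccontr)
  assume "k0 \<noteq> []"
  then obtain h k' where k0: "k0 = h # k'" by (cases k0) auto
  then have "toks k = True # False # toks (k' @ [a])"
    using kw by (cases k') (auto simp: kword_def toks_Cons suff_Cons suff_append)
  moreover obtain n where n: "t = Suc n"
    using assms(2) by (cases t) auto
  moreover obtain r where "p = True # r"
    using poly_hd[OF assms(1)] by blast
  ultimately show False
    using assms(3) by (cases n) auto
qed

text \<open>The common shape of a nested product on the barred word and a product on
  \<open>w\<close>: either the polygon of \<open>v\<close> sits on the edge after \<open>k\<close>,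
  or the product of \<open>v\<close> is multiplied with \<open>a\<close> alone. The proviso on
  \<open>x\<close> keeps the two apart.\<close>

definition good :: "bgen list \<Rightarrow> bgen list \<Rightarrow> bgen \<Rightarrow> bool" where
  "good v x c' \<longleftrightarrow> alt w \<and> (
     (\<exists>s m z t. poly s \<and> 0 < m \<and> toks v = s @ replicate m True \<and> poly (toks k @ s @ True # z) \<and>
        toks (b # rest) = s @ True # z @ replicate t True \<and> rest \<noteq> [] \<and> c' = rexc (last w) t \<and>
        (k0 = [] \<longrightarrow> x \<noteq> [])) \<or>
     (k0 = [] \<and> x = [] \<and> (\<exists>p t. poly p \<and> toks v = replicate t True @ p \<and> c' = lexc g (Suc t))))"

lemma goodI:
  assumes vx: "v @ x = b # rest" and lv: "3 \<le> length v" and c: "mB v = Some c"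
    and c': "mB (k @ c # x) = Some c'"
  shows "good v x c'"
proof -
  obtain v' where v: "v = b # v'" using vx lv by (cases v) auto
  have av: "alt v" using mB_alt[OF c lv] .
  have rest: "rest \<noteq> []" using vx lv v by auto
  show ?thesis
  proof (cases "k0 = [] \<and> x = []")
    case True
    then have vb: "v = b # rest" using vx by simp
    have aw: "alt w" using av alt_w vb by simp
    have m: "bmul a c = Some c'" using c' True by simp
    from c lv show ?thesis
    proof (cases rule: mB_Some_cases)
      case (right p t)
      \<comment> \<open>A disk has even length, so a nontrivial surplus at the end of
        \<open>v\<close> has the type opposite to \<open>a\<close>, and its product with
        \<open>a\<close> would vanish.\<close>
      have "odd (count_list (toks v) False)"
        using odd_count(1)[OF right(2)] right(3) by simp
      moreover have "v \<noteq> []" using v by simp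
      ultimately have "even (length v)"
        using count_toks[of v] by (metis even_Suc)
      then have "isD (last v) \<noteq> isD a"
        using alt_isD[OF av] v g(6) by auto
      then have t: "t = 0"
        using bmul_Some(5,6)[OF m] ea right(4) by (cases t) auto
      have "c' = lexc g 1"
        using bmul_Some[OF m] right(4) t ea g by (intro bgen_eqI) auto
      then show ?thesis
        unfolding good_def using aw True right t by (intro conjI disjI2 exI[of _ p] exI[of _ 0]) auto
    next
      case (left p t)
      have "c' = lexc g (Suc t)"
        using bmul_Some[OF m] left(4,5) ea g by (intro bgen_eqI) auto
      then show ?thesis
        unfolding good_def using aw True left by (intro conjI disjI2 exI[of _ p] exI[of _ t]) auto
    qed
  next
    case False
    then have l: "3 \<le> length (k @ c # x)" by (cases k0; cases x) auto
    have akc: "alt (k @ c # x)" using mB_alt[OF c' l] .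
    then have cc: "0 < esz c" "isD c \<noteq> isD a" "alt (c # x)"
      by (auto simp: alt_append alt_Cons)
    from c lv obtain s m where s: "poly s" "toks v = s @ replicate m True" and cr: "c = rexc (last v) m"
    proof (cases rule: mB_Some_cases)
      case (right p t)
      then show ?thesis by (intro that)
    next
      case (left p t)
      \<comment> \<open>A surplus on the left has the type of \<open>b\<close>, which is that of
        \<open>a\<close>, against alternation in the outer word.\<close>
      with cc g(6) v have False by auto
      then show ?thesis ..
    qed
    have m0: "0 < m" using cc(1) cr by simp
    have "alt x" "x \<noteq> [] \<Longrightarrow> tgt (last v) = src (hd x) \<and> isD (last v) \<noteq> isD (hd x)"
      using cc(3) m0 by (auto simp: alt_Cons cr)
    then have "alt (v @ x)"
      using av by (simp add: alt_append)
    then have aw: "alt w"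
      using vx alt_w by simp
    from c' l obtain p t where p: "poly p" "toks (k @ c # x) = p @ replicate t True"
      and c't: "c' = rexc (last (k @ c # x)) t"
    proof (cases rule: mB_Some_cases)
      case (right p t)
      then show ?thesis by (intro that)
    next
      case (left p t)
      then have "toks k @ False # toks (c # x) = replicate t True @ p"
        by (simp only: toks_kc)
      with k_left[OF left(2,5)] have "k0 = []" by blast
      with left(3) have "True # False # toks (c # x) = replicate t True @ p"
        using ea by (simp add: toks_Cons suff_Cons)
      with left(5) poly_hd[OF left(2)] have False
        by (cases t; cases "t - 1") auto
      then show ?thesis ..
    qed
    have "toks k @ False # toks (c # x) = p @ replicate t True"
      using p(2) by (simp only: toks_kc)
    from append_False_eq_replicate[OF this] obtain q where
      q: "p = toks k @ False # q" "toks (c # x) = q @ replicate t True"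
      by blast
    have pleaf: "p \<noteq> leaf" if "4 \<le> length k"
    proof
      assume "p = leaf"
      with q(1) have "count_list (toks k) False \<le> 2" by (auto dest: arg_cong[of _ _ "\<lambda>l. count_list l False"])
      with count_toks[of k] that show False by simp
    qed
    \<comment> \<open>In the outer polygon the edge after \<open>k\<close> is a plain side; it may
      be exchanged for the polygon \<open>s\<close> of \<open>v\<close>.\<close>
    from kword_slot[OF kw _ p(1), of "False # q" "[]"] q(1) pleaf
    obtain s0 z where z: "side s0" "False # q = s0 @ True # z"
      "\<And>s'. side s' \<Longrightarrow> poly (toks k @ s' @ True # z)"
      by auto
    then have qz: "q = True # z"
      using side_FalseD by (cases s0 rule: list.exhaust) auto
    have "toks (b # rest) = toks v @ suff x"
      unfolding vx[symmetric] using lv by (intro toks_append') auto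
    also have "\<dots> = s @ replicate m True @ suff x"
      by (simp add: s(2))
    also have "replicate m True @ suff x = toks (c # x)"
      by (simp add: toks_Cons cr)
    finally have "toks (b # rest) = s @ True # z @ replicate t True"
      by (simp add: q(2) qz)
    moreover have "c' = rexc (last w) t"
    proof (cases "x = []")
      case True
      then have "last w = last v" using vx rest by (metis append_Nil2 last_w)
      with True c't cr m0 show ?thesis
        by (simp add: rexc_def split: nat.split)
    next
      case x: False
      then have "last w = last x" using vx rest by (metis last_appendR last_w)
      with x c't show ?thesis by simp
    qed
    ultimately show ?thesis
      unfolding good_def using aw s m0 z(3)[OF inner[OF s(1)]] rest False
      by (intro conjI disjI1 exI[of _ s] exI[of _ m] exI[of _ z] exI[of _ t]) auto
  qed
qed

lemma good_mB:
  assumes "v @ x = b # rest" "good v x c'"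
  shows "mB w = Some c'"
proof -
  have aw: "alt w" using assms(2) by (simp add: good_def)
  from assms(2) consider
    s z t where "poly (toks k @ s @ True # z)" "toks (b # rest) = s @ True # z @ replicate t True"
      "c' = rexc (last w) t"
    | p t where "k0 = []" "x = []" "poly p" "toks v = replicate t True @ p" "c' = lexc g (Suc t)"
    unfolding good_def by blast
  then show ?thesis
  proof cases
    case (1 s z t)
    then have "toks w = (toks k @ s @ True # z) @ replicate t True"
      unfolding toks_w by simp
    from mB_right[OF aw 1(1) this] 1(3) show ?thesis by simp
  next
    case (2 p t)
    then have "toks w = replicate (Suc t) True @ p"
      unfolding toks_w using assms(1) ea by simp
    from mB_left[OF aw 2(3) this] 2 show ?thesis by simp
  qed
qed

text \<open>Two cuts would show two polygons at the start of \<open>b # rest\<close> separated by a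
  separator, or one polygon there and another one filling the word after skipped corners. Parsing
  excludes both.\<close>

lemma good_unique:
  assumes "v1 @ x1 = b # rest" "v2 @ x2 = b # rest" "v1 \<noteq> []" "v2 \<noteq> []" "good v1 x1 c1" "good v2 x2 c2"
  shows "v1 = v2"
proof -
  have rr: False
    if "v @ x = b # rest" "v' @ x' = b # rest" "v \<noteq> []" "v' \<noteq> []" "length v < length v'"
      "poly s" "toks v = s @ replicate m True" "poly s'" "toks v' = s' @ replicate m' True" for v x v' x' s m s' m'
  proof -
    from that(1,2,5) obtain y where y: "v' = v @ y" "y \<noteq> []"
      by (metis append_eq_append_conv_if append_take_drop_id linorder_not_less nat_less_le order_refl take_all_iff append_Nil2)
    then have e: "s @ replicate m True @ False # toks y = s' @ replicate m' True"
      using that by (simp add: toks_append' suff_def)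
    with prefix_free(1)[OF that(6,8)] have "s = s'" by blast
    with e show False by (metis append.assoc replicate_True_ne_False same_append_eq)
  qed
  have rl: False
    if "v @ x = b # rest" "v \<noteq> []" "x \<noteq> []" "poly s" "0 < m" "toks v = s @ replicate m True"
      "poly p" "toks (b # rest) = replicate t True @ p" for v x s m p t
  proof -
    have e: "s @ replicate m True @ False # toks x = replicate t True @ p"
      using that by (simp add: toks_append' suff_def flip: that(1))
    show False
    proof (cases "t = 0")
      case True
      with e prefix_free(1)[OF that(4,7), of "replicate m True @ False # toks x" "[]"] show False
        by simp
    next
      case False
      with no_poly_prefix[OF that(7,4) _ e[symmetric]] show False by simp
    qed
  qed
  let ?R = "\<lambda>v x. \<exists>s m. poly s \<and> 0 < m \<and> toks v = s @ replicate m True \<and> (k0 = [] \<longrightarrow> x \<noteq> [])"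
  let ?L = "\<lambda>v x. k0 = [] \<and> x = [] \<and> (\<exists>p t. poly p \<and> toks v = replicate t True @ p)"
  have rel: "?R v x \<or> ?L v x" if "good v x c" for v x c
    using that unfolding good_def by blast
  from rel[OF assms(5)] rel[OF assms(6)] consider "?R v1 x1" "?R v2 x2" | "?R v1 x1" "?L v2 x2"
    | "?L v1 x1" "?R v2 x2" | "?L v1 x1" "?L v2 x2"
    by blast
  then show ?thesis
  proof cases
    case 1
    show ?thesis
    proof (rule ccontr)
      assume "v1 \<noteq> v2"
      then have "length v1 \<noteq> length v2"
        using assms(1,2) by (metis append_eq_append_conv)
      then consider "length v1 < length v2" | "length v2 < length v1" by linarith
      then show False
        using 1 rr[OF assms(1,2,3,4)] rr[OF assms(2,1,4,3)] by cases blast+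
    qed
  next
    case 2
    then have "v2 = b # rest" using assms(2) by simp
    with 2 rl[OF assms(1,3)] show ?thesis by blast
  next
    case 3
    then have "v1 = b # rest" using assms(1) by simp
    with 3 rl[OF assms(2,4)] show ?thesis by blast
  next
    case 4
    with assms show ?thesis by simp
  qed
qed

text \<open>The code of \<open>b # rest\<close> begins with a corner, so in a right disk the edge of
  the root tile after \<open>k\<close> carries a polygon, and cutting there gives the nested
  product. In the excluded word \<open>k\<close> is the whole quadrilateral and \<open>b\<close> is
  pure surplus.\<close>

lemma mB_good:
  assumes m: "mB w = Some c'" and l: "3 \<le> length w" and ns: "\<not> (length k = 4 \<and> rest = [])"
  shows "\<exists>v x c. v @ x = b # rest \<and> 3 \<le> length v \<and> mB v = Some c \<and> mB (k @ c # x) = Some c'"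
proof -
  have aw: "alt w" using mB_alt[OF m l] .
  then have ab: "alt (b # rest)" by (simp add: alt_w)
  have ak: "alt k" using kw by (simp add: kword_def)
  from m l show ?thesis
  proof (cases rule: mB_Some_cases)
    case (right p t)
    have e: "toks k @ toks (b # rest) = p @ replicate t True"
      using right(3) by (simp only: toks_w)
    have "\<not> 4 \<le> length k"
    proof
      assume "4 \<le> length k"
      with kword_slot[OF kw _ right(2) e] have "p = leaf" by auto
      moreover from length_ge4[OF \<open>4 \<le> length k\<close>] obtain h1 h2 h3 h4 k' where
        k: "k = h1 # h2 # h3 # h4 # k'"
        by blast
      with kw have "toks k = leaf @ suff k'"
        unfolding k kword_def by (simp add: toks_Cons suff_Cons)
      ultimately have "suff k' @ toks (b # rest) = replicate t True"
        using e by simp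
      then have "k' = []" "rest = []"
        by (auto simp: suff_def toks_Cons Cons_replicate_eq replicate_True_ne_False split: if_splits
            dest: sym)
      with ns k show False by simp
    qed
    with kword_slot[OF kw _ right(2) e] obtain s z where
      sz: "side s" "toks (b # rest) = s @ True # z @ replicate t True"
        "\<And>s'. side s' \<Longrightarrow> poly (toks k @ s' @ True # z)" "length k < 3 \<Longrightarrow> False \<in> set z"
      by auto
    obtain r where "toks (b # rest) = True # r"
      using b0 by (cases "esz b") (auto simp: toks_Cons)
    with sz(1,2) have s: "poly s"
      by (cases s rule: list.exhaust) (auto dest: side_TrueD)
    from toks_cut[OF sz(2)] obtain v x n where
      vx: "b # rest = v @ x" "v \<noteq> []" "0 < n" "toks v = s @ replicate n True"
        "True # z @ replicate t True = replicate n True @ suff x"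
      by blast
    have av: "alt v" "alt x" using ab unfolding vx(1) by (auto simp: alt_append)
    have lv: "3 \<le> length v"
      using poly_length[OF s, of v "[]"] vx(4) by simp
    define c where "c = rexc (last v) n"
    have mv: "mB v = Some c"
      unfolding c_def using mB_right[OF av(1) s vx(4)] .
    have "odd (count_list (toks v) False)"
      using odd_count(1)[OF s] vx(4) by simp
    then have "even (length v)"
      using count_toks[OF vx(2)] by (metis even_Suc)
    moreover have hv: "hd v = b" using vx(1,2) by (cases v) auto
    ultimately have cD: "isD c \<noteq> isD a"
      using alt_isD[OF av(1) vx(2)] vx(3) g(6) by (auto simp: c_def)
    have "alt (v @ x)" using ab vx(1) by simp
    then have "alt (k @ c # x)"
      using ak mB_ends[OF mv] cD vx(2,3) hv g(4)
      by (auto simp: alt_append alt_Cons c_def)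
    moreover have "toks (k @ c # x) = (toks k @ [False] @ True # z) @ replicate t True"
      using vx(5) by (simp only: toks_kc toks_Cons) (simp add: c_def)
    ultimately have "mB (k @ c # x) = Some (rexc (last (k @ c # x)) t)"
      using sz(3)[OF edge] mB_right by blast
    moreover have "rexc (last (k @ c # x)) t = rexc (last w) t"
    proof (cases "x = []")
      case True
      moreover have "rest \<noteq> []" using lv vx(1) True by auto
      ultimately have "last w = last v" using vx(1) by (metis append_Nil2 last_w)
      with True vx(3) show ?thesis
        by (simp add: c_def) (simp add: rexc_def split: nat.split)
    next
      case x: False
      then have "rest \<noteq> []" using vx(1,2) by (cases v) auto
      then have "last w = last x" using vx(1) x by (metis last_appendR last_w)
      with x show ?thesis by simp
    qed
    ultimately show ?thesis
      using vx(1) lv mv right(4) by metis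
  next
    case (left p t)
    have e: "toks k @ toks (b # rest) = replicate t True @ p"
      using left(3) by (simp only: toks_w)
    from k_left[OF left(2,5) e] have k0: "k0 = []" .
    obtain n where n: "t = Suc n" using left(5) by (cases t) auto
    have e': "toks (b # rest) = replicate n True @ p"
      using e k0 n ea by simp
    have lv: "3 \<le> length (b # rest)"
      using poly_length[OF left(2), of "b # rest" _ "[]"] e' by simp
    have c': "c' = lexc g (Suc n)" using left(4) k0 n by simp
    have "mB (b # rest) = Some (lexc b n)"
    proof (cases "n = 0")
      case True
      with mB_right[OF ab left(2), of 0] e' have r: "mB (b # rest) = Some (rexc (last (b # rest)) 0)"
        by simp
      have "rexc (last (b # rest)) 0 = Idm (src b)"
        using mB_ends[OF r] by (simp add: rexc_def)
      with r True show ?thesis by (simp add: lexc_def)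
    next
      case False
      with mB_left[OF ab left(2) e'] show ?thesis by simp
    qed
    moreover have "bmul a (lexc b n) = Some c'"
    proof -
      have "c' = lexc g (Suc n)" by fact
      have "lexc b n = rexc (lexc g (Suc n)) n"
      proof (cases n)
        case 0
        then show ?thesis using ea g tgt_arrow[of a] tgt_arrow[of "lexc g (Suc 0)"]
          by (auto simp: lexc_def[of b] rexc_def split: if_splits)
      next
        case (Suc j)
        have "src a = (if isD a then src b else other (src b))"
          using g tgt_arrow[of a] ea by (auto simp: other_eq_iff split: if_splits)
        then show ?thesis
          using g by (auto simp: Suc rexc_def lexc_def)
      qed
      then show ?thesis
        using ea g by (subst bmul_rexc) (auto simp: c')
    qed
    ultimately show ?thesis
      using lv k0 by (intro exI[of _ "b # rest"] exI[of _ "[]"] exI[of _ "lexc b n"]) simp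
  qed
qed

text \<open>The case without a diagonal. In the relation this product cancels against the fourfold
  product of \<open>k\<close> followed by multiplication with \<open>b\<close>.\<close>

lemma mB_special:
  assumes "length k = 4" "rest = []"
  shows "mB w = Some b"
proof -
  have k: "toks k = leaf"
    using kw assms(1) by (rule kword_toks4)
  have aw: "alt w" unfolding alt_w using b0 assms(2) by (simp add: alt_Cons)
  have "toks w = leaf @ replicate (esz b) True"
    unfolding toks_w k using assms(2) by simp
  from mB_right[OF aw poly_leaf this] have "mB w = Some (rexc g (esz b))"
    by (simp add: assms(2))
  moreover have "esz g - esz a = esz b" "0 < esz g" "0 < esz a"
    using g(1) ea by simp_all
  then have "b = rexc g (esz b)"
    using ab bmul_rexc[of a g b] by metis
  ultimately show ?thesis by metis
qed

end

lemma cut_single: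
  assumes "p @ q = w" "\<And>u v. u @ v = w \<Longrightarrow> u \<noteq> p \<Longrightarrow> Q u v = 0"
  shows "cut Q w = Q p q"
proof -
  have "cut Q w = (\<Sum>(u, v)\<in>{(p, q)}. Q u v)"
    unfolding cut_def
    by (rule sum.mono_neutral_right[OF finite_splits]) (use assms in \<open>auto simp: splits_def\<close>)
  then show ?thesis by simp
qed

lemma cut_append:
  "cut Q (u @ y) = cut (\<lambda>u1 u2. Q u1 (u2 @ y)) u + cut (\<lambda>y1 y2. if y1 = [] then 0 else Q (u @ y1) y2) y"
proof (induction u arbitrary: Q)
  case Nil
  then show ?case by (cases y) (simp_all add: cut_Cons)
next
  case (Cons a u)
  then show ?case by (simp add: cut_Cons add.assoc cong: if_cong)
qed

context word_product
begin

lemma ins_append: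
  "ins \<phi> (u @ y) = ins (\<lambda>s. \<phi> (s @ y)) u + ins (\<lambda>s. \<phi> (u @ s)) y
     + cut (\<lambda>u1 u2. cut (\<lambda>y1 y2. if u2 = [] \<or> y1 = [] then 0 else val (\<lambda>c. \<phi> (u1 @ c # y2)) (u2 @ y1)) y) u"
proof (induction u arbitrary: \<phi>)
  case Nil
  then show ?case by simp
next
  case (Cons a u)
  have "pre \<phi> (a # u @ y) = pre (\<lambda>s. \<phi> (s @ y)) (a # u)
      + cut (\<lambda>y1 y2. if y1 = [] then 0 else val (\<lambda>c. \<phi> (c # y2)) (a # u @ y1)) y"
    unfolding pre_def using cut_append[of _ "a # u" y] by (simp only: append_Cons)
  then show ?case
    by (simp add: Cons.IH cut_Cons ac_simps cong: if_cong)
qed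

lemma ins_neutral:
  assumes "\<And>u v x c. u @ v @ x = w \<Longrightarrow> m v = Some c \<Longrightarrow> \<phi> (u @ c # x) = 0"
  shows "ins \<phi> w = 0"
  unfolding ins_eq_cut
  using assms by (intro cut_neutral) (auto simp: val_def split: option.split)

end

section \<open>Composable words and linear extension over the field with two elements\<close>

definition comp :: "bgen list \<Rightarrow> bool" where
  "comp w \<longleftrightarrow> successively (\<lambda>a b. tgt a = src b) w"

lemma comp_simps [simp]: "comp []" "comp [g]"
  by (simp_all add: comp_def)

lemma comp_append: "comp (u @ v) \<longleftrightarrow> comp u \<and> comp v \<and> (u \<noteq> [] \<longrightarrow> v \<noteq> [] \<longrightarrow> tgt (last u) = src (hd v))"
  by (auto simp: comp_def successively_append_iff)

lemma comp_Cons: "comp (g # w) \<longleftrightarrow> comp w \<and> (w \<noteq> [] \<longrightarrow> tgt g = src (hd w))"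
  by (cases w) (auto simp: comp_def)

lemma alt_comp: "alt w \<Longrightarrow> comp w"
  by (induction w) (auto simp: alt_Cons comp_Cons)

lemma kword_comp: "kword w \<Longrightarrow> comp w"
  by (simp add: kword_def alt_comp)

lemma kword_esz: "kword w \<Longrightarrow> g \<in> set w \<Longrightarrow> esz g = 1"
  by (simp add: kword_def)

lemma mB_comp: "mB w = Some c \<Longrightarrow> comp w"
proof (cases "length w = 2")
  case True
  assume "mB w = Some c"
  with mB_two[OF True] show ?thesis
    using bmul_Some(4) by (fastforce simp: comp_Cons)
next
  case False
  assume c: "mB w = Some c"
  with mB_length[OF this] False have "3 \<le> length w" by simp
  with mB_alt[OF c] alt_comp show ?thesis by blast
qed

lemma mB_comp_replace: "mB v = Some c \<Longrightarrow> comp (u @ c # x) \<longleftrightarrow> comp (u @ v @ x)"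
  using mB_comp[of v c] mB_ends[of v c] mB_length[of v c]
  by (cases "v = []") (auto simp: comp_append comp_Cons)

lemma mB_Idm: "Idm i \<in> set w \<Longrightarrow> 3 \<le> length w \<Longrightarrow> mB w = None"
  using mB_alt by (cases "mB w") (force simp: alt_def)+

lemma bit_add_self [simp]: "p + p = (0 :: 'a \<Rightarrow>\<^sub>0 bit)"
  by (rule poly_mapping_eqI) (simp add: lookup_add)

definition lin :: "('a \<Rightarrow> 's::ab_group_add) \<Rightarrow> ('a \<Rightarrow>\<^sub>0 bit) \<Rightarrow> 's" where
  "lin \<phi> p = (\<Sum>c\<in>Poly_Mapping.keys p. \<phi> c)"

lemma lin_zero [simp]: "lin \<phi> 0 = 0"
  by (simp add: lin_def)

lemma lin_single [simp]: "lin \<phi> (Poly_Mapping.single c 1) = \<phi> c"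
  by (simp add: lin_def)

lemma lin_add:
  fixes \<phi> :: "'a \<Rightarrow> 's::ab_group_add"
  assumes char2: "\<And>x::'s. x + x = 0"
  shows "lin \<phi> (p + q) = lin \<phi> p + lin \<phi> q"
proof -
  let ?S = "Poly_Mapping.keys p \<union> Poly_Mapping.keys q"
  have e: "lin \<phi> r = (\<Sum>c\<in>?S. if Poly_Mapping.lookup r c = 0 then 0 else \<phi> c)"
    if "Poly_Mapping.keys r \<subseteq> ?S" for r
    unfolding lin_def using that
    by (intro sum.mono_neutral_cong_left) (auto simp: in_keys_iff)
  have "lin \<phi> (p + q) = (\<Sum>c\<in>?S. (if Poly_Mapping.lookup p c = 0 then 0 else \<phi> c)
      + (if Poly_Mapping.lookup q c = 0 then 0 else \<phi> c))"
    using Poly_Mapping.keys_add[of p q]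
    by (subst e) (auto intro!: sum.cong simp: lookup_add char2 bit_not_zero_iff)
  then show ?thesis
    by (simp add: sum.distrib e)
qed

text \<open>\<open>kv\<close> prescribes the morphism on the Koszul words \<open>kword\<close>, the alternating words of arrows.\<close>

locale gauge = dga2_words M d mB
  for M :: "'r::ab_group_add \<Rightarrow> 'r \<Rightarrow> 'r" and d :: "'r \<Rightarrow> 'r" +
  fixes e :: "vtx \<Rightarrow> 'r" and kv :: "bgen list \<Rightarrow> 'r"
  assumes d_e: "d (e v) = 0"
    and e_idem: "M (e v) (e v) = e v"
    and e_orth: "v \<noteq> w \<Longrightarrow> M (e v) (e w) = 0"
    and kv_src: "kword k \<Longrightarrow> k \<noteq> [] \<Longrightarrow> M (e (src (hd k))) (kv k) = kv k"
    and kv_tgt: "kword k \<Longrightarrow> k \<noteq> [] \<Longrightarrow> M (kv k) (e (tgt (last k))) = kv k"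
    and kv_defect: "kword k \<Longrightarrow> k \<noteq> [] \<Longrightarrow>
      d (kv k) + cut (\<lambda>u v. if u = [] \<or> v = [] then 0 else M (kv u) (kv v)) k
        + (if length k = 4 then e (src (hd k)) else 0) = 0"
begin

text \<open>With \<open>val_fundef_cong\<close>, this tells the termination proof of
  \<open>fb\<close> that \<open>v\<close> and \<open>x\<close> are pieces of the given word and that
  \<open>c\<close> is the product of \<open>v\<close>.\<close>

lemma cut_fundef_cong [fundef_cong]:
  "w = w' \<Longrightarrow> (\<And>u v. u @ v = w' \<Longrightarrow> Q u v = Q' u v) \<Longrightarrow> cut Q w = cut Q' w'"
  using cut_cong by blast

lemma val_fundef_cong [fundef_cong]:
  "v = v' \<Longrightarrow> (\<And>c. mB v' = Some c \<Longrightarrow> \<phi> c = \<psi> c) \<Longrightarrow> val \<phi> v = val \<psi> v'"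
  by (auto simp: val_def split: option.split)

abbreviation arrows :: "bgen list \<Rightarrow> bgen list" where
  "arrows w \<equiv> takeWhile (\<lambda>h. esz h = 1) w"

abbreviation nonarrows :: "bgen list \<Rightarrow> bgen list" where
  "nonarrows w \<equiv> dropWhile (\<lambda>h. esz h = 1) w"

text \<open>Write a word of nonidentities as \<open>k0 @ g # rest\<close> with \<open>k0\<close> consisting of arrows and \<open>g = a b\<close>
  with an arrow \<open>a\<close>.  We require \<open>fb\<close> to vanish on the barred word \<open>k0 @ a # b # rest\<close>; the
  morphism equation on the barred word then determines \<open>fb\<close> on the given one.\<close>

function fb :: "bgen list \<Rightarrow> 'r" where
  "fb w =
    (if w \<noteq> [] \<and> comp w \<and> (\<forall>g\<in>set w. 0 < esz g) then
       if kword w then kv w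
       else if nonarrows w \<noteq> [] \<and> 2 \<le> esz (hd (nonarrows w)) \<and> kword (arrows w @ [lexc (hd (nonarrows w)) 1]) then
         M (kv (arrows w @ [lexc (hd (nonarrows w)) 1]))
           (fb (rexc (hd (nonarrows w)) (esz (hd (nonarrows w)) - 1) # tl (nonarrows w)))
         + cut (\<lambda>v x. if 3 \<le> length v then
              val (\<lambda>c. fb (arrows w @ lexc (hd (nonarrows w)) 1 # c # x)) v else 0)
             (rexc (hd (nonarrows w)) (esz (hd (nonarrows w)) - 1) # tl (nonarrows w))
       else 0
     else if \<exists>v. w = [Idm v] then e (src (hd w)) else 0)"
  by auto
termination
proof (relation "measure wsize")
  show "wf (measure wsize)" by simp
next
  fix w assume w: "nonarrows w \<noteq> [] \<and> 2 \<le> esz (hd (nonarrows w)) \<and> kword (arrows w @ [lexc (hd (nonarrows w)) 1])"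
  then have s: "wsize w = wsize (arrows w) + esz (hd (nonarrows w)) + wsize (tl (nonarrows w))"
    by (metis takeWhile_dropWhile_id wsize_simps(2,3) list.collapse add.assoc)
  have g2: "2 \<le> esz (hd (nonarrows w))"
    using w by blast
  show "(rexc (hd (nonarrows w)) (esz (hd (nonarrows w)) - 1) # tl (nonarrows w), w) \<in> measure wsize"
    using g2 s by simp
  fix v x c
  assume vx: "v @ x = rexc (hd (nonarrows w)) (esz (hd (nonarrows w)) - 1) # tl (nonarrows w)"
    and v: "3 \<le> length v" "mB v = Some c"
  have "wsize v + wsize x = esz (hd (nonarrows w)) - 1 + wsize (tl (nonarrows w))"
    using arg_cong[OF vx, of wsize] by simp
  with s g2 mB_wsize[OF v(2,1)]
  show "(arrows w @ lexc (hd (nonarrows w)) 1 # c # x, w) \<in> measure wsize"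
    by simp
qed

declare fb.simps [simp del]

lemma fb_Nil [simp]: "fb [] = 0"
  by (subst fb.simps) simp

lemma fb_Idm [simp]: "fb [Idm v] = e v"
  by (subst fb.simps) simp

lemma fb_not_comp: "\<not> comp w \<Longrightarrow> fb w = 0"
  by (subst fb.simps) auto

lemma fb_has_Idm: "u \<noteq> [] \<or> x \<noteq> [] \<Longrightarrow> fb (u @ Idm i # x) = 0"
  by (subst fb.simps) (auto simp: append_eq_Cons_conv)

lemma fb_kword: "kword w \<Longrightarrow> w \<noteq> [] \<Longrightarrow> fb w = kv w"
  by (subst fb.simps) (auto simp: kword_comp kword_esz)

text \<open>Both tests of the recursion fail: the initial run of arrows contains \<open>a\<close>,
  and the following letter \<open>b\<close> has the same type as \<open>a\<close>.\<close>

lemma fb_barred: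
  assumes "kword (k0 @ [a])" "bmul a b = Some g" "0 < esz b"
  shows "fb (k0 @ a # b # rest) = 0"
proof -
  have a: "esz a = 1" using assms(1) by (simp add: kword_def)
  have D: "isD a = isD b" using bmul_Some[OF assms(2)] assms(3) a by simp
  have k0: "\<forall>h\<in>set k0. esz h = 1" using assms(1) by (simp add: kword_def)
  let ?w = "k0 @ a # b # rest"
  have "\<not> kword ?w"
    using D by (auto simp: kword_def alt_append alt_Cons)
  moreover have "\<not> kword (arrows ?w @ [lexc (hd (nonarrows ?w)) 1])"
  proof (cases "esz b = 1")
    case True
    then have "arrows ?w = k0 @ a # b # arrows rest"
      using a k0 by (simp add: takeWhile_append2)
    with D show ?thesis
      by (auto simp: kword_def alt_append alt_Cons)
  next
    case False
    then have "arrows ?w = k0 @ [a]" "nonarrows ?w = b # rest"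
      using a k0 by (simp_all add: takeWhile_append2 dropWhile_append2)
    with D show ?thesis
      by (auto simp: kword_def alt_append alt_Cons)
  qed
  ultimately show ?thesis
    by (subst fb.simps) auto
qed

lemma fb_unbarred:
  assumes kw: "kword (k0 @ [a])" and ab: "bmul a b = Some g" and b0: "0 < esz b"
    and "comp (k0 @ g # rest)" "\<forall>h\<in>set rest. 0 < esz h"
  shows "fb (k0 @ g # rest) = M (kv (k0 @ [a])) (fb (b # rest))
    + cut (\<lambda>v x. if 3 \<le> length v then val (\<lambda>c. fb (k0 @ a # c # x)) v else 0) (b # rest)"
proof -
  interpret barred_word k0 a b g rest
    using kw ab b0 by unfold_locales
  have k0: "\<forall>h\<in>set k0. esz h = 1" using kw by (simp add: kword_def)
  have g2: "2 \<le> esz g" using g(1) b0 by simp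
  have tw: "arrows w = k0" "nonarrows w = g # rest"
    using k0 g2 by (simp_all add: takeWhile_append2 dropWhile_append2)
  have l: "lexc g 1 = a"
    using g ea by (intro bgen_eqI) auto
  have "esz g - esz a = esz g - 1" "0 < esz g" "0 < esz a"
    using ea g(1) by simp_all
  then have r: "rexc g (esz g - 1) = b"
    using ab bmul_rexc[of a g b] by metis
  have nk: "\<not> kword w"
    using g2 by (auto simp: kword_def)
  have pos: "w \<noteq> [] \<and> comp w \<and> (\<forall>h\<in>set w. 0 < esz h)"
    using assms(4,5) k0 g2 by auto
  have kwg: "nonarrows w \<noteq> [] \<and> 2 \<le> esz (hd (nonarrows w)) \<and> kword (arrows w @ [lexc (hd (nonarrows w)) 1])"
    unfolding tw list.sel l using kw g2 by blast
  show ?thesis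
    unfolding fb.simps[of w] if_P[OF pos] if_not_P[OF nk] if_P[OF kwg]
    unfolding tw list.sel l r ..
qed

lemma M_cut: "M (cut Q w) z = cut (\<lambda>u v. M (Q u v) z) w" "M z (cut Q w) = cut (\<lambda>u v. M z (Q u v)) w"
  by (simp_all add: cut_hom[of "\<lambda>x. M x z"] cut_hom[of "M z"] M_add_left M_add_right)

text \<open>The pairing behind the contraction. Take the longest initial Koszul word: if its last
  letter multiplies with the next one, the word is refined; otherwise the next letter has exponent
  at least two, and an arrow can be split off.\<close>

lemma word_cases:
  obtains "\<not> comp w" | u i x where "w = u @ Idm i # x" | "kword w"
    | k0 a b g rest where "w = k0 @ g # rest" "kword (k0 @ [a])" "bmul a b = Some g" "0 < esz b"
        "comp w" "\<forall>h\<in>set w. 0 < esz h"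
    | k0 a b g rest where "w = k0 @ a # b # rest" "kword (k0 @ [a])" "bmul a b = Some g" "0 < esz b"
proof -
  note rule = that
  have "(\<not> comp w) \<or> (\<exists>u i x. w = u @ Idm i # x) \<or> kword w \<or>
    (\<exists>k0 a b g rest. w = k0 @ g # rest \<and> kword (k0 @ [a]) \<and> bmul a b = Some g \<and> 0 < esz b \<and>
       comp w \<and> (\<forall>h\<in>set w. 0 < esz h)) \<or>
    (\<exists>k0 a b g rest. w = k0 @ a # b # rest \<and> kword (k0 @ [a]) \<and> bmul a b = Some g \<and> 0 < esz b)"
    (is "?P w")
  proof (cases "comp w \<and> (\<forall>h\<in>set w. 0 < esz h)")
    case False
    then consider "\<not> comp w" | h where "h \<in> set w" "esz h = 0" by blast
    then show ?thesis
    proof cases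
      case (2 h)
      from 2(2) obtain i where "h = Idm i" by (cases h) auto
      with 2 show ?thesis by (metis in_set_conv_decomp)
    qed blast
  next
    case w: True
    define k where "k = (GREATEST n. n \<le> length w \<and> kword (take n w))"
    have k: "k \<le> length w \<and> kword (take k w)"
      unfolding k_def by (rule GreatestI_nat[of _ 0 "length w"]) (auto simp: kword_def)
    have max: "\<not> kword (take (Suc k) w)" if "k < length w"
      using Greatest_le_nat[of "\<lambda>n. n \<le> length w \<and> kword (take n w)" "Suc k" "length w"] that
      unfolding k_def[symmetric] by auto
    show ?thesis
    proof (cases "k = length w")
      case True
      with k show ?thesis by simp
    next
      case False
      with k have kl: "k < length w" by simp
      define g rest where "g = w ! k" and "rest = drop (Suc k) w"
      have wk: "w = take k w @ g # rest"
        unfolding g_def rest_def using kl by (simp add: id_take_nth_drop)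
      have t: "take (Suc k) w = take k w @ [g]"
        using kl by (simp add: take_Suc_conv_app_nth g_def)
      have g0: "0 < esz g" and cg: "comp (take k w @ g # rest)"
        using w wk by (metis in_set_conv_decomp, metis)
      have nk: "\<not> kword (take k w @ [g])" using max[OF kl] t by simp
      show ?thesis
      proof (cases "take k w \<noteq> [] \<and> isD (last (take k w)) = isD g")
        case True
        then obtain k0 a where k0: "take k w = k0 @ [a]"
          by (metis append_butlast_last_id)
        have ka: "kword (k0 @ [a])" using k k0 by simp
        have "esz a = 1" using ka by (simp add: kword_def)
        then have "bmul a g \<noteq> None"
          using True k0 g0 cg by (simp add: bmul_None comp_append comp_Cons)
        then show ?thesis
          using wk k0 ka g0 by (metis append.assoc append_Cons append_Nil not_None_eq)
      next
        case False
        define a where "a = lexc g 1"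
        have "alt (take k w @ [g])"
          using k False g0 cg by (auto simp: kword_def alt_append alt_Cons comp_append)
        then have "esz g \<noteq> 1"
          using nk k by (auto simp: kword_def)
        with g0 have g2: "2 \<le> esz g" by simp
        have ka: "kword (take k w @ [a])"
          using k False g0 cg by (auto simp: kword_def alt_append alt_Cons comp_append a_def)
        have "bmul a (rexc g (esz g - 1)) = Some g"
          using g2 by (subst bmul_rexc) (auto simp: a_def)
        moreover have "0 < esz (rexc g (esz g - 1))" using g2 by simp
        ultimately show ?thesis
          using wk ka w by metis
      qed
    qed
  qed
  then show ?thesis
    using rule by blast
qed

text \<open>Makes values of \<open>fb\<close> multiply to zero across a junction that is not
  composable, and lets the \<open>e v\<close> act as units on them.\<close>

lemma fb_src_tgt:
  "w \<noteq> [] \<Longrightarrow> M (e (src (hd w))) (fb w) = fb w \<and> M (fb w) (e (tgt (last w))) = fb w"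
proof (induction "wsize w" arbitrary: w rule: less_induct)
  case less
  show ?case
  proof (cases rule: word_cases[of w])
    case 1
    then show ?thesis by (simp add: fb_not_comp)
  next
    case (2 u i x)
    then show ?thesis
      by (cases "u = [] \<and> x = []") (auto simp: e_idem fb_has_Idm)
  next
    case 3
    with less.prems show ?thesis
      by (simp add: fb_kword kv_src kv_tgt)
  next
    case (4 k0 a b g rest)
    interpret barred_word k0 a b g rest
      using 4 by unfold_locales
    let ?y = "b # rest"
    let ?C = "\<lambda>v x. if 3 \<le> length v then val (\<lambda>c. fb (k0 @ a # c # x)) v else 0"
    have fw: "fb w = M (kv k) (fb ?y) + cut ?C ?y"
      unfolding 4(1) by (rule fb_unbarred) (use 4 in auto)
    have hd: "src (hd w) = src (hd k)" "src (hd w) = src (hd (k0 @ a # z))" for z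
      using 4(1) g by (cases k0; simp)+
    have lst: "tgt (last w) = tgt (last ?y)"
      using 4(1) g by simp
    have "wsize ?y < wsize w"
      using 4(1) g by simp
    from less.hyps[OF this] have y: "M (fb ?y) (e (tgt (last w))) = fb ?y"
      unfolding lst by blast
    have C: "M (e (src (hd w))) (?C v x) = ?C v x \<and> M (?C v x) (e (tgt (last w))) = ?C v x"
      if "v @ x = ?y" for v x
    proof (cases "3 \<le> length v \<and> mB v \<noteq> None")
      case True
      then obtain c where c: "mB v = Some c" "3 \<le> length v" by auto
      have "wsize (k0 @ a # c # x) < wsize w"
        using mB_wsize[OF c] arg_cong[OF that, of wsize] 4(1) g ea by simp
      note ih = less.hyps[OF this]
      have "tgt (last (k0 @ a # c # x)) = tgt (last ?y)"
        using mB_ends[OF c(1)] c(2) that by (cases "x = []") (auto simp flip: that)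
      with ih hd(2) lst c show ?thesis
        by (simp add: val_def)
    next
      case False
      then show ?thesis by (auto simp: val_def)
    qed
    have "M (e (src (hd w))) (M (kv k) (fb ?y)) = M (kv k) (fb ?y)"
      using kv_src[OF kw] by (simp add: hd(1) flip: M_assoc)
    moreover have "M (e (src (hd w))) (cut ?C ?y) = cut ?C ?y"
      unfolding M_cut by (rule cut_cong) (use C in blast)
    moreover have "M (cut ?C ?y) (e (tgt (last w))) = cut ?C ?y"
      unfolding M_cut by (rule cut_cong) (use C in blast)
    ultimately show ?thesis
      by (simp only: fw M_add_left M_add_right M_assoc y)
  next
    case (5 k0 a b g rest)
    then show ?thesis by (simp add: fb_barred)
  qed
qed

lemma M_fb_not_comp: "\<not> comp (u @ v) \<Longrightarrow> M (fb u) (fb v) = 0"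
proof -
  assume "\<not> comp (u @ v)"
  then consider "\<not> comp u" | "\<not> comp v" | "u \<noteq> []" "v \<noteq> []" "tgt (last u) \<noteq> src (hd v)"
    by (auto simp: comp_append)
  then show ?thesis
  proof cases
    case 3
    have "M (fb u) (fb v) = M (M (fb u) (e (tgt (last u)))) (M (e (src (hd v))) (fb v))"
      using fb_src_tgt 3 by simp
    also have "\<dots> = M (fb u) (M (M (e (tgt (last u))) (e (src (hd v)))) (fb v))"
      by (simp only: M_assoc)
    finally show ?thesis
      using e_orth[OF 3(3)] by simp
  qed (simp_all add: fb_not_comp)
qed

lemma defect_not_comp: "\<not> comp w \<Longrightarrow> defect fb w = 0"
proof -
  assume w: "\<not> comp w"
  have "conv fb fb w = 0"
    unfolding conv_def by (rule cut_neutral) (use w M_fb_not_comp in blast)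
  moreover have "ins fb w = 0"
    by (rule ins_neutral) (use w mB_comp_replace fb_not_comp in blast)
  ultimately show ?thesis
    using w by (simp add: defect_def fb_not_comp)
qed

lemma defect_Nil [simp]: "defect fb [] = 0"
  by (simp add: defect_def conv_def)

text \<open>Products inside a Koszul word are idempotents, and \<open>fb\<close> kills longer words
  containing one. An insertion therefore survives only when the whole word has four arrows, which
  leaves \<open>kv_defect\<close>.\<close>

lemma defect_kword: "kword w \<Longrightarrow> defect fb w = 0"
proof (cases "w = []")
  case False
  assume kw: "kword w"
  have sub: "fb u = (if u = [] then 0 else kv u)" if "u @ v = w \<or> v @ u = w" for u v
    using that kw kword_append[of u v] kword_append[of v u] by (auto simp: fb_kword)
  have 1: "conv fb fb w = cut (\<lambda>u v. if u = [] \<or> v = [] then 0 else M (kv u) (kv v)) w"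
    unfolding conv_def
  proof (rule cut_cong)
    fix u v assume "u @ v = w"
    then have "fb u = (if u = [] then 0 else kv u)" "fb v = (if v = [] then 0 else kv v)"
      using sub by blast+
    then show "M (fb u) (fb v) = (if u = [] \<or> v = [] then 0 else M (kv u) (kv v))"
      by simp
  qed
  have z: "val (\<lambda>c. fb (u @ c # x)) v = 0" if "u @ v @ x = w" "u \<noteq> [] \<or> x \<noteq> []" for u v x
  proof (cases "mB v")
    case (Some c)
    have "kword v" using kw that(1) kword_append by blast
    from kword_mB[OF this Some] have "c = Idm (src (hd v))" by simp
    then show ?thesis using fb_has_Idm[OF that(2)] Some by (simp add: val_def)
  qed (simp add: val_def)
  have "ins fb w = cut (\<lambda>v x. val (\<lambda>c. fb ([] @ c # x)) v) w"
    unfolding ins_eq_cut by (rule cut_single) (auto intro!: cut_neutral z)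
  also have "\<dots> = val (\<lambda>c. fb ([] @ c # [])) w"
    by (rule cut_single[of w "[]"]) (auto intro: z[of "[]", simplified])
  also have "\<dots> = (if length w = 4 then e (src (hd w)) else 0)"
    using kword_mB[OF kw] mB_kword4[OF kw] by (cases "mB w") (auto simp: val_def)
  finally show ?thesis
    using kv_defect[OF kw False] False kw by (simp add: defect_def 1 fb_kword)
qed simp

text \<open>Strict unitality: an idempotent enters only twofold products with its neighbours and, at
  an end of the word, the cut beside it. In the interior the two products cancel each other; at an
  end the product cancels the cut.\<close>

lemma defect_Idm: "defect fb (u @ Idm i # x) = 0"
proof (cases "comp (u @ Idm i # x) \<and> (u \<noteq> [] \<or> x \<noteq> [])")
  case False
  moreover have "defect fb [Idm i] = 0"
    by (simp add: defect_def conv_def cut_Cons pre_def d_e val_def)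
  ultimately show ?thesis
    by (cases "comp (u @ Idm i # x)") (auto simp: defect_not_comp)
next
  case True
  then have ux: "u \<noteq> [] \<or> x \<noteq> []" by blast
  let ?w = "u @ Idm i # x"
  have u: "bmul (last u) (Idm i) = Some (last u)" if "u \<noteq> []"
    using True that by (auto simp: comp_append comp_Cons)
  have x: "bmul (Idm i) (hd x) = Some (hd x)" if "x \<noteq> []"
    using True that by (auto simp: comp_append comp_Cons)
  have eu: "M (fb u) (e i) = fb u"
    using fb_src_tgt[of u] True by (cases "u = []") (auto simp: comp_append comp_Cons)
  have ex: "M (e i) (fb x) = fb x"
    using fb_src_tgt[of x] True by (cases "x = []") (auto simp: comp_append comp_Cons)
  have conv: "conv fb fb ?w = (if u = [] then fb x else 0) + (if x = [] then fb u else 0)"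
  proof -
    have split: "(\<exists>p'. p = u @ Idm i # p' \<and> x = p' @ q) \<or> (\<exists>q'. q = q' @ Idm i # x \<and> u = p @ q')"
      if "p @ q = ?w" for p q
      using that by (auto simp: append_eq_append_conv2 append_eq_Cons_conv Cons_eq_append_conv)
    have z: "M (fb p) (fb q) = 0" if "p @ q = ?w" "\<not> (u = [] \<and> p = [Idm i])" "\<not> (x = [] \<and> q = [Idm i])" for p q
      using split[OF that(1)]
    proof (elim disjE exE conjE)
      fix p' assume "p = u @ Idm i # p'" "x = p' @ q"
      with that(2) show ?thesis by (auto simp: fb_has_Idm)
    next
      fix q' assume "q = q' @ Idm i # x" "u = p @ q'"
      with that(3) show ?thesis by (auto simp: fb_has_Idm)
    qed
    consider "u = []" "x \<noteq> []" | "u \<noteq> []" "x = []" | "u \<noteq> []" "x \<noteq> []" using ux by blast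
    then show ?thesis
    proof cases
      case 1
      then have "conv fb fb ?w = M (fb [Idm i]) (fb x)"
        unfolding conv_def by (intro cut_single z) auto
      with 1 ex show ?thesis by simp
    next
      case 2
      then have "conv fb fb ?w = M (fb u) (fb [Idm i])"
        unfolding conv_def by (intro cut_single z) auto
      with 2 eu show ?thesis by simp
    next
      case 3
      then have "conv fb fb ?w = 0"
        unfolding conv_def by (intro cut_neutral z) auto
      with 3 show ?thesis by simp
    qed
  qed
  have long: "mB v = None" if "Idm i \<in> set v" "length v \<noteq> 2" for v
    using mB_Idm[OF that(1)] mB_length[of v] that(2) by (cases "mB v") force+
  have t1: "ins (\<lambda>s. fb (s @ Idm i # x)) u = 0"
    by (rule ins_neutral, rule fb_has_Idm) simp
  have t2: "ins (\<lambda>s. fb (u @ Idm i # s)) x = 0"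
    by (rule ins_neutral) (simp add: fb_has_Idm)
  have t3: "pre (\<lambda>s. fb (u @ s)) (Idm i # x) = (if x = [] then 0 else fb (u @ x))"
  proof (cases x)
    case Nil
    then show ?thesis by (simp add: pre_def cut_Cons val_def)
  next
    case (Cons h x')
    have "pre (\<lambda>s. fb (u @ s)) (Idm i # x) = val (\<lambda>c. fb (u @ c # x')) [Idm i, h]"
      unfolding pre_def
    proof (rule cut_single)
      fix v y assume v: "v @ y = Idm i # x" "v \<noteq> [Idm i, h]"
      show "val (\<lambda>c. fb (u @ c # y)) v = 0"
      proof (cases v)
        case (Cons h' v')
        with v \<open>x = h # x'\<close> have "Idm i \<in> set v" "length v \<noteq> 2"
          by (cases v'; cases "tl v'"; auto)+
        from long[OF this] show ?thesis by (simp add: val_def)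
      qed simp
    qed (simp add: Cons)
    with x Cons show ?thesis by (simp add: val_def)
  qed
  have t4: "cut (\<lambda>u1 u2. cut (\<lambda>y1 y2. if u2 = [] \<or> y1 = [] then 0
      else val (\<lambda>c. fb (u1 @ c # y2)) (u2 @ y1)) (Idm i # x)) u = (if u = [] then 0 else fb (u @ x))"
    (is "cut ?Q u = _")
  proof (cases u rule: rev_cases)
    case (snoc u' h)
    have l: "val \<phi> (u2 @ y1) = 0" if h: "y1 \<noteq> []" "u2 \<noteq> []" "y1 @ y2 = Idm i # x" "\<not> (length u2 = 1 \<and> y1 = [Idm i])"
      for \<phi> :: "bgen \<Rightarrow> 'r" and u2 y1 y2
    proof -
      obtain y' where "y1 = Idm i # y'" using h(1,3) by (cases y1) auto
      with h have "Idm i \<in> set (u2 @ y1)" "length (u2 @ y1) \<noteq> 2"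
        by (cases u2; cases "tl u2"; auto)+
      from long[OF this] show ?thesis by (simp add: val_def)
    qed
    have "cut ?Q u = ?Q u' [h]"
    proof (rule cut_single)
      fix u1 u2 assume u12: "u1 @ u2 = u" "u1 \<noteq> u'"
      then have "length u2 \<noteq> 1"
        using snoc by (cases u2; cases "tl u2"; auto)
      then show "?Q u1 u2 = 0"
        by (intro cut_neutral) (auto intro!: l)
    qed (simp add: snoc)
    also have "\<dots> = val (\<lambda>c. fb (u' @ c # x)) ([h] @ [Idm i])"
    proof -
      have "?Q u' [h] = (if [h] = [] \<or> [Idm i] = [] then 0 else val (\<lambda>c. fb (u' @ c # x)) ([h] @ [Idm i]))"
      proof (rule cut_single)
        fix y1 y2 assume "y1 @ y2 = Idm i # x" "y1 \<noteq> [Idm i]"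
        then show "(if [h] = [] \<or> y1 = [] then 0 else val (\<lambda>c. fb (u' @ c # y2)) ([h] @ y1)) = 0"
          using l[of y1 "[h]" y2] by auto
      qed simp
      then show ?thesis by simp
    qed
    also have "\<dots> = fb (u @ x)"
      using u snoc by (simp add: val_def)
    finally show ?thesis using snoc by simp
  qed simp
  have "ins fb ?w = (if x = [] then 0 else fb (u @ x)) + (if u = [] then 0 else fb (u @ x))"
    by (subst ins_append) (simp add: t1 t2 t3 t4)
  then show ?thesis
    using ux conv by (auto simp: defect_def fb_has_Idm)
qed

text \<open>By \<open>mB_adjacent\<close> the only nonzero product across the bar is
  \<open>bmul a b\<close>, which isolates the term at the unbarred word.\<close>

lemma ins_barred:
  fixes \<psi> :: "bgen list \<Rightarrow> 's::ab_group_add"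
  assumes "bmul a b = Some g"
  shows "ins \<psi> (k0 @ a # b # rest) = ins (\<lambda>s. \<psi> (s @ b # rest)) (k0 @ [a])
    + (pre (\<lambda>s. \<psi> (k0 @ a # s)) (b # rest) + ins (\<lambda>s. \<psi> (k0 @ a # b # s)) rest) + \<psi> (k0 @ g # rest)"
proof -
  have l: "val \<phi> (u2 @ y1) = 0" if h: "u1 @ u2 = k0 @ [a]" "y1 @ y2 = b # rest" "y1 \<noteq> []" "u2 \<noteq> []" "\<not> (u1 = k0 \<and> y1 = [b])"
    for \<phi> :: "bgen \<Rightarrow> 's" and u1 u2 y1 y2
  proof -
    obtain y' where y': "y1 = b # y'" using h(2,3) by (cases y1) auto
    obtain u' where u': "u2 = u' @ [a]" using h(1,4) by (cases u2 rule: rev_cases) auto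
    have "u' \<noteq> [] \<or> y' \<noteq> []" using h(1,5) y' u' by auto
    then have "mB (u' @ a # b # y') = None" using assms by (intro mB_adjacent) auto
    then show ?thesis by (simp add: u' y' val_def)
  qed
  let ?Q = "\<lambda>u1 u2. cut (\<lambda>y1 y2. if u2 = [] \<or> y1 = [] then 0
      else val (\<lambda>c. \<psi> (u1 @ c # y2)) (u2 @ y1)) (b # rest)"
  have "cut ?Q (k0 @ [a]) = ?Q k0 [a]"
    by (rule cut_single) (auto intro!: cut_neutral l)
  also have "\<dots> = (if [a] = [] \<or> [b] = [] then 0 else val (\<lambda>c. \<psi> (k0 @ c # rest)) ([a] @ [b]))"
  proof (rule cut_single)
    fix y1 y2 assume "y1 @ y2 = b # rest" "y1 \<noteq> [b]"
    then show "(if [a] = [] \<or> y1 = [] then 0 else val (\<lambda>c. \<psi> (k0 @ c # y2)) ([a] @ y1)) = 0"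
      using l[of k0 "[a]" y1 y2] by auto
  qed simp
  also have "\<dots> = \<psi> (k0 @ g # rest)"
    using assms by (simp add: val_def)
  finally have "cut ?Q (k0 @ [a]) = \<psi> (k0 @ g # rest)" .
  then show ?thesis
    using ins_append[of \<psi> "k0 @ [a]" "b # rest"] by simp
qed

lemma ins_kword_neutral:
  assumes "kword k" "\<And>u i x. length u + length x + 4 = length k \<Longrightarrow> \<psi> (u @ Idm i # x) = 0"
  shows "ins \<psi> k = 0"
proof (rule ins_neutral)
  fix u v x c assume a: "u @ v @ x = k" "mB v = Some c"
  then have "kword v" using assms(1) kword_append by blast
  from kword_mB[OF this a(2)] have "length v = 4" "c = Idm (src (hd v))" by auto
  with a(1) assms(2)[of u x] show "\<psi> (u @ c # x) = 0" by auto
qed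

text \<open>Holds by the choice of \<open>fb\<close>: cuts other than the one at the bar leave a
  refined piece, insertions that keep a bar vanish, and the rest is the recursion equation.\<close>

lemma defect_barred:
  assumes kw: "kword (k0 @ [a])" and ab: "bmul a b = Some g" and b0: "0 < esz b"
  shows "defect fb (k0 @ a # b # rest) = 0"
proof (cases "comp (k0 @ a # b # rest) \<and> (\<forall>h\<in>set rest. 0 < esz h)")
  case False
  then consider "\<not> comp (k0 @ a # b # rest)" | i where "Idm i \<in> set rest"
    by (metis esz.elims gr0I nat.distinct(1))
  then show ?thesis
  proof cases
    case (2 i)
    then obtain r1 r2 where "rest = r1 @ Idm i # r2" by (metis in_set_conv_decomp)
    then show ?thesis using defect_Idm[of "k0 @ a # b # r1" i r2] by simp
  qed (rule defect_not_comp)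
next
  case True
  interpret barred_word k0 a b g rest
    using assms by unfold_locales
  let ?w = "k0 @ a # b # rest"
  have cw: "comp (k0 @ g # rest)"
    using True g by (auto simp: comp_append comp_Cons)
  have bar: "fb (k1 @ a' # b' # r) = 0" if "k1 @ [a'] = k0 @ [a]" "bmul a' b' \<noteq> None" "0 < esz b'" for k1 a' b' r
    using fb_barred[of k1 a' b' _ r] that kw by auto
  have "conv fb fb ?w = M (fb (k0 @ [a])) (fb (b # rest))"
    unfolding conv_def
  proof (rule cut_single)
    fix p q assume pq: "p @ q = ?w" "p \<noteq> k0 @ [a]"
    then consider q' where "k0 = p @ q'" "q = q' @ a # b # rest"
      | p' where "p = k0 @ a # b # p'"
      by (auto simp: append_eq_append_conv2 append_eq_Cons_conv Cons_eq_append_conv)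
    then show "M (fb p) (fb q) = 0"
    proof cases
      case (1 q')
      then have "kword (q' @ [a])" using kw kword_append[of p "q' @ [a]"] by simp
      with fb_barred[OF this ab b0] 1 show ?thesis by simp
    next
      case (2 p')
      with fb_barred[OF kw ab b0] show ?thesis by simp
    qed
  qed simp
  moreover have "ins (\<lambda>s. fb (s @ b # rest)) (k0 @ [a]) = 0"
    by (rule ins_kword_neutral[OF kw]) (simp add: fb_has_Idm)
  moreover have "ins (\<lambda>s. fb (k0 @ a # b # s)) rest = 0"
    by (rule ins_neutral) (simp add: fb_barred[OF kw ab b0])
  moreover have "pre (\<lambda>s. fb (k0 @ a # s)) (b # rest) =
      cut (\<lambda>v x. if 3 \<le> length v then val (\<lambda>c. fb (k0 @ a # c # x)) v else 0) (b # rest)"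
    unfolding pre_def
  proof (rule cut_cong)
    fix v x assume vx: "v @ x = b # rest"
    show "val (\<lambda>c. fb (k0 @ a # c # x)) v = (if 3 \<le> length v then val (\<lambda>c. fb (k0 @ a # c # x)) v else 0)"
    proof (cases "3 \<le> length v \<or> mB v = None")
      case False
      with mB_length[of v] obtain c h where h: "v = [b, h]" "mB v = Some c"
        using vx mB_two[of v] by (cases "length v = 2") auto
      then have bh: "bmul b h = Some c" by simp
      note c = bmul_Some[OF bh]
      have "bmul a c \<noteq> None" "0 < esz c"
        using c b0 g ea by (auto simp: bmul_None)
      then have "fb (k0 @ a # c # x) = 0"
        by (intro bar) auto
      with h show ?thesis by (simp add: val_def)
    qed (auto simp: val_def)
  qed
  ultimately have "defect fb ?w = (M (kv (k0 @ [a])) (fb (b # rest)) +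
      cut (\<lambda>v x. if 3 \<le> length v then val (\<lambda>c. fb (k0 @ a # c # x)) v else 0) (b # rest)) + fb (k0 @ g # rest)"
    unfolding defect_def ins_barred[OF ab]
    by (simp add: fb_barred[OF kw ab b0] fb_kword[OF kw] add.assoc)
  also have "\<dots> = 0"
    using fb_unbarred[OF kw ab b0 cw] True by simp
  finally show ?thesis .
qed

section \<open>The A-infinity relation of B and the joint induction\<close>

definition relation :: "bgen list \<Rightarrow> bgen \<Rightarrow>\<^sub>0 bit" where
  "relation w = ins (val (\<lambda>c. Poly_Mapping.single c 1)) w"

lemma bmul_assoc:
  assumes "bmul a b = Some g"
  shows "val \<phi> [g, h] = val (\<lambda>c. val \<phi> [a, c]) [b, h]"
  using assms by (cases a; cases b; cases h) (auto simp: val_def add.assoc split: if_splits)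

text \<open>The A-infinity relation on barred words: cutting off the first quadrilateral of a polygon
  along the diagonal that starts at the bar.\<close>

lemma relation_barred:
  assumes kw: "kword (k0 @ [a])" and ab: "bmul a b = Some g" and b0: "0 < esz b"
  shows "relation (k0 @ a # b # rest) = 0"
proof -
  interpret barred_word k0 a b g rest
    using assms by unfold_locales
  let ?s = "\<lambda>c. Poly_Mapping.single c (1 :: bit)"
  have long: "val \<phi> (u @ c # c' # x) = 0" if "bmul c c' \<noteq> None" "u \<noteq> [] \<or> x \<noteq> []"
    for \<phi> :: "bgen \<Rightarrow> bgen \<Rightarrow>\<^sub>0 bit" and u c c' x
    using mB_adjacent[OF that] by (simp add: val_def)
  have t2: "ins (\<lambda>s. val ?s (k0 @ a # b # s)) rest = 0"
    by (rule ins_neutral) (use ab in \<open>auto intro!: long\<close>)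
  have sum: "relation (k0 @ a # b # rest) = ins (\<lambda>s. val ?s (s @ b # rest)) k
      + pre (\<lambda>s. val ?s (k0 @ a # s)) (b # rest) + val ?s w"
    unfolding relation_def ins_barred[OF ab] t2 by simp
  \<comment> \<open>While \<open>w\<close> has fewer than three letters, only twofold products nest,
    and the claim is associativity or an empty sum.\<close>
  consider "k0 = []" "rest = []" | h where "k0 = [h]" "rest = []" | h where "k0 = []" "rest = [h]"
    | "3 \<le> length w"
    by (cases k0; cases rest; cases "tl k0"; cases "tl rest") auto
  then show ?thesis
  proof cases
    case 1
    then show ?thesis
      unfolding sum by (simp add: pre_def cut_Cons val_def)
  next
    case (2 h)
    have "isD h \<noteq> isD a" "esz h = 1" using kw 2 by (auto simp: kword_def alt_Cons)
    then have "bmul h g = None"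
      using g by (auto simp: bmul_None)
    moreover have "bmul h a = None"
      using \<open>isD h \<noteq> isD a\<close> \<open>esz h = 1\<close> ea by (auto simp: bmul_None)
    ultimately show ?thesis
      unfolding sum using 2 by (simp add: pre_def cut_Cons val_def)
  next
    case (3 h)
    have "val ?s w = pre (\<lambda>s. val ?s (k0 @ a # s)) (b # rest)"
      using 3 bmul_assoc[OF ab, of ?s h] by (simp add: pre_def cut_Cons) (simp add: val_def)
    moreover have "ins (\<lambda>s. val ?s (s @ b # rest)) k = 0"
      using 3 by (simp add: pre_def cut_Cons val_def)
    ultimately show ?thesis
      unfolding sum by simp
  next
    case 4
    let ?C = "\<lambda>v x. if 3 \<le> length v then val (\<lambda>c. val ?s (k @ c # x)) v else 0"
    have pre: "pre (\<lambda>s. val ?s (k0 @ a # s)) (b # rest) = cut ?C (b # rest)"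
      unfolding pre_def
    proof (rule cut_cong)
      fix v x assume vx: "v @ x = b # rest"
      show "val (\<lambda>c. val ?s (k0 @ a # c # x)) v = ?C v x"
      proof (cases "3 \<le> length v \<or> mB v = None")
        case False
        with mB_length[of v] obtain c h where h: "v = [b, h]" "mB v = Some c"
          using vx mB_two[of v] by (cases "length v = 2") auto
        then have bh: "bmul b h = Some c" by simp
        note c = bmul_Some[OF bh]
        have "bmul a c \<noteq> None"
          using c b0 g ea by (auto simp: bmul_None)
        moreover have "k0 \<noteq> [] \<or> x \<noteq> []"
          using 4 vx h(1) by auto
        ultimately have "val ?s (k0 @ a # c # x) = 0"
          by (rule long)
        with h show ?thesis by (simp add: val_def)
      qed (auto simp: val_def)
    qed
    show ?thesis
    proof (cases "length k = 4 \<and> rest = []")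
      \<comment> \<open>The root quadrilateral is \<open>k\<close> itself, so there is no diagonal
        to cut along.\<close>
      case True
      then have l: "length k = 4" and r: "rest = []" by auto
      have "cut ?C (b # rest) = 0"
        by (rule cut_neutral) (auto simp: r append_eq_Cons_conv)
      moreover have "ins (\<lambda>s. val ?s (s @ b # rest)) k = ?s b"
      proof -
        have z: "val (\<lambda>c. val ?s ((u @ c # x) @ b # rest)) v = 0" if "u @ v @ x = k" "u \<noteq> [] \<or> x \<noteq> []" for u v x
        proof (cases "mB v")
          case (Some c)
          have "kword v" using kw that(1) kword_append by metis
          from kword_mB[OF this Some] have "length v = 4" by simp
          moreover have "length u + length v + length x = 4"
            using l arg_cong[OF that(1), of length] by simp
          ultimately show ?thesis using that by simp
        qed (simp add: val_def)
        have "ins (\<lambda>s. val ?s (s @ b # rest)) k = cut (\<lambda>v x. val (\<lambda>c. val ?s (([] @ c # x) @ b # rest)) v) k"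
          unfolding ins_eq_cut by (rule cut_single) (auto intro!: cut_neutral z[simplified])
        also have "\<dots> = val (\<lambda>c. val ?s (([] @ c # []) @ b # rest)) k"
          by (rule cut_single[of k "[]"]) (auto intro: z[of "[]", simplified])
        also have "\<dots> = ?s b"
        proof -
          note m = mB_kword4[OF kw l]
          have "tgt (Idm (src (hd k))) = tgt (last k)" using mB_ends[OF m] by blast
          then have "src b = src (hd k)" using g by simp
          with m show ?thesis by (simp add: val_def r)
        qed
        finally show ?thesis .
      qed
      moreover have "val ?s w = ?s b"
        using mB_special[OF l r] by (simp add: val_def)
      ultimately show ?thesis
        unfolding sum pre by simp
    next
      \<comment> \<open>Nonzero nested products over cuts of \<open>b # rest\<close> now correspond
        to the product on \<open>w\<close>, and at most one cut contributes.\<close>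
      case ns: False
      have "ins (\<lambda>s. val ?s (s @ b # rest)) k = 0"
      proof (rule ins_kword_neutral[OF kw])
        fix u x :: "bgen list" and i assume "length u + length x + 4 = length k"
        with ns have "3 \<le> length ((u @ Idm i # x) @ b # rest)"
          by (cases u; cases x; cases rest) auto
        then have "mB ((u @ Idm i # x) @ b # rest) = None"
          by (intro mB_Idm[of i]) auto
        then show "val ?s ((u @ Idm i # x) @ b # rest) = 0" by (simp add: val_def)
      qed
      moreover have "cut ?C (b # rest) = val ?s w"
      proof (cases "mB w")
        case None
        have "?C v x = 0" if "v @ x = b # rest" for v x
          using goodI[OF that] good_mB[OF that] None by (fastforce simp: val_def split: option.split)
        then have "cut ?C (b # rest) = 0"
          by (intro cut_neutral) blast
        with None show ?thesis by (simp add: val_def)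
      next
        case (Some c')
        from mB_good[OF Some 4 ns] obtain v x c where
          v: "v @ x = b # rest" "3 \<le> length v" "mB v = Some c" "mB (k @ c # x) = Some c'"
          by blast
        have "cut ?C (b # rest) = ?C v x"
        proof (rule cut_single[OF v(1)])
          fix v2 x2 assume v2: "v2 @ x2 = b # rest" "v2 \<noteq> v"
          show "?C v2 x2 = 0"
          proof (rule ccontr)
            assume "?C v2 x2 \<noteq> 0"
            then obtain c2 c3 where "3 \<le> length v2" "mB v2 = Some c2" "mB (k @ c2 # x2) = Some c3"
              by (auto simp: val_def split: if_splits option.splits)
            from goodI[OF v2(1) this] this goodI[OF v] v2 v(1,2) show False
              using good_unique[of v x v2 x2 c' c3] by force
          qed
        qed
        with v Some show ?thesis by (simp add: val_def)
      qed
      ultimately show ?thesis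
        unfolding sum pre by simp
    qed
  qed
qed

lemma ins_val: "ins (val \<phi>) w = lin \<phi> (relation w)"
  for \<phi> :: "bgen \<Rightarrow> 'r"
proof -
  have "lin \<phi> (val (\<lambda>c. Poly_Mapping.single c 1) u) = val \<phi> u" for u
    by (simp add: val_def split: option.split)
  then show ?thesis
    unfolding relation_def by (subst ins_hom[of "lin \<phi>"]) (simp_all add: lin_add)
qed

text \<open>Nested insertions are grouped by their outer factor, over which they sum to its
  relation; only the whole word is left as outer factor.\<close>

lemma ins_ins_fb:
  assumes "\<And>u v x. u @ v @ x = w \<Longrightarrow> u \<noteq> [] \<or> x \<noteq> [] \<Longrightarrow> relation v = 0"
  shows "ins (ins fb) w = lin (\<lambda>c. fb [c]) (relation w)"
proof -
  have "ins (ins fb) w = cut (\<lambda>u z. cut (\<lambda>v x. lin (\<lambda>c. fb (u @ c # x)) (relation v)) z) w"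
    by (subst ins_ins) (simp_all add: ins_val)
  also have "\<dots> = cut (\<lambda>v x. lin (\<lambda>c. fb ([] @ c # x)) (relation v)) w"
    by (rule cut_single) (auto intro!: cut_neutral simp: assms)
  also have "\<dots> = lin (\<lambda>c. fb ([] @ c # [])) (relation w)"
  proof (rule cut_single[of w "[]"])
    fix v x assume "v @ x = w" "v \<noteq> w"
    then have "relation v = 0" using assms[of "[]" v x] by auto
    then show "lin (\<lambda>c. fb ([] @ c # x)) (relation v) = 0" by simp
  qed simp
  finally show ?thesis by simp
qed

text \<open>For an unbarred word the equation follows from \<open>bianchi\<close> applied to its barred version, all of
  whose other contributions are known to vanish.\<close>

theorem defect_relation:
  assumes inj: "\<And>p. lin (\<lambda>c. fb [c]) p = 0 \<Longrightarrow> p = 0"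
  shows "defect fb w = 0 \<and> relation w = 0"
proof (induction "wsize w" arbitrary: w rule: less_induct)
  case less
  have smaller: "defect fb v = 0" "relation v = 0" if "wsize v < wsize w" for v
    using less.hyps[OF that] by blast+
  \<comment> \<open>All words of this total exponent are treated at once, because the relation of
    \<open>w\<close> needs the defect after an insertion, which may be another word of the same
    exponent.\<close>
  have D: "defect fb w' = 0" if sz: "wsize w' = wsize w" for w'
  proof (cases rule: word_cases[of w'])
    case 1
    then show ?thesis by (rule defect_not_comp)
  next
    case (2 u i x)
    then show ?thesis by (simp add: defect_Idm)
  next
    case 3
    then show ?thesis by (rule defect_kword)
  next
    case (4 k0 a b g rest)
    interpret barred_word k0 a b g rest
      using 4 by unfold_locales
    let ?w = "k0 @ a # b # rest"
    \<comment> \<open>Without idempotents each nonempty piece has positive exponent, so proper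
      factors of the refined word fall under the induction hypothesis.\<close>
    have pos: "0 < wsize v" if "v \<noteq> []" "set v \<subseteq> set ?w" for v
      using that 4(6) 4(1) b0 ea by (cases v) auto
    have sw: "wsize ?w = wsize w"
      using sz 4(1) g ea by simp
    have dw: "defect fb ?w = 0"
      using defect_barred[OF kw ab b0] .
    have sub: "defect fb p = 0" "defect fb q = 0" if "p @ q = ?w" for p q
    proof -
      have s: "wsize p + wsize q = wsize w" "set p \<subseteq> set ?w" "set q \<subseteq> set ?w"
        using sw arg_cong[OF that, of wsize] arg_cong[OF that, of set] by auto
      have "p = [] \<or> q = [] \<or> (wsize p < wsize w \<and> wsize q < wsize w)"
        using pos[of p] pos[of q] s by auto
      then show "defect fb p = 0" "defect fb q = 0"
        using that dw smaller by auto
    qed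
    have "conv (defect fb) fb ?w = 0" "conv fb (defect fb) ?w = 0"
      unfolding conv_def by (intro cut_neutral; use sub in simp)+
    moreover have "ins (ins fb) ?w = 0"
    proof -
      have "relation v = 0" if "u @ v @ x = ?w" "u \<noteq> [] \<or> x \<noteq> []" for u v x
      proof -
        have "wsize u + wsize v + wsize x = wsize w"
          using sw arg_cong[OF that(1), of wsize] by simp
        moreover have "set u \<subseteq> set ?w" "set x \<subseteq> set ?w"
          using arg_cong[OF that(1), of set] by auto
        then have "0 < wsize u + wsize x"
          using pos[of u] pos[of x] that(2) by (cases "u = []") auto
        ultimately show ?thesis by (intro smaller) linarith
      qed
      from ins_ins_fb[OF this] show ?thesis
        by (simp add: relation_barred[OF kw ab b0])
    qed
    ultimately have "ins (defect fb) ?w = 0"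
      by (simp add: bianchi dw)
    moreover have "ins (\<lambda>s. defect fb (s @ b # rest)) k = 0"
      by (rule ins_kword_neutral[OF kw]) (simp add: defect_Idm)
    moreover have "ins (\<lambda>s. defect fb (k0 @ a # b # s)) rest = 0"
      by (rule ins_neutral) (simp add: defect_barred[OF kw ab b0])
    moreover have "pre (\<lambda>s. defect fb (k0 @ a # s)) (b # rest) = 0"
      unfolding pre_def
    proof (rule cut_neutral)
      fix v x assume vx: "v @ x = b # rest"
      show "val (\<lambda>c. defect fb (k0 @ a # c # x)) v = 0"
      proof (cases "mB v")
        case (Some c)
        have "defect fb (k0 @ a # c # x) = 0"
        proof (cases "length v = 2")
          case True
          with mB_two[of v] vx obtain h where h: "v = [b, h]" by auto
          with Some have bh: "bmul b h = Some c" by simp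
          note c = bmul_Some[OF bh]
          have "bmul a c \<noteq> None" "0 < esz c"
            using c b0 g ea by (auto simp: bmul_None)
          then show ?thesis
            using defect_barred[OF kw] by blast
        next
          case False
          with mB_length[OF Some] have "3 \<le> length v" by simp
          from mB_wsize[OF Some this] have "wsize (k0 @ a # c # x) < wsize w"
            using sw arg_cong[OF vx, of wsize] by simp
          then show ?thesis by (rule smaller)
        qed
        with Some show ?thesis by (simp add: val_def)
      qed (simp add: val_def)
    qed
    ultimately have "defect fb (k0 @ g # rest) = 0"
      unfolding ins_barred[OF ab] by simp
    with 4(1) show ?thesis by simp
  next
    case (5 k0 a b g rest)
    then show ?thesis by (simp add: defect_barred)
  qed
  have D': "defect fb w' = 0" if "wsize w' \<le> wsize w" for w'
    using that D[of w'] smaller(1)[of w'] by linarith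
  \<comment> \<open>Idempotents have exponent zero, so a proper factor may keep the total exponent;
    hence a second induction, on length.\<close>
  have "relation w' = 0" if "wsize w' \<le> wsize w" for w'
    using that
  proof (induction "length w'" arbitrary: w' rule: less_induct)
    case (less w')
    have "ins (defect fb) w' = 0"
    proof (rule ins_neutral)
      fix u v x c assume uv: "u @ v @ x = w'" "mB v = Some c"
      then have "wsize (u @ c # x) \<le> wsize w'"
        using mB_wsize_le[OF uv(2)] arg_cong[OF uv(1), of wsize] by auto
      with less.prems show "defect fb (u @ c # x) = 0"
        by (intro D') simp
    qed
    moreover have "defect fb p = 0 \<and> defect fb q = 0" if "p @ q = w'" for p q
      using arg_cong[OF that, of wsize] less.prems by (auto intro!: D')
    then have "conv (defect fb) fb w' = 0" "conv fb (defect fb) w' = 0" "defect fb w' = 0"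
      unfolding conv_def by (auto intro!: cut_neutral)
    ultimately have "ins (ins fb) w' = 0"
      using bianchi[of fb w'] by simp
    moreover have "ins (ins fb) w' = lin (\<lambda>c. fb [c]) (relation w')"
    proof (rule ins_ins_fb)
      fix u v x assume uv: "u @ v @ x = w'" "u \<noteq> [] \<or> x \<noteq> []"
      then have "length v < length w'" "wsize v \<le> wsize w"
        using less.prems arg_cong[OF uv(1), of wsize] by auto
      then show "relation v = 0" by (rule less.hyps)
    qed
    ultimately show ?case
      using inj by simp
  qed
  with D[of w] show ?case by simp
qed

end

section \<open>The matrix model\<close>

definition E :: "Rpoly \<Rightarrow> 4 \<Rightarrow> 4 \<Rightarrow> Aalg" where
  "E r i j = (\<chi> a b. if a = i \<and> b = j then r else 0)"

lemma E_nth: "E r i j $ a $ b = (if a = i \<and> b = j then r else 0)"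
  by (simp add: E_def)

lemma E_mult: "E r i j ** E s k l = (if j = k then E (r * s) i l else 0)"
proof -
  have "(\<Sum>c\<in>UNIV. (if a = i \<and> c = j then r else 0) * (if c = k \<and> b = l then s else 0)) =
      (\<Sum>c\<in>UNIV. if c = j then (if a = i \<and> b = l \<and> j = k then r * s else 0) else 0)" for a b
    by (rule sum.cong) auto
  then show ?thesis
    by (auto simp: vec_eq_iff matrix_matrix_mult_def E_nth)
qed

lemma E_add: "E r i j + E s i j = E (r + s) i j"
  by (auto simp: vec_eq_iff E_nth)

lemma E_zero [simp]: "E 0 i j = 0"
  by (auto simp: vec_eq_iff E_nth)

lemma d0_eq: "d0 = E px 1 0 + (E (py * pz) 0 1 + (E py 3 2 + E (px * pz) 2 3))"
  by (auto simp: vec_eq_iff E_nth d0_def)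

lemma matrix_add_rdistrib': "((A :: Aalg) + B) ** C = A ** C + B ** C"
  by (simp add: vec_eq_iff matrix_matrix_mult_def distrib_right sum.distrib)

lemma bit_add_self_1: "1 + 1 = (0 :: bit)"
  by simp

lemma Rpoly_char2 [simp]: "(r :: Rpoly) + r = 0"
proof (rule poly_mapping_eqI)
  show "Poly_Mapping.lookup (r + r) k = Poly_Mapping.lookup 0 k" for k
    by (cases "Poly_Mapping.lookup r k") (simp_all only: lookup_add lookup_zero add_0_left bit_add_self_1)
qed

lemma Rpoly_two [simp]: "(2 :: Rpoly) = 0"
  using Rpoly_char2[of 1] unfolding one_add_one .

lemma Aalg_char2 [simp]: "(f :: Aalg) + f = 0"
  by (simp add: vec_eq_iff)

lemma Aalg_two [simp]: "(2 :: Aalg) = 0"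
  using Aalg_char2[of 1] unfolding one_add_one .

lemma mat_commute: "f ** mat t = mat t ** (f :: Aalg)"
  by (simp add: vec_eq_iff matrix_matrix_mult_def mat_def if_distrib if_distribR mult.commute cong: if_cong)

definition dA :: "Aalg \<Rightarrow> Aalg" where
  "dA f = f ** d0 + d0 ** f"

lemma d0_square: "f ** (d0 ** d0) = (d0 ** d0) ** f"
proof -
  let ?t = "px * (py * pz)"
  have "d0 ** d0 = E ?t 0 0 + (E ?t 1 1 + (E ?t 2 2 + E ?t 3 3))"
    unfolding d0_eq by (simp add: matrix_add_ldistrib matrix_add_rdistrib' E_mult ac_simps)
  also have "\<dots> = mat ?t"
    using exhaust_4 by (force simp: vec_eq_iff E_nth mat_def)
  finally have "d0 ** d0 = mat ?t" .
  then show ?thesis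
    using mat_commute by simp
qed

interpretation A: dga2 "(**)" dA
proof
  fix x y z :: Aalg
  show "x + x = 0" by simp
  show "(x + y) ** z = x ** z + y ** z" by (rule matrix_add_rdistrib')
  show "x ** (y + z) = x ** y + x ** z" by (rule matrix_add_ldistrib)
  show "x ** y ** z = x ** (y ** z)" by (simp add: matrix_mul_assoc)
  show "dA (x + y) = dA x + dA y"
    by (simp add: dA_def matrix_add_ldistrib matrix_add_rdistrib' ac_simps)
  show "dA (x ** y) = dA x ** y + x ** dA y"
    by (simp add: dA_def matrix_add_ldistrib matrix_add_rdistrib' matrix_mul_assoc)
  have "x ** d0 ** d0 = d0 ** d0 ** x"
    using d0_square[of x] by (simp add: matrix_mul_assoc)
  then show "dA (dA x) = 0"
    by (simp add: dA_def matrix_add_ldistrib matrix_add_rdistrib' matrix_mul_assoc)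
qed

definition eA :: "vtx \<Rightarrow> Aalg" where
  "eA v = (case v of Wh \<Rightarrow> E 1 0 0 + E 1 1 1 | Bk \<Rightarrow> E 1 2 2 + E 1 3 3)"

text \<open>Concatenation becomes matrix multiplication, so rows belong to the source vertex. Single
  arrows go to cycles, pairs to null-homotopies of their products, and the two triples to elements
  bounding the sums of products over their cuts. On triples of shape \<open>S, D, S\<close> these
  sums already vanish.\<close>

definition kA :: "bgen list \<Rightarrow> Aalg" where
  "kA w =
    (if w = [Dg Wh 0] then E py 0 0 + E py 1 1
     else if w = [Dg Bk 0] then E px 2 2 + E px 3 3
     else if w = [Sg Wh 0] then E 1 1 2 + E pz 0 3
     else if w = [Sg Bk 0] then E 1 3 0 + E pz 2 1
     else if w = [Dg Wh 0, Sg Wh 0] then E 1 1 3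
     else if w = [Sg Wh 0, Dg Bk 0] then E 1 0 2
     else if w = [Dg Bk 0, Sg Bk 0] then E 1 3 1
     else if w = [Sg Bk 0, Dg Wh 0] then E 1 2 0
     else if w = [Dg Wh 0, Sg Wh 0, Dg Bk 0] then E 1 0 3
     else if w = [Dg Bk 0, Sg Bk 0, Dg Wh 0] then E 1 2 1
     else 0)"

lemma kA_cases:
  "kA w = 0 \<or> w \<in> {[Dg Wh 0], [Dg Bk 0], [Sg Wh 0], [Sg Bk 0], [Dg Wh 0, Sg Wh 0], [Sg Wh 0, Dg Bk 0],
     [Dg Bk 0, Sg Bk 0], [Sg Bk 0, Dg Wh 0], [Dg Wh 0, Sg Wh 0, Dg Bk 0], [Dg Bk 0, Sg Bk 0, Dg Wh 0]}"
  unfolding kA_def by (simp split: if_split)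

lemma kA_ends: "eA (src (hd w)) ** kA w = kA w \<and> kA w ** eA (tgt (last w)) = kA w"
  using kA_cases[of w]
  by (elim disjE insertE emptyE)
     (simp_all add: kA_def eA_def matrix_add_ldistrib matrix_add_rdistrib' E_mult)

lemma kA_long: "4 \<le> length w \<Longrightarrow> kA w = 0"
  by (auto simp: kA_def)

lemma kA_values [simp]:
  "kA [Dg Wh 0] = E py 0 0 + E py 1 1" "kA [Dg Bk 0] = E px 2 2 + E px 3 3"
  "kA [Sg Wh 0] = E 1 1 2 + E pz 0 3" "kA [Sg Bk 0] = E 1 3 0 + E pz 2 1"
  "kA [Dg Wh 0, Sg Wh 0] = E 1 1 3" "kA [Sg Wh 0, Dg Bk 0] = E 1 0 2"
  "kA [Dg Bk 0, Sg Bk 0] = E 1 3 1" "kA [Sg Bk 0, Dg Wh 0] = E 1 2 0"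
  "kA [Dg Wh 0, Sg Wh 0, Dg Bk 0] = E 1 0 3" "kA [Dg Bk 0, Sg Bk 0, Dg Wh 0] = E 1 2 1"
  "kA [Sg Wh 0, Dg Bk 0, Sg Bk 0] = 0" "kA [Sg Bk 0, Dg Wh 0, Sg Wh 0] = 0"
  "kA (a # b # c # d # w) = 0"
  by (simp_all add: kA_def)

lemma dA_values [simp]:
  "dA (E r i 0) = E (r * (py * pz)) i 1 + d0 ** E r i 0"
  "dA (E r i 1) = E (r * px) i 0 + d0 ** E r i 1"
  "dA (E r i 2) = E (r * (px * pz)) i 3 + d0 ** E r i 2"
  "dA (E r i 3) = E (r * py) i 2 + d0 ** E r i 3"
  by (simp_all add: dA_def d0_eq matrix_add_ldistrib E_mult)

lemma d0_mult_E [simp]: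
  "d0 ** E r 0 j = E (px * r) 1 j" "d0 ** E r 1 j = E (py * pz * r) 0 j"
  "d0 ** E r 2 j = E (py * r) 3 j" "d0 ** E r 3 j = E (px * pz * r) 2 j"
  by (simp_all add: d0_eq matrix_add_rdistrib' E_mult)

fun next_arrow :: "bgen \<Rightarrow> bgen" where
  "next_arrow (Dg v k) = Sg v 0" | "next_arrow (Sg v k) = Dg (other v) 0" | "next_arrow (Idm v) = Idm v"

lemma kword_arrow: "kword (g # w) \<Longrightarrow> g \<in> {Dg Wh 0, Dg Bk 0, Sg Wh 0, Sg Bk 0}"
  by (cases g; cases "src g") (auto simp: kword_def)

lemma kword_next: "kword (g # h # w) \<Longrightarrow> h = next_arrow g \<and> kword (h # w)"
  by (cases g; cases h) (auto simp: kword_def alt_Cons)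

fun arrow_path :: "bgen \<Rightarrow> nat \<Rightarrow> bgen list" where
  "arrow_path g 0 = [g]"
| "arrow_path g (Suc n) = g # arrow_path (next_arrow g) n"

lemma kword_arrow_path: "kword (g # w) \<Longrightarrow> g # w = arrow_path g (length w)"
proof (induction w arbitrary: g)
  case (Cons h w)
  from kword_next[OF Cons.prems] have h: "h = next_arrow g" and "kword (h # w)" by auto
  note Cons.IH[OF this(2)]
  moreover have "arrow_path g (length (h # w)) = g # arrow_path h (length w)"
    by (simp add: h)
  ultimately show ?case by metis
qed simp

text \<open>A Koszul word is determined by its first arrow and its length. As \<open>kA\<close>
  vanishes from length four on, cuts contribute only up to length six, which leaves 24 words to
  compute.\<close>

lemma kA_defect:
  assumes kw: "kword k" and "k \<noteq> []"
  shows "dA (kA k) + cut (\<lambda>u v. if u = [] \<or> v = [] then 0 else kA u ** kA v) k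
        + (if length k = 4 then eA (src (hd k)) else 0) = 0"
proof (cases "length k \<le> 6")
  case True
  obtain g w where k: "k = g # w" using assms(2) by (cases k) auto
  define n where "n = length w"
  have kp: "k = arrow_path g n" using kword_arrow_path kw k n_def by blast
  have g: "g = Dg Wh 0 \<or> g = Dg Bk 0 \<or> g = Sg Wh 0 \<or> g = Sg Bk 0"
    using kword_arrow[of g w] kw k by simp
  have "n \<le> 5" using True k n_def by simp
  then have nn: "n = 0 \<or> n = Suc 0 \<or> n = Suc (Suc 0) \<or> n = Suc (Suc (Suc 0)) \<or>
      n = Suc (Suc (Suc (Suc 0))) \<or> n = Suc (Suc (Suc (Suc (Suc 0))))"
    by arith
  note s = cut_Cons eA_def A.d_add matrix_add_ldistrib matrix_add_rdistrib' E_mult ac_simps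
  from nn g show ?thesis
    unfolding kp by (elim disjE) (simp_all only: arrow_path.simps next_arrow.simps other.simps, simp_all add: s)
next
  case False
  then have "cut (\<lambda>u v. if u = [] \<or> v = [] then 0 else kA u ** kA v) k = 0"
  proof (intro cut_neutral)
    fix u v assume "u @ v = k"
    with False have "4 \<le> length u \<or> 4 \<le> length v" by auto
    then show "(if u = [] \<or> v = [] then 0 else kA u ** kA v) = 0"
      using kA_long by auto
  qed
  with False show ?thesis
    by (simp add: kA_long)
qed

interpretation A: gauge "(**)" dA eA kA
proof
  note s = kA_def eA_def dA_def d0_eq matrix_add_ldistrib matrix_add_rdistrib' E_mult E_add
  show "mB [] = None" by simp
  show "dA (eA v) = 0" for v
    by (cases v) (simp_all add: s ac_simps)
  show "eA v ** eA v = eA v" for v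
    by (cases v) (simp_all add: s)
  show "v \<noteq> w \<Longrightarrow> eA v ** eA w = 0" for v w
    by (cases v; cases w) (simp_all add: s)
  show "eA (src (hd k)) ** kA k = kA k" "kA k ** eA (tgt (last k)) = kA k" for k
    using kA_ends by blast+
qed (rule kA_defect)

section \<open>Cohomology of the matrix algebra\<close>

lemma Rpoly_sum: "r = (\<Sum>s\<in>Poly_Mapping.keys r. Poly_Mapping.single s 1)" for r :: Rpoly
  by (rule poly_mapping_eqI)
     (auto simp: lookup_sum lookup_single when_def in_keys_iff bit_not_zero_iff sum.delta' finite_keys)

abbreviation mono :: "nat \<times> nat \<times> nat \<Rightarrow> Rpoly" where
  "mono m \<equiv> Poly_Mapping.single m 1"

lemma lookup_mono_mult:
  "Poly_Mapping.lookup (mono (a, b, c) * r) (i, j, k) =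
    (if a \<le> i \<and> b \<le> j \<and> c \<le> k then Poly_Mapping.lookup r (i - a, j - b, k - c) else 0)"
proof -
  have "Poly_Mapping.lookup (mono (a, b, c) * r) (i, j, k) =
      (\<Sum>s\<in>Poly_Mapping.keys r. if (a, b, c) + s = (i, j, k) then 1 else 0)"
    by (subst Rpoly_sum[of r])
       (simp add: sum_distrib_left mult_single lookup_sum lookup_single when_def)
  also have "\<dots> = (\<Sum>s\<in>Poly_Mapping.keys r.
      if s = (i - a, j - b, k - c) then (if a \<le> i \<and> b \<le> j \<and> c \<le> k then 1 else 0) else 0)"
    by (rule sum.cong) auto
  also have "\<dots> = (if a \<le> i \<and> b \<le> j \<and> c \<le> k then Poly_Mapping.lookup r (i - a, j - b, k - c) else 0)"
    by (auto simp: sum.delta' in_keys_iff bit_not_zero_iff)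
  finally show ?thesis .
qed

lemma Rpoly_eqI: "(\<And>i j k. Poly_Mapping.lookup r (i, j, k) = Poly_Mapping.lookup s (i, j, k)) \<Longrightarrow> r = (s :: Rpoly)"
  by (rule poly_mapping_eqI) auto

lemma mono_quotient:
  "\<exists>s. \<forall>i j k. Poly_Mapping.lookup s (i, j, k) = Poly_Mapping.lookup (r :: Rpoly) (a + i, b + j, c + k)"
proof -
  have "inj (\<lambda>(i, j, k). (a + i, b + j, c + k))"
    by (auto simp: inj_on_def)
  then show ?thesis
    by (intro exI[of _ "Poly_Mapping.map_key (\<lambda>(i, j, k). (a + i, b + j, c + k)) r"])
       (simp add: map_key.rep_eq)
qed

lemma mono_split:
  "\<exists>s r0. r = mono (a, b, c) * s + r0 \<and>
    (\<forall>i j k. Poly_Mapping.lookup r0 (i, j, k) = (if a \<le> i \<and> b \<le> j \<and> c \<le> k then 0 else Poly_Mapping.lookup r (i, j, k)))"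
proof -
  obtain s where s: "\<And>i j k. Poly_Mapping.lookup s (i, j, k) = Poly_Mapping.lookup r (a + i, b + j, c + k)"
    using mono_quotient by blast
  have "r = mono (a, b, c) * s + (mono (a, b, c) * s + r)"
    by (simp flip: add.assoc)
  then show ?thesis
    by (intro exI[of _ s] exI[of _ "mono (a, b, c) * s + r"])
       (auto simp: lookup_add lookup_mono_mult s)
qed

lemma mono_cancel: "mono (a, b, c) * r = mono (a, b, c) * s \<Longrightarrow> r = s"
proof (rule Rpoly_eqI)
  fix i j k
  assume "mono (a, b, c) * r = mono (a, b, c) * s"
  then have "Poly_Mapping.lookup (mono (a, b, c) * r) (a + i, b + j, c + k) =
      Poly_Mapping.lookup (mono (a, b, c) * s) (a + i, b + j, c + k)" by simp
  then show "Poly_Mapping.lookup r (i, j, k) = Poly_Mapping.lookup s (i, j, k)"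
    by (simp add: lookup_mono_mult)
qed

text \<open>A term of \<open>r\<close> not divisible by the second monomial would survive
  multiplication by the first, since the two share no variable, but could not occur on the other
  side.\<close>

lemma mono_coprime:
  assumes "mono (a, b, c) * r = mono (a', b', c') * s" "a = 0 \<or> a' = 0" "b = 0 \<or> b' = 0" "c = 0 \<or> c' = 0"
  shows "\<exists>t. r = mono (a', b', c') * t \<and> s = mono (a, b, c) * t"
proof -
  obtain t r0 where t: "r = mono (a', b', c') * t + r0"
    and r0: "\<And>i j k. Poly_Mapping.lookup r0 (i, j, k) =
      (if a' \<le> i \<and> b' \<le> j \<and> c' \<le> k then 0 else Poly_Mapping.lookup r (i, j, k))"
    using mono_split[of r a' b' c'] by blast
  have "Poly_Mapping.lookup r0 (i, j, k) = 0" for i j k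
  proof (cases "a' \<le> i \<and> b' \<le> j \<and> c' \<le> k")
    case False
    have "Poly_Mapping.lookup r (i, j, k) = Poly_Mapping.lookup (mono (a, b, c) * r) (a + i, b + j, c + k)"
      by (simp add: lookup_mono_mult)
    also have "\<dots> = 0"
      unfolding assms(1) using False assms(2-4) by (auto simp: lookup_mono_mult)
    finally show ?thesis by (simp add: r0)
  qed (simp add: r0)
  then have "r0 = 0" by (intro Rpoly_eqI) simp
  with t have r: "r = mono (a', b', c') * t" by simp
  with assms(1) have "mono (a', b', c') * s = mono (a', b', c') * (mono (a, b, c) * t)"
    by (simp add: ac_simps)
  with mono_cancel r show ?thesis by blast
qed

lemma p_mono: "px = mono (1, 0, 0)" "py = mono (0, 1, 0)" "pz = mono (0, 0, 1)"
  "px * pz = mono (1, 0, 1)" "py * pz = mono (0, 1, 1)"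
  by (simp_all add: px_def py_def pz_def mult_single)

section \<open>The linear part of the morphism on basis elements\<close>

lemma fb_step:
  assumes "kword [a]" "bmul a b = Some g" "0 < esz b"
  shows "A.fb [g] = kA [a] ** A.fb [b]"
  using A.fb_unbarred[of "[]" a b g "[]"] assms by (simp add: cut_Cons)

lemma fb_arrow: "kword [a] \<Longrightarrow> A.fb [a] = kA [a]"
  by (rule A.fb_kword) auto

lemma kword_single [simp]: "kword [Dg v 0]" "kword [Sg v 0]"
  by (simp_all add: kword_def alt_Cons)

lemma fb_Dg:
  "A.fb [Dg Wh k] = E (mono (0, Suc k, 0)) 0 0 + E (mono (0, Suc k, 0)) 1 1"
  "A.fb [Dg Bk k] = E (mono (Suc k, 0, 0)) 2 2 + E (mono (Suc k, 0, 0)) 3 3"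
proof (induction k)
  case 0
  { case 1 show ?case by (simp add: fb_arrow p_mono) }
  { case 2 show ?case by (simp add: fb_arrow p_mono) }
next
  case (Suc k)
  { case 1
    show ?case
      using fb_step[of "Dg Wh 0" "Dg Wh k" "Dg Wh (Suc k)"] Suc
      by (simp add: matrix_add_ldistrib matrix_add_rdistrib' E_mult p_mono mult_single) }
  { case 2
    show ?case
      using fb_step[of "Dg Bk 0" "Dg Bk k" "Dg Bk (Suc k)"] Suc
      by (simp add: matrix_add_ldistrib matrix_add_rdistrib' E_mult p_mono mult_single) }
qed

text \<open>Both starting vertices and both parities feed each other: each step prepends one arrow,
  and two arrows make a factor \<open>z\<close>.\<close>

lemma fb_Sg_even:
  "A.fb [Sg Wh (2 * j)] = E (mono (0, 0, j)) 1 2 + E (mono (0, 0, Suc j)) 0 3 \<and>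
   A.fb [Sg Bk (2 * j)] = E (mono (0, 0, j)) 3 0 + E (mono (0, 0, Suc j)) 2 1 \<and>
   A.fb [Sg Wh (Suc (2 * j))] = E (mono (0, 0, Suc j)) 0 0 + E (mono (0, 0, Suc j)) 1 1 \<and>
   A.fb [Sg Bk (Suc (2 * j))] = E (mono (0, 0, Suc j)) 2 2 + E (mono (0, 0, Suc j)) 3 3"
proof (induction j)
  case 0
  have z: "mono (0, 0, 0) = 1" by (simp add: zero_prod_def flip: single_one)
  have e: "A.fb [Sg Wh 0] = E 1 1 2 + E pz 0 3" "A.fb [Sg Bk 0] = E 1 3 0 + E pz 2 1"
    by (simp_all add: fb_arrow)
  show ?case
    using fb_step[of "Sg Wh 0" "Sg Bk 0" "Sg Wh (Suc 0)"] fb_step[of "Sg Bk 0" "Sg Wh 0" "Sg Bk (Suc 0)"]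
    by (simp add: e z matrix_add_ldistrib matrix_add_rdistrib' E_mult add_ac) (simp add: p_mono)
next
  case (Suc j)
  have e: "A.fb [Sg Wh (Suc (Suc (2 * j)))] = E (mono (0, 0, Suc j)) 1 2 + E (mono (0, 0, Suc (Suc j))) 0 3"
    "A.fb [Sg Bk (Suc (Suc (2 * j)))] = E (mono (0, 0, Suc j)) 3 0 + E (mono (0, 0, Suc (Suc j))) 2 1"
    using fb_step[of "Sg Wh 0" "Sg Bk (Suc (2 * j))" "Sg Wh (Suc (Suc (2 * j)))"]
      fb_step[of "Sg Bk 0" "Sg Wh (Suc (2 * j))" "Sg Bk (Suc (Suc (2 * j)))"] Suc
    by (simp_all add: matrix_add_ldistrib matrix_add_rdistrib' E_mult p_mono mult_single add_ac)
  have "A.fb [Sg Wh (Suc (Suc (Suc (2 * j))))] = E (mono (0, 0, Suc (Suc j))) 0 0 + E (mono (0, 0, Suc (Suc j))) 1 1"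
    "A.fb [Sg Bk (Suc (Suc (Suc (2 * j))))] = E (mono (0, 0, Suc (Suc j))) 2 2 + E (mono (0, 0, Suc (Suc j))) 3 3"
    using fb_step[of "Sg Wh 0" "Sg Bk (Suc (Suc (2 * j)))" "Sg Wh (Suc (Suc (Suc (2 * j))))"]
      fb_step[of "Sg Bk 0" "Sg Wh (Suc (Suc (2 * j)))" "Sg Bk (Suc (Suc (Suc (2 * j))))"]
    by (simp_all add: e matrix_add_ldistrib matrix_add_rdistrib' E_mult p_mono mult_single add_ac)
  with e show ?case by simp
qed

lemma fb_Sg:
  "A.fb [Sg Wh (2 * j)] = E (mono (0, 0, j)) 1 2 + E (mono (0, 0, Suc j)) 0 3"
  "A.fb [Sg Bk (2 * j)] = E (mono (0, 0, j)) 3 0 + E (mono (0, 0, Suc j)) 2 1"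
  "A.fb [Sg Wh (Suc (2 * j))] = E (mono (0, 0, Suc j)) 0 0 + E (mono (0, 0, Suc j)) 1 1"
  "A.fb [Sg Bk (Suc (2 * j))] = E (mono (0, 0, Suc j)) 2 2 + E (mono (0, 0, Suc j)) 3 3"
  using fb_Sg_even by blast+

lemma eA_mono: "eA Wh = E (mono (0, 0, 0)) 0 0 + E (mono (0, 0, 0)) 1 1"
  "eA Bk = E (mono (0, 0, 0)) 2 2 + E (mono (0, 0, 0)) 3 3"
  by (simp_all add: eA_def zero_prod_def flip: single_one)

text \<open>Coordinates dual to the images of the basis of B, read at monomials that no boundary
  reaches: the entries of boundaries used here lie in the ideals \<open>(x, yz)\<close>,
  \<open>(y, xz)\<close> and \<open>(x, y)\<close>. This yields injectivity on cohomology.\<close>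

fun coef :: "bgen \<Rightarrow> Aalg \<Rightarrow> bit" where
  "coef (Idm Wh) f = Poly_Mapping.lookup (f $ 0 $ 0) (0, 0, 0)"
| "coef (Idm Bk) f = Poly_Mapping.lookup (f $ 2 $ 2) (0, 0, 0)"
| "coef (Dg Wh k) f = Poly_Mapping.lookup (f $ 0 $ 0) (0, Suc k, 0)"
| "coef (Dg Bk k) f = Poly_Mapping.lookup (f $ 2 $ 2) (Suc k, 0, 0)"
| "coef (Sg Wh k) f = (if even k then Poly_Mapping.lookup (f $ 1 $ 2) (0, 0, k div 2)
     else Poly_Mapping.lookup (f $ 0 $ 0) (0, 0, Suc (k div 2)))"
| "coef (Sg Bk k) f = (if even k then Poly_Mapping.lookup (f $ 3 $ 0) (0, 0, k div 2)
     else Poly_Mapping.lookup (f $ 2 $ 2) (0, 0, Suc (k div 2)))"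

lemma bgen_parity_cases:
  obtains v where "c = Idm v" | v k where "c = Dg v k" | v j where "c = Sg v (2 * j)" | v j where "c = Sg v (Suc (2 * j))"
proof (cases c)
  case (Sg v k)
  then show ?thesis
    using that(3,4) by (cases "even k") (auto elim!: evenE oddE)
qed (use that in auto)

lemma coef_fb: "coef c (A.fb [c']) = (if c = c' then 1 else 0)"
proof -
  have par: "2 * i \<noteq> Suc (2 * j)" "Suc (2 * i) \<noteq> 2 * j" for i j :: nat
    by presburger+
  show ?thesis
    by (cases c rule: bgen_parity_cases; cases c' rule: bgen_parity_cases; cases "src c"; cases "src c'")
       (simp_all add: eA_mono fb_Dg fb_Sg E_nth lookup_single when_def par)
qed

text \<open>\<open>sum_4\<close> and \<open>exhaust_4\<close> list the indices as 1, 2, 3, 4,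
  whereas the matrices are written with indices 0 to 3.\<close>

lemma four_eq_zero: "(4 :: 4) = 0"
  by simp

lemma dA_nth:
  "dA f $ i $ 0 = px * f $ i $ 1 + (d0 ** f) $ i $ 0" "dA f $ i $ 1 = (py * pz) * f $ i $ 0 + (d0 ** f) $ i $ 1"
  "dA f $ i $ 2 = py * f $ i $ 3 + (d0 ** f) $ i $ 2" "dA f $ i $ 3 = (px * pz) * f $ i $ 2 + (d0 ** f) $ i $ 3"
  "(d0 ** f) $ 0 $ j = (py * pz) * f $ 1 $ j" "(d0 ** f) $ 1 $ j = px * f $ 0 $ j"
  "(d0 ** f) $ 2 $ j = (px * pz) * f $ 3 $ j" "(d0 ** f) $ 3 $ j = py * f $ 2 $ j"
  by (simp_all add: dA_def matrix_matrix_mult_def sum_4 d0_def four_eq_zero ac_simps)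

lemma coef_dA: "coef c (dA f) = 0"
  by (cases "(c, f)" rule: coef.cases)
     (simp_all add: dA_nth p_mono(4,5) lookup_add lookup_mono_mult, simp_all add: p_mono lookup_mono_mult)

lemma coef_add: "coef c (f + g) = coef c f + coef c g"
  by (cases "(c, f)" rule: coef.cases) (simp_all add: lookup_add)

lemma coef_zero [simp]: "coef c 0 = 0"
  by (cases "(c, 0 :: Aalg)" rule: coef.cases) simp_all

lemma coef_lin: "coef c (lin (\<lambda>c. A.fb [c]) p) = Poly_Mapping.lookup p c"
proof -
  have "coef c (sum g S) = (\<Sum>x\<in>S. coef c (g x))" if "finite S" for g :: "bgen \<Rightarrow> Aalg" and S
    using that by induction (simp_all add: coef_add)
  then show ?thesis
    by (simp add: lin_def coef_fb in_keys_iff bit_not_zero_iff)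
qed

lemma lin_fb_boundary: "lin (\<lambda>c. A.fb [c]) p = dA u \<Longrightarrow> p = 0"
  by (rule poly_mapping_eqI) (metis coef_lin coef_dA lookup_zero)

lemma lin_fb_add: "lin (\<lambda>c. A.fb [c]) (p + q) = lin (\<lambda>c. A.fb [c]) p + lin (\<lambda>c. A.fb [c]) q"
  by (rule lin_add) simp

lemma lin_fb_realize:
  fixes G :: "Rpoly \<Rightarrow> Aalg"
  assumes G: "\<And>r s. G (r + s) = G r + G s" "G 0 = 0"
    and q: "\<And>s. s \<in> Poly_Mapping.keys q \<Longrightarrow> \<exists>c. A.fb [c] = G (mono s)"
  shows "\<exists>v. lin (\<lambda>c. A.fb [c]) v = G q"
proof -
  from q obtain c where c: "\<And>s. s \<in> Poly_Mapping.keys q \<Longrightarrow> A.fb [c s] = G (mono s)"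
    by metis
  have "lin (\<lambda>c. A.fb [c]) (\<Sum>s\<in>S. Poly_Mapping.single (c s) 1) = G (\<Sum>s\<in>S. mono s)"
    if "finite S" "S \<subseteq> Poly_Mapping.keys q" for S
    using that by induction (auto simp: lin_fb_add G c)
  from this[OF finite_keys order_refl] show ?thesis
    unfolding Rpoly_sum[of q, symmetric] by blast
qed

lemma char2_move: "a + b = 0 \<longleftrightarrow> a = b" for a b :: Rpoly
proof
  assume "a + b = 0"
  then have "a + b + b = b" by simp
  then show "a = b" by (simp add: add.assoc)
qed simp

text \<open>Normal form modulo an ideal generated by two monomials; the surviving monomials index
  the cohomology classes.\<close>

lemma split_two:
  obtains r s q where "p = mono (a, b, c) * r + (mono (a', b', c') * s + q)"
    and "\<And>i j k. (i, j, k) \<in> Poly_Mapping.keys q \<Longrightarrow>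
      \<not> (a \<le> i \<and> b \<le> j \<and> c \<le> k) \<and> \<not> (a' \<le> i \<and> b' \<le> j \<and> c' \<le> k)"
proof -
  obtain r p1 where 1: "p = mono (a, b, c) * r + p1"
    "\<And>i j k. Poly_Mapping.lookup p1 (i, j, k) = (if a \<le> i \<and> b \<le> j \<and> c \<le> k then 0 else Poly_Mapping.lookup p (i, j, k))"
    using mono_split[of p a b c] by blast
  obtain s q where 2: "p1 = mono (a', b', c') * s + q"
    "\<And>i j k. Poly_Mapping.lookup q (i, j, k) = (if a' \<le> i \<and> b' \<le> j \<and> c' \<le> k then 0 else Poly_Mapping.lookup p1 (i, j, k))"
    using mono_split[of p1 a' b' c'] by blast
  show ?thesis
  proof (rule that[of r s q])
    show "p = mono (a, b, c) * r + (mono (a', b', c') * s + q)"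
      by (simp only: 1(1) 2(1))
    fix i j k assume "(i, j, k) \<in> Poly_Mapping.keys q"
    then have "Poly_Mapping.lookup q (i, j, k) \<noteq> 0"
      by (simp add: in_keys_iff)
    then show "\<not> (a \<le> i \<and> b \<le> j \<and> c \<le> k) \<and> \<not> (a' \<le> i \<and> b' \<le> j \<and> c' \<le> k)"
      using 1(2)[of i j k] 2(2)[of i j k] by (auto split: if_splits)
  qed
qed

text \<open>The cycle equations pair off the sixteen entries. Eight of them acquire common cofactors
  \<open>t1\<close> to \<open>t4\<close> by coprimality, four are determined by other entries, and
  the remaining four are reduced modulo the ideals of boundaries to remainders that lie in the image
  of the linear part.\<close>

lemma cycle_representative:
  assumes "dA w = 0"
  shows "\<exists>v u. lin (\<lambda>c. A.fb [c]) v + w = dA u"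
proof -
  let ?L = "lin (\<lambda>c. A.fb [c])"
  have z: "dA w $ i $ j = 0" for i j using assms by simp
  note nth = dA_nth char2_move
  have a00: "px * w $ 0 $ 1 = (py * pz) * w $ 1 $ 0" using z[of 0 0] by (simp only: nth)
  have a01: "(py * pz) * w $ 0 $ 0 = (py * pz) * w $ 1 $ 1" using z[of 0 1] by (simp only: nth)
  have a22: "py * w $ 2 $ 3 = (px * pz) * w $ 3 $ 2" using z[of 2 2] by (simp only: nth)
  have a23: "(px * pz) * w $ 2 $ 2 = (px * pz) * w $ 3 $ 3" using z[of 2 3] by (simp only: nth)
  have a02: "py * w $ 0 $ 3 = (py * pz) * w $ 1 $ 2" using z[of 0 2] by (simp only: nth)
  have a03: "(px * pz) * w $ 0 $ 2 = (py * pz) * w $ 1 $ 3" using z[of 0 3] by (simp only: nth)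
  have a20: "px * w $ 2 $ 1 = (px * pz) * w $ 3 $ 0" using z[of 2 0] by (simp only: nth)
  have a21: "(py * pz) * w $ 2 $ 0 = (px * pz) * w $ 3 $ 1" using z[of 2 1] by (simp only: nth)
  obtain t1 where t1: "w $ 0 $ 1 = (py * pz) * t1" "w $ 1 $ 0 = px * t1"
    using mono_coprime[of 1 0 0 _ 0 1 1, folded p_mono(4,5), folded p_mono(1-3), OF a00] by auto
  obtain t2 where t2: "w $ 2 $ 3 = (px * pz) * t2" "w $ 3 $ 2 = py * t2"
    using mono_coprime[of 0 1 0 _ 1 0 1, folded p_mono(4,5), folded p_mono(1-3), OF a22] by auto
  have d1: "w $ 1 $ 1 = w $ 0 $ 0" using mono_cancel[of 0 1 1, folded p_mono(5), OF a01] by simp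
  have d2: "w $ 3 $ 3 = w $ 2 $ 2" using mono_cancel[of 1 0 1, folded p_mono(4), OF a23] by simp
  have d3: "w $ 0 $ 3 = pz * w $ 1 $ 2"
    using mono_cancel[of 0 1 0, folded p_mono(2), OF a02[unfolded mult.assoc]] .
  have d4: "w $ 2 $ 1 = pz * w $ 3 $ 0"
    using mono_cancel[of 1 0 0, folded p_mono(1), OF a20[unfolded mult.assoc]] .
  have "pz * (px * w $ 0 $ 2) = pz * (py * w $ 1 $ 3)" using a03 by (simp add: ac_simps)
  from mono_cancel[of 0 0 1, folded p_mono(3), OF this]
  obtain t3 where t3: "w $ 0 $ 2 = py * t3" "w $ 1 $ 3 = px * t3"
    using mono_coprime[of 1 0 0 _ 0 1 0, folded p_mono(1-3)] by auto
  have "pz * (py * w $ 2 $ 0) = pz * (px * w $ 3 $ 1)" using a21 by (simp add: ac_simps)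
  from mono_cancel[of 0 0 1, folded p_mono(3), OF this]
  obtain t4 where t4: "w $ 2 $ 0 = px * t4" "w $ 3 $ 1 = py * t4"
    using mono_coprime[of 0 1 0 _ 1 0 0, folded p_mono(1-3)] by auto
  obtain r1 s1 q1 where q1: "w $ 0 $ 0 = px * r1 + ((py * pz) * s1 + q1)"
    "\<And>i j k. (i, j, k) \<in> Poly_Mapping.keys q1 \<Longrightarrow>
      \<not> (1 \<le> i \<and> 0 \<le> j \<and> 0 \<le> k) \<and> \<not> (0 \<le> i \<and> 1 \<le> j \<and> 1 \<le> k)"
    by (rule split_two[of "w $ 0 $ 0" 1 0 0 0 1 1, folded p_mono(4,5), folded p_mono(1-3)]) (rule that)
  obtain r2 s2 q2 where q2: "w $ 2 $ 2 = py * r2 + ((px * pz) * s2 + q2)"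
    "\<And>i j k. (i, j, k) \<in> Poly_Mapping.keys q2 \<Longrightarrow>
      \<not> (0 \<le> i \<and> 1 \<le> j \<and> 0 \<le> k) \<and> \<not> (1 \<le> i \<and> 0 \<le> j \<and> 1 \<le> k)"
    by (rule split_two[of "w $ 2 $ 2" 0 1 0 1 0 1, folded p_mono(4,5), folded p_mono(1-3)]) (rule that)
  obtain r3 s3 q3 where q3: "w $ 1 $ 2 = px * r3 + (py * s3 + q3)"
    "\<And>i j k. (i, j, k) \<in> Poly_Mapping.keys q3 \<Longrightarrow>
      \<not> (1 \<le> i \<and> 0 \<le> j \<and> 0 \<le> k) \<and> \<not> (0 \<le> i \<and> 1 \<le> j \<and> 0 \<le> k)"
    by (rule split_two[of "w $ 1 $ 2" 1 0 0 0 1 0, folded p_mono(4,5), folded p_mono(1-3)]) (rule that)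
  obtain r4 s4 q4 where q4: "w $ 3 $ 0 = py * r4 + (px * s4 + q4)"
    "\<And>i j k. (i, j, k) \<in> Poly_Mapping.keys q4 \<Longrightarrow>
      \<not> (0 \<le> i \<and> 1 \<le> j \<and> 0 \<le> k) \<and> \<not> (1 \<le> i \<and> 0 \<le> j \<and> 0 \<le> k)"
    by (rule split_two[of "w $ 3 $ 0" 0 1 0 1 0 0, folded p_mono(4,5), folded p_mono(1-3)]) (rule that)
  have G: "E (r + s) i j = E r i j + E s i j" for r s i j by (simp add: E_add)
  obtain v1 where v1: "?L v1 = E q1 0 0 + E q1 1 1"
  proof -
    have real: "\<exists>c. A.fb [c] = E (mono m) 0 0 + E (mono m) 1 1" if "m \<in> Poly_Mapping.keys q1" for m
    proof -
      obtain i j k where m: "m = (i, j, k)" by (cases m)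
      have "i = 0" "j = 0 \<or> k = 0" using q1(2)[of i j k] that unfolding m by auto
      then consider "m = (0, 0, 0)" | n where "m = (0, Suc n, 0)" | n where "m = (0, 0, Suc n)"
        unfolding m by (cases j; cases k) auto
      then show ?thesis
      proof cases
        case 1
        then show ?thesis by (intro exI[of _ "Idm Wh"]) (simp add: eA_mono)
      next
        case (2 n)
        then show ?thesis by (intro exI[of _ "Dg Wh n"]) (simp add: fb_Dg)
      next
        case (3 n)
        then show ?thesis by (intro exI[of _ "Sg Wh (Suc (2 * n))"]) (simp add: fb_Sg)
      qed
    qed
    have "\<exists>v. ?L v = E q1 0 0 + E q1 1 1"
      by (rule lin_fb_realize[of "\<lambda>r. E r 0 0 + E r 1 1" q1]) (simp_all only: real, simp_all add: G add_ac)
    then show ?thesis using that by blast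
  qed
  obtain v2 where v2: "?L v2 = E q2 2 2 + E q2 3 3"
  proof -
    have real: "\<exists>c. A.fb [c] = E (mono m) 2 2 + E (mono m) 3 3" if "m \<in> Poly_Mapping.keys q2" for m
    proof -
      obtain i j k where m: "m = (i, j, k)" by (cases m)
      have "j = 0" "i = 0 \<or> k = 0" using q2(2)[of i j k] that unfolding m by auto
      then consider "m = (0, 0, 0)" | n where "m = (Suc n, 0, 0)" | n where "m = (0, 0, Suc n)"
        unfolding m by (cases i; cases k) auto
      then show ?thesis
      proof cases
        case 1
        then show ?thesis by (intro exI[of _ "Idm Bk"]) (simp add: eA_mono)
      next
        case (2 n)
        then show ?thesis by (intro exI[of _ "Dg Bk n"]) (simp add: fb_Dg)
      next
        case (3 n)
        then show ?thesis by (intro exI[of _ "Sg Bk (Suc (2 * n))"]) (simp add: fb_Sg)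
      qed
    qed
    have "\<exists>v. ?L v = E q2 2 2 + E q2 3 3"
      by (rule lin_fb_realize[of "\<lambda>r. E r 2 2 + E r 3 3" q2]) (simp_all only: real, simp_all add: G add_ac)
    then show ?thesis using that by blast
  qed
  obtain v3 where v3: "?L v3 = E q3 1 2 + E (pz * q3) 0 3"
  proof -
    have real: "\<exists>c. A.fb [c] = E (mono m) 1 2 + E (pz * mono m) 0 3" if "m \<in> Poly_Mapping.keys q3" for m
    proof -
      obtain i j k where m: "m = (i, j, k)" by (cases m)
      have "i = 0" "j = 0" using q3(2)[of i j k] that unfolding m by auto
      show ?thesis
        using fb_Sg(1)[of k] by (intro exI[of _ "Sg Wh (2 * k)"]) (simp add: m \<open>i = 0\<close> \<open>j = 0\<close> p_mono mult_single)
    qed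
    have "\<exists>v. ?L v = E q3 1 2 + E (pz * q3) 0 3"
      by (rule lin_fb_realize[of "\<lambda>r. E r 1 2 + E (pz * r) 0 3" q3]) (simp_all only: real, simp_all add: G distrib_left add_ac)
    then show ?thesis using that by blast
  qed
  obtain v4 where v4: "?L v4 = E q4 3 0 + E (pz * q4) 2 1"
  proof -
    have real: "\<exists>c. A.fb [c] = E (mono m) 3 0 + E (pz * mono m) 2 1" if "m \<in> Poly_Mapping.keys q4" for m
    proof -
      obtain i j k where m: "m = (i, j, k)" by (cases m)
      have "i = 0" "j = 0" using q4(2)[of i j k] that unfolding m by auto
      show ?thesis
        using fb_Sg(2)[of k] by (intro exI[of _ "Sg Bk (2 * k)"]) (simp add: m \<open>i = 0\<close> \<open>j = 0\<close> p_mono mult_single)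
    qed
    have "\<exists>v. ?L v = E q4 3 0 + E (pz * q4) 2 1"
      by (rule lin_fb_realize[of "\<lambda>r. E r 3 0 + E (pz * r) 2 1" q4]) (simp_all only: real, simp_all add: G distrib_left add_ac)
    then show ?thesis using that by blast
  qed
  \<comment> \<open>The \<open>t\<close> terms bound the eight entries with common cofactors. The
    quotients \<open>r\<close> and \<open>s\<close> bound what the reductions removed, so only the
    remainders \<open>q\<close> are left for \<open>v1\<close> to \<open>v4\<close>.\<close>
  let ?u = "E t1 0 0 + E r1 0 1 + E s1 1 0 + (E t2 2 2 + E r2 2 3 + E s2 3 2)
    + (E t3 0 3 + E r3 0 2 + E s3 1 3) + (E t4 2 1 + E r4 2 0 + E s4 3 1)"
  have "?L (v1 + v2 + v3 + v4) + w = dA ?u"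
  proof -
    have "(?L (v1 + v2 + v3 + v4) + w) $ i $ j = dA ?u $ i $ j" for i j
      using exhaust_4[of i] exhaust_4[of j]
      by (elim disjE)
        (simp_all add: lin_fb_add v1 v2 v3 v4 E_nth dA_nth t1 t2 t3 t4 q1(1) q2(1) q3(1) q4(1) d1 d2 d3 d4
          four_eq_zero distrib_left ac_simps)
    then show ?thesis by (simp add: vec_eq_iff)
  qed
  then show ?thesis by blast
qed

section \<open>Multilinear extension\<close>

lemma cut_mid: "cut Q (xs @ c # ys) = cut (\<lambda>u1 u2. Q u1 (u2 @ c # ys)) xs + cut (\<lambda>y1 y2. Q (xs @ c # y1) y2) ys"
  by (simp add: cut_append cut_Cons)

lemma multilinearD: "multilinear F \<Longrightarrow> F (xs @ (a + b) # ys) = F (xs @ a # ys) + F (xs @ b # ys)"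
  unfolding multilinear_def by blast

lemma multilinear_cut:
  assumes "\<And>v. multilinear (\<lambda>u. Q u v)" "\<And>u. multilinear (Q u)"
  shows "multilinear (cut Q)"
proof -
  have "Q u1 (u2 @ (a + b) # ys) = Q u1 (u2 @ a # ys) + Q u1 (u2 @ b # ys)" for u1 u2 a b ys
    using multilinearD[OF assms(2)] by blast
  moreover have "Q (xs @ (a + b) # y1) y2 = Q (xs @ a # y1) y2 + Q (xs @ b # y1) y2" for xs a b y1 y2
    using multilinearD[OF assms(1)] by blast
  ultimately show ?thesis
    unfolding multilinear_def by (simp add: cut_mid cut_add ac_simps)
qed

lemma multilinear_zero: "multilinear F \<Longrightarrow> F (xs @ 0 # ys) = 0"
  using multilinearD[of F xs 0 0 ys] by simp

text \<open>Allows the algebra and morphism equations to be tested on lists of basis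
  elements.\<close>

lemma multilinear_nested:
  assumes F: "multilinear F" and G: "multilinear G"
  shows "multilinear (cut (\<lambda>u. cut (\<lambda>v x. if v = [] then 0 else F (u @ G v # x))))"
proof (rule multilinear_cut)
  fix u
  have "multilinear (\<lambda>v. if v = [] then 0 else F (u @ G v # x))" for x
    unfolding multilinear_def by (simp add: multilinearD[OF G] multilinearD[OF F])
  moreover have "multilinear (\<lambda>x. if v = [] then 0 else F (u @ G v # x))" for v
    using multilinearD[OF F, of "u @ G v # _"] unfolding multilinear_def by simp
  ultimately show "multilinear (cut (\<lambda>v x. if v = [] then 0 else F (u @ G v # x)))"
    by (rule multilinear_cut)
next
  fix z
  have "F ((xs @ (a + b) # ys) @ c # x) = F ((xs @ a # ys) @ c # x) + F ((xs @ b # ys) @ c # x)" for xs a b ys c x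
    using multilinearD[OF F, of xs a b "ys @ c # x"] by simp
  then have "(if v = [] then 0 else F ((xs @ (a + b) # ys) @ G v # x)) =
     (if v = [] then 0 else F ((xs @ a # ys) @ G v # x)) + (if v = [] then 0 else F ((xs @ b # ys) @ G v # x))"
    for xs a b ys v x
    by simp
  then show "multilinear (\<lambda>u. cut (\<lambda>v x. if v = [] then 0 else F (u @ G v # x)) z)"
    unfolding multilinear_def by (simp only: cut_add) simp
qed

lemma cut_map: "cut Q (map h cs) = cut (\<lambda>u v. Q (map h u) (map h v)) cs"
  by (induction cs arbitrary: Q) (simp_all add: cut_Cons)

lemma cut_index: "cut Q w = (\<Sum>i\<le>length w. Q (take i w) (drop i w))"
proof (induction w arbitrary: Q)
  case (Cons a w)
  then show ?case
    by (simp add: cut_Cons sum.atMost_Suc_shift del: sum.atMost_Suc)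
qed simp

text \<open>Turns the index sums of the A-infinity equations into nested cuts. The test for
  \<open>v = []\<close> reflects that \<open>j\<close> starts at 1, and the extra cut position at
  the end of the list contributes an empty sum.\<close>

lemma index_sum_eq_cut:
  "(\<Sum>i<length as. \<Sum>j\<in>{1..length as - i}. F (take i as @ G (take j (drop i as)) # drop (i + j) as))
    = cut (\<lambda>u. cut (\<lambda>v x. if v = [] then 0 else F (u @ G v # x))) as"
proof -
  have inner: "cut (\<lambda>v x. if v = [] then 0 else F (u @ G v # x)) z =
      (\<Sum>j\<in>{1..length z}. F (u @ G (take j z) # drop j z))" for u z
  proof -
    have "cut (\<lambda>v x. if v = [] then 0 else F (u @ G v # x)) z =
        (\<Sum>j\<le>length z. if take j z = [] then 0 else F (u @ G (take j z) # drop j z))"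
      by (simp only: cut_index)
    also have "\<dots> = (\<Sum>j\<in>{1..length z}. F (u @ G (take j z) # drop j z))"
      by (rule sum.mono_neutral_cong_right) auto
    finally show ?thesis .
  qed
  have "cut (\<lambda>u. cut (\<lambda>v x. if v = [] then 0 else F (u @ G v # x))) as =
      (\<Sum>i\<le>length as. \<Sum>j\<in>{1..length as - i}. F (take i as @ G (take j (drop i as)) # drop (i + j) as))"
    by (simp add: cut_index[of _ as] inner add.commute)
  also have "\<dots> = (\<Sum>i<length as. \<Sum>j\<in>{1..length as - i}. F (take i as @ G (take j (drop i as)) # drop (i + j) as))"
    by (rule sum.mono_neutral_right) auto
  finally show ?thesis by simp
qed

abbreviation basis :: "'a \<Rightarrow> 'a \<Rightarrow>\<^sub>0 bit" where
  "basis c \<equiv> Poly_Mapping.single c 1"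

definition mext :: "('a list \<Rightarrow> 'r::ab_group_add) \<Rightarrow> ('a \<Rightarrow>\<^sub>0 bit) list \<Rightarrow> 'r" where
  "mext \<phi> vs = (\<Sum>cs\<in>listset (map Poly_Mapping.keys vs). \<phi> cs)"

lemma mext_Nil [simp]: "mext \<phi> [] = \<phi> []"
  by (simp add: mext_def)

lemma mext_Cons: "mext \<phi> (v # vs) = lin (\<lambda>c. mext (\<lambda>cs. \<phi> (c # cs)) vs) v"
proof -
  let ?L = "listset (map Poly_Mapping.keys vs)"
  have "listset (map Poly_Mapping.keys (v # vs)) = (\<lambda>p. fst p # snd p) ` (Poly_Mapping.keys v \<times> ?L)"
    by (force simp: set_Cons_def)
  moreover have "inj_on (\<lambda>p. fst p # snd p) (Poly_Mapping.keys v \<times> ?L)"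
    by (auto simp: inj_on_def)
  ultimately have "mext \<phi> (v # vs) = (\<Sum>(x, xs)\<in>Poly_Mapping.keys v \<times> ?L. \<phi> (x # xs))"
    unfolding mext_def by (simp add: sum.reindex o_def split_beta)
  then show ?thesis
    by (simp add: lin_def mext_def sum.cartesian_product)
qed

lemma mext_single [simp]: "mext \<phi> (map basis cs) = \<phi> cs"
  by (induction cs arbitrary: \<phi>) (simp_all add: mext_Cons)

lemma lin_add_fun: "lin (\<lambda>c. \<phi> c + \<psi> c) p = lin \<phi> p + lin \<psi> p"
  by (simp add: lin_def sum.distrib)

lemma mext_multilinear:
  fixes \<phi> :: "'a list \<Rightarrow> 'r::ab_group_add"
  assumes "\<And>x::'r. x + x = 0"
  shows "multilinear (mext \<phi>)"
proof -
  have "mext \<phi> (xs @ (a + b) # ys) = mext \<phi> (xs @ a # ys) + mext \<phi> (xs @ b # ys)" for xs a b ys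
    by (induction xs arbitrary: \<phi>) (simp_all add: mext_Cons lin_add[OF assms] lin_add_fun)
  then show ?thesis by (simp add: multilinear_def)
qed

lemma sum_basis: "v = (\<Sum>c\<in>Poly_Mapping.keys v. basis c)" for v :: "'a \<Rightarrow>\<^sub>0 bit"
  by (rule poly_mapping_eqI)
     (auto simp: lookup_sum lookup_single when_def in_keys_iff bit_not_zero_iff sum.delta')

lemma multilinear_expand:
  assumes F: "multilinear F"
  shows "F (map basis ws @ vs) = mext (\<lambda>cs. F (map basis (ws @ cs))) vs"
proof (induction vs arbitrary: ws)
  case (Cons v vs)
  have "F (map basis ws @ (\<Sum>c\<in>S. basis c) # vs) = (\<Sum>c\<in>S. F (map basis ws @ basis c # vs))"
    if "finite S" for S
    using that by induction (simp_all add: multilinear_zero[OF F] multilinearD[OF F])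
  from this[OF finite_keys, of v] have "F (map basis ws @ v # vs) = lin (\<lambda>c. F (map basis ws @ basis c # vs)) v"
    by (simp add: lin_def flip: sum_basis)
  also have "\<dots> = lin (\<lambda>c. mext (\<lambda>cs. F (map basis ((ws @ [c]) @ cs))) vs) v"
    by (simp only: flip: Cons.IH) simp
  finally show ?case by (simp add: mext_Cons)
qed simp

lemma multilinear_ext:
  assumes "multilinear F" "multilinear F'" "\<And>cs. F (map basis cs) = F' (map basis cs)"
  shows "F vs = F' vs"
  using multilinear_expand[OF assms(1), of "[]" vs] multilinear_expand[OF assms(2), of "[]" vs]
  by (simp add: assms(3))

section \<open>The quasi-isomorphism\<close>

lemma muA_simps: "muA [f] = dA f" "muA [f, g] = f ** g" "muA [] = 0" "muA (f # g # h # fs) = 0"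
  by (simp_all add: muA_def dA_def)

lemma muA_length: "length as \<noteq> 1 \<Longrightarrow> length as \<noteq> 2 \<Longrightarrow> muA as = 0"
  by (cases as rule: remdups_adj.cases; cases "tl (tl as)") (auto simp: muA_simps)

lemma multilinear_muA: "multilinear muA"
  unfolding multilinear_def
proof (intro allI)
  fix xs ys :: "Aalg list" and a b
  show "muA (xs @ (a + b) # ys) = muA (xs @ a # ys) + muA (xs @ b # ys)"
  proof (cases "length xs + length ys \<le> 1")
    case True
    then consider "xs = []" "ys = []" | x where "xs = [x]" "ys = []" | y where "xs = []" "ys = [y]"
      by (cases xs; cases ys) auto
    then show ?thesis
      by cases (simp_all add: muA_simps A.d_add A.M_add_left A.M_add_right)
  next
    case False
    then have "muA (xs @ c # ys) = 0" for c
      by (intro muA_length) auto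
    then show ?thesis by simp
  qed
qed

theorem ainf_muA: "ainf_algebra muA"
proof -
  have "cut (\<lambda>u. cut (\<lambda>v x. if v = [] then 0 else muA (u @ muA v # x))) as = 0" if ne: "as \<noteq> []" for as
  proof (cases "length as \<le> 3")
    case True
    then consider f where "as = [f]" | f g where "as = [f, g]" | f g h where "as = [f, g, h]"
      using ne by (cases as; cases "tl as"; cases "tl (tl as)") auto
    then show ?thesis
      by cases (simp_all add: cut_Cons muA_simps A.d_M A.M_assoc ac_simps)
  next
    case False
    have "muA (u @ muA v # x) = 0" if "u @ v @ x = as" "v \<noteq> []" for u v x
    proof (cases "length v \<le> 2")
      case True
      have "length u + length v + length x = length as"
        using arg_cong[OF that(1), of length] by simp
      with False True have "2 < length (u @ muA v # x)" by simp
      then show ?thesis by (intro muA_length) auto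
    next
      case False
      then have "muA v = 0" by (simp add: muA_length)
      then show ?thesis by (simp add: multilinear_zero[OF multilinear_muA])
    qed
    then show ?thesis by (intro cut_neutral) auto
  qed
  then show ?thesis
    unfolding ainf_algebra_def char2_def index_sum_eq_cut
    using multilinear_muA Aalg_char2 by blast
qed

lemma defect_relation: "A.defect A.fb w = 0" "A.relation w = 0"
proof -
  have "p = 0" if "lin (\<lambda>c. A.fb [c]) p = 0" for p
    using lin_fb_boundary[of p 0] that by simp
  from A.defect_relation[OF this] show "A.defect A.fb w = 0" "A.relation w = 0"
    by blast+
qed

lemma muB_mext: "muB = mext (A.val basis)"
  by (rule ext) (simp add: muB_def mext_def muB_basis_eq A.val_def)

lemma multilinear_muB: "multilinear muB"
  unfolding muB_mext by (rule mext_multilinear) (rule bit_add_self)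

text \<open>On basis elements \<open>muB\<close> is zero or one basis element, so insertions stay
  within lists of basis elements.\<close>

lemma insert_muB:
  assumes "multilinear F"
  shows "cut (\<lambda>u. cut (\<lambda>v x. if v = [] then 0 else F (u @ muB v # x))) (map basis cs)
    = A.ins (\<lambda>w. F (map basis w)) cs"
  unfolding A.ins_eq_cut cut_map
proof (intro cut_cong)
  fix u v x z :: "bgen list"
  show "(if map basis v = [] then 0 else F (map basis u @ muB (map basis v) # map basis x)) =
      A.val (\<lambda>c. F (map basis (u @ c # x))) v"
    using multilinear_zero[OF assms] by (cases "mB v") (auto simp: muB_mext A.val_def)
qed

theorem ainf_muB: "ainf_algebra muB"
proof -
  have "cut (\<lambda>u. cut (\<lambda>v x. if v = [] then 0 else muB (u @ muB v # x))) as = 0" for as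
  proof -
    have "cut (\<lambda>u. cut (\<lambda>v x. if v = [] then 0 else muB (u @ muB v # x))) (map basis cs) = 0" for cs
      unfolding insert_muB[OF multilinear_muB]
      using defect_relation(2)[of cs] by (simp add: muB_mext A.relation_def)
    moreover have "multilinear (\<lambda>as :: (bgen \<Rightarrow>\<^sub>0 bit) list. 0 :: bgen \<Rightarrow>\<^sub>0 bit)"
      by (simp add: multilinear_def)
    ultimately show ?thesis
      using multilinear_ext[OF multilinear_nested[OF multilinear_muB multilinear_muB], of "\<lambda>as. 0"] by blast
  qed
  then show ?thesis
    unfolding ainf_algebra_def char2_def index_sum_eq_cut
    using multilinear_muB bit_add_self by blast
qed

definition fAB :: "(bgen \<Rightarrow>\<^sub>0 bit) list \<Rightarrow> Aalg" where
  "fAB = mext A.fb"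

lemma multilinear_fAB: "multilinear fAB"
  unfolding fAB_def by (rule mext_multilinear) simp

lemma fAB_Nil [simp]: "fAB [] = 0"
  by (simp add: fAB_def)

lemma finite_blocks: "finite (blocks as)"
proof -
  let ?A = "{x. set x \<subseteq> set as \<and> length x \<le> length as}"
  have "length ps \<le> length (concat ps)" if "[] \<notin> set ps" for ps :: "'a list list"
    using that
  proof (induction ps)
    case (Cons p ps)
    then show ?case by (cases p) auto
  qed simp
  moreover have "length p \<le> length (concat ps)" if "p \<in> set ps" for p and ps :: "'a list list"
    using that by (induction ps) auto
  ultimately have "blocks as \<subseteq> {ps. set ps \<subseteq> ?A \<and> length ps \<le> length as}"
    by (auto simp: blocks_def)
  moreover have "finite ?A"
    by (rule finite_lists_length_le) simp
  then have "finite {ps. set ps \<subseteq> ?A \<and> length ps \<le> length as}"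
    by (rule finite_lists_length_le)
  ultimately show ?thesis
    by (rule finite_subset)
qed

text \<open>The target has no products above arity two, so only one or two blocks count;
  \<open>f [] = 0\<close> removes the cuts with an empty piece.\<close>

lemma sum_blocks_muA:
  assumes "as \<noteq> []" "f [] = 0"
  shows "(\<Sum>ps\<in>blocks as. muA (map f ps)) = dA (f as) + A.conv f f as"
proof -
  let ?P = "{(u, v) \<in> splits as. u \<noteq> [] \<and> v \<noteq> []}"
  let ?S = "insert [as] ((\<lambda>(u, v). [u, v]) ` ?P)"
  have fin: "finite ?P" by (rule finite_subset[OF _ finite_splits[of as]]) auto
  have "muA (map f ps) = 0" if "ps \<in> blocks as - ?S" for ps
  proof (rule muA_length)
    show "length (map f ps) \<noteq> 1"
      using that by (auto simp: blocks_def length_Suc_conv)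
    show "length (map f ps) \<noteq> 2"
      using that by (auto simp: blocks_def length_Suc_conv numeral_2_eq_2 splits_def)
  qed
  then have "(\<Sum>ps\<in>blocks as. muA (map f ps)) = (\<Sum>ps\<in>?S. muA (map f ps))"
    using assms(1) by (intro sum.mono_neutral_right finite_blocks) (auto simp: blocks_def splits_def)
  also have "\<dots> = dA (f as) + (\<Sum>ps\<in>(\<lambda>(u, v). [u, v]) ` ?P. muA (map f ps))"
    using fin by (subst sum.insert) (auto simp: muA_simps)
  also have "(\<Sum>ps\<in>(\<lambda>(u, v). [u, v]) ` ?P. muA (map f ps)) = (\<Sum>(u, v)\<in>?P. f u ** f v)"
    by (subst sum.reindex) (auto simp: inj_on_def muA_simps o_def split_beta)
  also have "\<dots> = (\<Sum>(u, v)\<in>splits as. f u ** f v)"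
    using assms(2) by (intro sum.mono_neutral_left) auto
  finally show ?thesis
    by (simp add: A.conv_def cut_def)
qed

lemma fAB_single: "fAB [v] = lin (\<lambda>c. A.fb [c]) v"
  by (simp add: fAB_def mext_Cons)

lemma muB_single: "muB [v] = 0"
  by (simp add: muB_mext mext_Cons A.val_def lin_def)

theorem ainf_morphism_fAB: "ainf_morphism muB muA fAB"
proof -
  let ?L = "cut (\<lambda>u. cut (\<lambda>v x. if v = [] then 0 else fAB (u @ muB v # x)))"
  let ?R = "\<lambda>as. dA (fAB as) + A.conv fAB fAB as"
  have conv: "multilinear (A.conv fAB fAB)"
    unfolding A.conv_def
    by (rule multilinear_cut)
       (simp_all add: multilinear_def multilinearD[OF multilinear_fAB] A.M_add_left A.M_add_right)
  have R: "multilinear ?R"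
    unfolding multilinear_def multilinearD[OF multilinear_fAB] multilinearD[OF conv] A.d_add
    by (simp only: ac_simps simp_thms)
  have "?L (map basis cs) = ?R (map basis cs)" for cs
  proof -
    have "A.conv fAB fAB (map basis cs) = A.conv A.fb A.fb cs"
      by (simp add: A.conv_def cut_map fAB_def)
    moreover have "?L (map basis cs) = A.ins A.fb cs"
      by (simp add: insert_muB[OF multilinear_fAB]) (simp add: fAB_def)
    moreover have "dA (A.fb cs) + A.conv A.fb A.fb cs = A.ins A.fb cs"
      by (rule iffD2[OF A.eq_iff_add_zero defect_relation(1)[unfolded A.defect_def]])
    ultimately show ?thesis
      by (simp add: fAB_def)
  qed
  from multilinear_ext[OF multilinear_nested[OF multilinear_fAB multilinear_muB] R this]
  have "?L as = ?R as" for as .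
  then show ?thesis
    unfolding ainf_morphism_def index_sum_eq_cut
    using multilinear_fAB sum_blocks_muA[of _ fAB] by simp
qed

theorem ainf_quasi_iso_fAB: "ainf_quasi_iso muB muA fAB"
  unfolding ainf_quasi_iso_def
proof (intro conjI allI impI)
  show "ainf_morphism muB muA fAB" by (rule ainf_morphism_fAB)
next
  \<comment> \<open>Since \<open>muB\<close> has no differential, injectivity on cohomology means
    that only zero maps to a boundary.\<close>
  fix v assume "\<exists>u. fAB [v] = muA [u]"
  then have "v = 0"
    using lin_fb_boundary by (auto simp: fAB_single muA_simps)
  then show "\<exists>u. v = muB [u]" by (simp add: muB_single)
next
  fix w assume "muA [w] = 0"
  then obtain v u where vu: "lin (\<lambda>c. A.fb [c]) v + w = dA u"
    using cycle_representative[of w] by (auto simp: muA_simps)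
  have w: "- w = w"
    by (rule minus_unique) simp
  have "fAB [v] - w = muA [u]"
    unfolding fAB_single muA_simps diff_conv_add_uminus w vu ..
  then show "\<exists>v u. muB [v] = 0 \<and> fAB [v] - w = muA [u]"
    using muB_single by blast
qed

theorem mainTheorem3:
  shows "ainf_algebra muA \<and> ainf_algebra muB \<and>
         (\<exists>f :: (bgen \<Rightarrow>\<^sub>0 bit) list \<Rightarrow> Aalg. ainf_quasi_iso muB muA f)"
  using ainf_muA ainf_muB ainf_quasi_iso_fAB by blast

end
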